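(* Let $G$ be a $C_2$ graph. Then the following three statements are equivalent: (1) $M(G)=2$; (2) $G$ is a graph of two parallel paths; (3) $G$ is an LSEAC graph.
   Context: All graphs are finite, simple and undirected. For a graph $G$ on vertex set $\{1,\dots,n\}$, $S(G)$ is the set of all real symmetric $n\times n$ matrices $A$ such that for $i\neq j$, $a_{ij}\neq 0$ if and only if $\{i,j\}$ is an edge of $G$ (diagonal entries are unrestricted). $M(G)$ is the maximum, over $A\in S(G)$, of the largest multiplicity of an eigenvalue of $A$; equivalently $M(G)=n-\min\{\operatorname{rank}A : A\in S(G)\}$. A graph is $C_2$ if it is connected and has no vertex of degree less than two. $G$ is a graph of two parallel paths if $G$ is not itself a path and its vertex set can be partitioned into the vertex sets of two vertex-disjoint induced paths $P_1=p_1p_2\cdots p_{k_1}$ and $P_2=q_1q_2\cdots q_{k_2}$ ($k_1,k_2\ge 1$; a single vertex counts as a path) such that the edges between $P_1$ and $P_2$ can be drawn without crossing, i.e. there are no two edges $p_iq_j$ and $p_kq_l$ with $i<k$ and $j>l$ (with respect to suitable orderings of the paths). $G$ need not be connected. A SEAC (singly edge-articulated cycle) graph is a graph built sequentially from cycles: start with a cycle, and at each step attach a new cycle by identifying one of its edges with an edge of the graph built so far; no edge may be used more than once for such an articulation. The constituent cycles and edges of articulation are then well defined; two constituent cycles are neighbors if they share an edge of articulation. A SEAC graph is linear (LSEAC) if each of its constituent cycles has at most two neighbors. A single cycle is an LSEAC graph. *)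

theory Defs
  imports "HOL-Analysis.Analysis"
begin

text \<open>
  A graph is given by its edge set \<open>E :: 'n set set\<close>; its vertex set is the whole
  finite type \<open>'n\<close>, which also indexes the rows and columns of the matrices.
\<close>

definition simple_graph :: "'n set set \<Rightarrow> bool" where
  "simple_graph E \<longleftrightarrow> (\<forall>e\<in>E. card e = 2)"

definition graph_connected :: "'n set set \<Rightarrow> bool" where
  "graph_connected E \<longleftrightarrow> (\<forall>u v. (u, v) \<in> {(x, y). {x, y} \<in> E}\<^sup>*)"

definition vertex_degree :: "'n set set \<Rightarrow> 'n \<Rightarrow> nat" where
  "vertex_degree E v = card {e \<in> E. v \<in> e}"

definition C2_graph :: "'n set set \<Rightarrow> bool" where
  "C2_graph E \<longleftrightarrow> graph_connected E \<and> (\<forall>v. 2 \<le> vertex_degree E v)"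

definition sym_matrices :: "'n::finite set set \<Rightarrow> (real ^ 'n ^ 'n) set" where
  "sym_matrices E =
     {A. transpose A = A \<and> (\<forall>i j. i \<noteq> j \<longrightarrow> (A $ i $ j \<noteq> 0 \<longleftrightarrow> {i, j} \<in> E))}"

definition is_eigenvalue :: "real ^ 'n ^ 'n \<Rightarrow> real \<Rightarrow> bool" where
  "is_eigenvalue A c \<longleftrightarrow> (\<exists>x. x \<noteq> 0 \<and> A *v x = c *\<^sub>R x)"

text \<open>
  For the symmetric matrices considered here, algebraic and geometric multiplicity
  agree, and all eigenvalues are real.
\<close>

definition eig_multiplicity :: "real ^ 'n ^ 'n \<Rightarrow> real \<Rightarrow> nat" where
  "eig_multiplicity A c = dim {x. A *v x = c *\<^sub>R x}"

text \<open>
  The set below is nonempty and bounded by \<open>CARD('n)\<close>, so \<open>Max\<close> is a genuine maximum.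
\<close>

definition max_multiplicity :: "'n::finite set set \<Rightarrow> nat" where
  "max_multiplicity E =
     Max {eig_multiplicity A c | A c. A \<in> sym_matrices E \<and> is_eigenvalue A c}"

text \<open>
  A path is the list of its vertices in order. The equivalence also forbids
  chords, so this says that \<open>set ps\<close> induces a path in the graph.
\<close>

definition induced_path :: "'n set set \<Rightarrow> 'n list \<Rightarrow> bool" where
  "induced_path E ps \<longleftrightarrow> ps \<noteq> [] \<and> distinct ps \<and>
     (\<forall>i < length ps. \<forall>j < length ps.
        {ps ! i, ps ! j} \<in> E \<longleftrightarrow> j = Suc i \<or> i = Suc j)"

definition is_path_graph :: "'n set set \<Rightarrow> bool" where
  "is_path_graph E \<longleftrightarrow> (\<exists>ps. induced_path E ps \<and> set ps = UNIV)"

definition crossing :: "'n set set \<Rightarrow> 'n list \<Rightarrow> 'n list \<Rightarrow> bool" where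
  "crossing E ps qs \<longleftrightarrow>
     (\<exists>i j k l. i < k \<and> k < length ps \<and> l < j \<and> j < length qs \<and>
        {ps ! i, qs ! j} \<in> E \<and> {ps ! k, qs ! l} \<in> E)"

text \<open>
  The suitable orderings of the two paths are chosen by the existential quantifiers,
  since the reversal of an induced path is an induced path.
\<close>

definition two_parallel_paths :: "'n set set \<Rightarrow> bool" where
  "two_parallel_paths E \<longleftrightarrow> \<not> is_path_graph E \<and>
     (\<exists>ps qs. induced_path E ps \<and> induced_path E qs \<and>
        set ps \<inter> set qs = {} \<and> set ps \<union> set qs = UNIV \<and> \<not> crossing E ps qs)"

definition is_cycle :: "'n set set \<Rightarrow> bool" where
  "is_cycle C \<longleftrightarrow> (\<exists>xs. 3 \<le> length xs \<and> distinct xs \<and>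
     C = {{xs ! i, xs ! (Suc i mod length xs)} | i. i < length xs})"

text \<open>
  \<open>seac E Cs As\<close>: the graph with edge set \<open>E\<close> and vertex set \<open>\<Union>E\<close> can be
  built from the constituent cycles \<open>Cs\<close> (given as edge sets) with edges of
  articulation \<open>As\<close>. Identifying an edge of a new cycle with the edge \<open>e\<close> amounts to
  adding a cycle \<open>C\<close> through \<open>e\<close> that meets the old vertices in the two ends of \<open>e\<close> only.
\<close>

inductive seac :: "'n set set \<Rightarrow> 'n set set set \<Rightarrow> 'n set set \<Rightarrow> bool" where
  start: "is_cycle C \<Longrightarrow> seac C {C} {}"
| attach: "seac E Cs As \<Longrightarrow> is_cycle C \<Longrightarrow> e \<in> E \<Longrightarrow> e \<notin> As \<Longrightarrow> e \<in> C \<Longrightarrow>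
     \<Union>E \<inter> \<Union>C = e \<Longrightarrow> seac (E \<union> C) (insert C Cs) (insert e As)"

definition neighbors :: "'n set set \<Rightarrow> 'n set set \<Rightarrow> 'n set set \<Rightarrow> bool" where
  "neighbors As C D \<longleftrightarrow> C \<noteq> D \<and> (\<exists>e\<in>As. e \<in> C \<and> e \<in> D)"

text \<open>
  \<open>Cs\<close> and \<open>As\<close> are determined by \<open>E\<close>, so quantifying them existentially is harmless.
\<close>

definition lseac_graph :: "'n set set \<Rightarrow> bool" where
  "lseac_graph E \<longleftrightarrow> \<Union>E = UNIV \<and>
     (\<exists>Cs As. seac E Cs As \<and> (\<forall>C\<in>Cs. card {D \<in> Cs. neighbors As C D} \<le> 2))"

end

theory Submission imports Defs begin

text \<open>
  The upper bound on the multiplicity is zero forcing: an eigenvector of an LSEAC graph that vanishes on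
  an unused edge of an end cell vanishes along that cell, hence on the next edge of articulation,
  and so on through the chain of cells.

  For the converse we construct matrices of large nullity. Partition the vertices into connected
  branch sets and give the edges inside the branch sets a very large weight. The Schur complement onto one
  representative per branch set is then a small perturbation of the matrix of total weights between
  branch sets, and by Brouwer's theorem the remaining edge weights can be chosen such that the
  prescribed totals are attained exactly. In this way a \<open>K\<^sub>4\<close>-minor, a
  triangle minor with all edges doubled, two vertices joined by three bridges, and a cut vertex in
  a \<open>C\<^sub>2\<close> graph all yield nullity three. A \<open>C\<^sub>2\<close> graph without these configurations has a
  Hamiltonian cycle whose chords are non-crossing and pairwise nested between two of the cycle
  edges; deleting these two edges leaves the two parallel paths. Finally, the
  rungs between two parallel paths are totally ordered, and consecutive rungs bound the cells of an
  LSEAC graph.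
\<close>

section \<open>Prescribed responses between branch sets\<close>

text \<open>Membership in \<open>sym_matrices\<close> demands a nonzero entry on every edge, so an
  edge of the graph cannot be removed by giving it weight zero, and passing to a minor is not an
  operation on these matrices. Hence the exact realization: every edge keeps a nonzero weight, and
  only the Schur complement is prescribed. With weights of size 1/\<epsilon> inside the branch sets,
  the harmonic extension of a representative is close to the indicator of its branch set, so the
  response between two branch sets is close to the sum of the weights between them; the error is
  absorbed by a small correction of these weights, found as a fixed point. A total of zero is
  compatible with nonzero weights only if at least two edges join the branch sets, which is why
  edges are doubled when the target is the zero matrix. The kernel dimension is that of the small
  target matrix: the zero matrix of order 3, the all-ones matrix of order 4 and a rank-two matrix of
  order 5 all have nullity 3. Pairs of branch sets without an edge stay outside the fixed-point
  argument; there the response vanishes by separation or is matched on the diagonal.\<close>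

lemma norm_matrix_vector_bound:
  fixes A :: "real^'n^'n"
  assumes "\<And>i j. \<bar>A $ i $ j\<bar> \<le> b"
  shows "norm (A *v x) \<le> real CARD('n) * real CARD('n) * b * norm x"
proof -
  have "norm (A *v x) \<le> onorm ((*v) A) * norm x"
    by (rule onorm) (simp add: matrix_vector_mul_bounded_linear)
  also have "\<dots> \<le> real CARD('n) * real CARD('n) * b * norm x"
    by (intro mult_right_mono onorm_le_matrix_component assms) auto
  finally show ?thesis .
qed

lemma norm_le_component_bound:
  fixes x :: "real^'n"
  assumes "\<And>i. \<bar>x $ i\<bar> \<le> b"
  shows "norm x \<le> real CARD('n) * b"
proof -
  have "norm x \<le> (\<Sum>i\<in>UNIV. \<bar>x $ i\<bar>)" by (rule norm_le_l1_cart)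
  also have "\<dots> \<le> (\<Sum>i\<in>(UNIV::'n set). b)" by (intro sum_mono assms)
  finally show ?thesis by simp
qed

text \<open>The Dirichlet problem with boundary \<open>K\<close> as one square operator: boundary
  values in the rows of \<open>K\<close>, equations elsewhere. Unique solvability then is
  injectivity of a linear endomorphism.\<close>

definition dirichlet :: "'n::finite set \<Rightarrow> real^'n^'n \<Rightarrow> real^'n \<Rightarrow> real^'n" where
  "dirichlet K M x = (\<chi> u. if u \<in> K then x $ u else (M *v x) $ u)"

lemma dirichlet_nth [simp]: "dirichlet K M x $ u = (if u \<in> K then x $ u else (M *v x) $ u)"
  by (simp add: dirichlet_def)

lemma linear_dirichlet: "linear (dirichlet K M)"
  by (rule linearI) (auto simp: vec_eq_iff matrix_vector_right_distrib matrix_vector_mult_scaleR)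

lemma dirichlet_bounded_below:
  fixes L :: "real^'n^'n"
  assumes "\<And>x. dirichlet K L x = 0 \<Longrightarrow> x = 0"
  obtains c where "c > 0" "\<And>x. c * norm x \<le> norm (dirichlet K L x)"
proof -
  have "inj (dirichlet K L)"
    using assms linear_injective_0[OF linear_dirichlet] by blast
  from linear_inj_bounded_below_pos[OF linear_dirichlet this] show thesis using that by metis
qed

text \<open>Reverse triangle inequality: the perturbation enters only the rows off \<open>K\<close>
  and consumes at most half of the constant \<open>c\<close>.\<close>

lemma dirichlet_perturbed_bounded_below:
  fixes L B :: "real^'n^'n"
  assumes c: "\<And>x. c * norm x \<le> norm (dirichlet K L x)"
    and b: "\<And>x. norm (B *v x) \<le> b * norm x" and e: "e \<ge> 0" "e * b \<le> c / 2"
  shows "c / 2 * norm x \<le> norm (dirichlet K (L + e *\<^sub>R B) x)"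
proof -
  have eq: "dirichlet K (L + e *\<^sub>R B) x - dirichlet K L x = (\<chi> u. if u \<in> K then 0 else e * (B *v x) $ u)"
    by (simp add: vec_eq_iff matrix_vector_mult_add_rdistrib scaleR_matrix_vector_assoc[symmetric])
  have "norm (dirichlet K (L + e *\<^sub>R B) x - dirichlet K L x) \<le> norm (e *\<^sub>R (B *v x))"
    unfolding eq by (intro norm_le_componentwise_cart) auto
  also have "\<dots> \<le> e * (b * norm x)" using b e by (simp add: mult_left_mono)
  also have "\<dots> \<le> c / 2 * norm x" using e(2) by (metis mult.assoc mult_right_mono norm_ge_zero)
  finally have "norm (dirichlet K (L + e *\<^sub>R B) x - dirichlet K L x) \<le> c / 2 * norm x" .
  moreover have "norm (dirichlet K L x) \<le> norm (dirichlet K (L + e *\<^sub>R B) x) 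
      + norm (dirichlet K (L + e *\<^sub>R B) x - dirichlet K L x)"
    by norm
  ultimately show ?thesis using c[of x] by (simp add: field_simps)
qed

text \<open>All elements but one get the same value \<open>a\<close>, and the last one balances the
  sum. One of the values 1 and 2 leaves a nonzero balance.\<close>

lemma prescribed_sum_nonzero:
  fixes t :: real
  assumes "finite M" "M \<noteq> {}" "t \<noteq> 0 \<or> 2 \<le> card M"
  obtains g where "\<forall>e\<in>M. g e \<noteq> (0::real)" "sum g M = t"
proof -
  obtain e0 where e0: "e0 \<in> M" using assms by auto
  obtain a :: real where a: "a \<noteq> 0" "t - a * real (card (M - {e0})) \<noteq> 0"
  proof (cases "t = 0")
    case True
    then have "card (M - {e0}) \<noteq> 0" using assms e0 by (simp add: card_Diff_singleton)
    then show ?thesis using that[of 1] True by auto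
  next
    case False
    show ?thesis
    proof (cases "t = real (card (M - {e0}))")
      case True
      then show ?thesis using that[of 2] False by auto
    next
      case False
      then show ?thesis using that[of 1] by auto
    qed
  qed
  let ?g = "\<lambda>e. if e = e0 then t - a * real (card (M - {e0})) else a"
  have "sum ?g M = ?g e0 + sum ?g (M - {e0})" using assms(1) e0 by (rule sum.remove)
  also have "sum ?g (M - {e0}) = sum (\<lambda>_. a) (M - {e0})" by (intro sum.cong) auto
  finally have "sum ?g M = t" by simp
  then show thesis using that[of ?g] a by auto
qed

section \<open>Laplacian of the branch sets and the weights between them\<close>

locale branching =
  fixes E :: "'n::finite set set" and \<rho> :: "'n \<Rightarrow> 'n"
  assumes simple: "simple_graph E"
    and idem: "\<And>v. \<rho> (\<rho> v) = \<rho> v"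
    and fibre_connected: "\<And>v. (v, \<rho> v) \<in> {(a, b). {a, b} \<in> E \<and> \<rho> a = \<rho> b}\<^sup>*"
begin

definition intra :: "'n \<Rightarrow> 'n \<Rightarrow> bool" where
  "intra u v \<longleftrightarrow> {u, v} \<in> E \<and> \<rho> u = \<rho> v"

definition lap :: "real^'n^'n" where
  "lap = (\<chi> u v. if u = v then real (card {w. intra u w}) else if intra u v then -1 else 0)"

text \<open>\<open>\<gamma>\<close> is the fixed base weight of an edge and \<open>t\<close> the
  correction still to be found. Symmetrizing \<open>t\<close> makes the matrix symmetric for every
  \<open>t\<close>, so the correction may range over a full ball, as Brouwer's theorem
  needs.\<close>

definition cross :: "('n set \<Rightarrow> real) \<Rightarrow> real^'n^'n \<Rightarrow> real^'n^'n" where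
  "cross \<gamma> t = (\<chi> u v. if {u, v} \<in> E \<and> \<rho> u \<noteq> \<rho> v
      then \<gamma> {u, v} + (t $ \<rho> u $ \<rho> v + t $ \<rho> v $ \<rho> u) / 2 else 0)"

definition ind :: "'n \<Rightarrow> real^'n" where
  "ind s = (\<chi> v. if \<rho> v = s then 1 else 0)"

definition between :: "'n \<Rightarrow> 'n \<Rightarrow> 'n set set" where
  "between r s = {e \<in> E. \<rho> ` e = {r, s}}"

lemma not_loop: "{u, u} \<notin> E"
  using simple by (auto simp: simple_graph_def)

lemma intra_sym: "intra u v \<longleftrightarrow> intra v u"
  by (auto simp: intra_def insert_commute)

lemma intra_irrefl: "\<not> intra u u"
  using not_loop by (auto simp: intra_def)

lemma lap_apply: "(lap *v x) $ u = (\<Sum>w | intra u w. x $ u - x $ w)"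
proof -
  have "(lap *v x) $ u = (\<Sum>v\<in>UNIV. (if v = u then real (card {w. intra u w}) * x $ u else 0) 
       + (if intra u v then - x $ v else 0))"
    unfolding matrix_vector_mult_def lap_def
    by (simp, intro sum.cong) (auto simp: intra_irrefl)
  also have "\<dots> = real (card {w. intra u w}) * x $ u - (\<Sum>w | intra u w. x $ w)"
    by (simp add: sum.distrib sum.If_cases sum_negf)
  finally show ?thesis by (simp add: sum_subtractf)
qed

lemma lap_sym: "lap $ u $ v = lap $ v $ u"
  by (simp add: lap_def intra_sym)

text \<open>The Dirichlet energy of the graph inside the branch sets; the sum runs over ordered
  pairs, hence the half.\<close>

lemma lap_energy: "(\<Sum>u\<in>UNIV. x $ u * (lap *v x) $ u) = (\<Sum>(u, w) | intra u w. (x $ u - x $ w)\<^sup>2) / 2"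
proof -
  let ?S = "{(u, w). intra u w}"
  have 1: "(\<Sum>u\<in>UNIV. x $ u * (lap *v x) $ u) = (\<Sum>(u, w)\<in>?S. x $ u * (x $ u - x $ w))"
  proof -
    have "?S = Sigma UNIV (\<lambda>u. {w. intra u w})" by auto
    then show ?thesis by (simp add: lap_apply sum_distrib_left sum.Sigma)
  qed
  have 2: "(\<Sum>(u, w)\<in>?S. x $ u * (x $ u - x $ w)) = (\<Sum>(u, w)\<in>?S. x $ w * (x $ w - x $ u))"
    by (rule sum.reindex_bij_witness[of _ prod.swap prod.swap]) (auto simp: intra_sym)
  have "2 * (\<Sum>(u, w)\<in>?S. x $ u * (x $ u - x $ w)) = 
      (\<Sum>(u, w)\<in>?S. x $ u * (x $ u - x $ w)) + (\<Sum>(u, w)\<in>?S. x $ w * (x $ w - x $ u))"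
    using 2 by simp
  also have "\<dots> = (\<Sum>(u, w)\<in>?S. (x $ u - x $ w)\<^sup>2)"
    unfolding sum.distrib[symmetric] by (intro sum.cong) (auto simp: algebra_simps power2_eq_square)
  finally show ?thesis using 1 by simp
qed

lemma constant_on_fibres:
  assumes "\<And>u w. intra u w \<Longrightarrow> x $ u = x $ w"
  shows "x $ v = x $ \<rho> v"
  using fibre_connected[of v]
proof (induction rule: rtrancl_induct)
  case (step y z)
  then show ?case using assms[of y z] by (auto simp: intra_def)
qed simp

text \<open>A solution with zero data has zero energy, so it is constant on each connected fibre and
  equals its value at the representative, which is zero.\<close>

lemma dirichlet_lap_injective:
  assumes "dirichlet (range \<rho>) lap x = 0"
  shows "x = 0"
proof -
  have 0: "x $ u = 0" if "u \<in> range \<rho>" for u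
    using assms that by (simp add: vec_eq_iff) metis
  have 1: "(lap *v x) $ u = 0" if "u \<notin> range \<rho>" for u
    using assms that by (simp add: vec_eq_iff) metis
  have "(\<Sum>u\<in>UNIV. x $ u * (lap *v x) $ u) = 0"
    using 0 1 by (intro sum.neutral) (metis mult_eq_0_iff)
  then have "(\<Sum>(u, w) | intra u w. (x $ u - x $ w)\<^sup>2) = 0"
    by (simp add: lap_energy)
  then have "\<forall>p\<in>{(u, w). intra u w}. (case p of (u, w) \<Rightarrow> (x $ u - x $ w)\<^sup>2) = 0"
    by (subst (asm) sum_nonneg_eq_0_iff) auto
  then have "x $ u = x $ w" if "intra u w" for u w using that by auto
  then have "x $ v = x $ \<rho> v" for v by (rule constant_on_fibres)
  then show ?thesis using 0 by (simp add: vec_eq_iff)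
qed

lemma lap_ind: "lap *v ind s = 0"
  by (auto simp: vec_eq_iff lap_apply ind_def intra_def intro!: sum.neutral)

text \<open>Pair with the indicator of the fibre, which the symmetric matrix \<open>lap\<close>
  annihilates. Summing over a fibre thus removes the large weights from a response.\<close>

lemma lap_fibre_sum: "(\<Sum>u | \<rho> u = r. (lap *v x) $ u) = 0"
proof -
  have "(\<Sum>u | \<rho> u = r. (lap *v x) $ u) = (\<Sum>u\<in>UNIV. ind r $ u * (lap *v x) $ u)"
    by (simp add: ind_def sum.If_cases if_distrib[of "\<lambda>a. a * _"] cong: if_cong)
  also have "\<dots> = ind r \<bullet> (lap *v x)" by (simp add: inner_vec_def)
  also have "\<dots> = (lap *v ind r) \<bullet> x"
  proof -
    have "transpose lap = lap" using lap_sym by (simp add: transpose_def vec_eq_iff)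
    then show ?thesis by (metis dot_lmul_matrix transpose_matrix_vector)
  qed
  finally show ?thesis by (simp add: lap_ind)
qed

lemma cross_sym: "cross \<gamma> t $ u $ v = cross \<gamma> t $ v $ u"
  by (auto simp: cross_def insert_commute add.commute)

text \<open>Since \<open>r\<close> and \<open>s\<close> differ, each edge between the two fibres
  arises from exactly one ordered pair.\<close>

lemma sum_between:
  fixes g :: "'n set \<Rightarrow> real"
  assumes "r \<noteq> s"
  shows "(\<Sum>u | \<rho> u = r. (\<Sum>v | \<rho> v = s. if {u, v} \<in> E then g {u, v} else 0)) = sum g (between r s)"
proof -
  let ?S = "{(u, v). \<rho> u = r \<and> \<rho> v = s \<and> {u, v} \<in> E}"
  have "(\<Sum>u | \<rho> u = r. (\<Sum>v | \<rho> v = s. if {u, v} \<in> E then g {u, v} else (0::real)))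
      = (\<Sum>(u, v)\<in>{u. \<rho> u = r} \<times> {v. \<rho> v = s}. if {u, v} \<in> E then g {u, v} else 0)"
    by (simp add: sum.cartesian_product)
  also have "\<dots> = (\<Sum>(u, v)\<in>?S. g {u, v})"
    by (intro sum.mono_neutral_cong_right) (auto split: if_splits)
  also have "\<dots> = sum g (between r s)"
  proof (rule sum.reindex_bij_betw[of "\<lambda>(u, v). {u, v}" ?S "between r s" g, symmetric, THEN sym, THEN trans[rotated]])
    show "bij_betw (\<lambda>(u, v). {u, v}) ?S (between r s)"
      unfolding bij_betw_def
    proof
      show "inj_on (\<lambda>(u, v). {u, v}) ?S"
        using assms by (auto simp: inj_on_def doubleton_eq_iff)
      show "(\<lambda>(u, v). {u, v}) ` ?S = between r s"
      proof
        show "(\<lambda>(u, v). {u, v}) ` ?S \<subseteq> between r s" by (auto simp: between_def)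
        show "between r s \<subseteq> (\<lambda>(u, v). {u, v}) ` ?S"
        proof
          fix e assume "e \<in> between r s"
          then have e: "e \<in> E" "\<rho> ` e = {r, s}" by (auto simp: between_def)
          then obtain u v where uv: "e = {u, v}"
            using simple by (metis card_2_iff simple_graph_def)
          then have "(\<rho> u = r \<and> \<rho> v = s) \<or> (\<rho> u = s \<and> \<rho> v = r)"
            using e(2) by (auto simp: doubleton_eq_iff)
          then have "(u, v) \<in> ?S \<or> (v, u) \<in> ?S" using e uv by (auto simp: insert_commute)
          then show "e \<in> (\<lambda>(u, v). {u, v}) ` ?S" using uv by (force simp: insert_commute)
        qed
      qed
    qed
  qed (auto intro!: sum.cong)
  finally show ?thesis .
qed

lemma cross_response:
  assumes "r \<noteq> s"
  shows "(\<Sum>u | \<rho> u = r. (cross \<gamma> t *v ind s) $ u)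
     = sum \<gamma> (between r s) + real (card (between r s)) * ((t $ r $ s + t $ s $ r) / 2)"
proof -
  let ?g = "\<lambda>e. \<gamma> e + (t $ r $ s + t $ s $ r) / 2"
  have "(\<Sum>u | \<rho> u = r. (cross \<gamma> t *v ind s) $ u) = 
     (\<Sum>u | \<rho> u = r. (\<Sum>v | \<rho> v = s. if {u, v} \<in> E then ?g {u, v} else 0))"
  proof (rule sum.cong)
    fix u assume "u \<in> {u. \<rho> u = r}"
    then show "(cross \<gamma> t *v ind s) $ u = (\<Sum>v | \<rho> v = s. if {u, v} \<in> E then ?g {u, v} else 0)"
      using assms by (auto simp: matrix_vector_mult_def ind_def cross_def 
          intro!: sum.mono_neutral_cong_right split: if_splits)
  qed simp
  also have "\<dots> = sum ?g (between r s)" by (rule sum_between[OF assms])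
  finally show ?thesis by (simp add: sum.distrib)
qed

text \<open>Different pairs of branch sets have disjoint edge sets, so the weights are chosen pair
  by pair. Each edge looks up the choice belonging to its own image under
  \<open>\<rho>\<close>.\<close>

lemma weights_exist:
  fixes T :: "'n set \<Rightarrow> real"
  assumes "\<And>r s. r \<noteq> s \<Longrightarrow> between r s \<noteq> {} \<Longrightarrow> T {r, s} \<noteq> 0 \<or> 2 \<le> card (between r s)"
  obtains \<gamma> where "\<And>r s e. r \<noteq> s \<Longrightarrow> e \<in> between r s \<Longrightarrow> \<gamma> e \<noteq> 0"
    "\<And>r s. r \<noteq> s \<Longrightarrow> between r s \<noteq> {} \<Longrightarrow> sum \<gamma> (between r s) = T {r, s}"
proof -
  have "\<exists>g. \<forall>r s. P = {r, s} \<longrightarrow> r \<noteq> s \<longrightarrow> between r s \<noteq> {} \<longrightarrow> 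
     (\<forall>e\<in>between r s. g e \<noteq> 0) \<and> sum g (between r s) = T P" for P
  proof (cases "\<exists>r s. P = {r, s} \<and> r \<noteq> s \<and> between r s \<noteq> {}")
    case True
    then obtain r s where rs: "P = {r, s}" "r \<noteq> s" "between r s \<noteq> {}" by auto
    from prescribed_sum_nonzero[OF _ rs(3), of "T P"] assms[OF rs(2,3)] rs(1)
    obtain g where "\<forall>e\<in>between r s. g e \<noteq> 0" "sum g (between r s) = T P" by auto
    moreover have "between r' s' = between r s" if "P = {r', s'}" for r' s'
      using that rs(1) by (auto simp: between_def)
    ultimately show ?thesis by metis
  qed auto
  then obtain G where G: "\<And>P r s. P = {r, s} \<Longrightarrow> r \<noteq> s \<Longrightarrow> between r s \<noteq> {} \<Longrightarrow> 
     (\<forall>e\<in>between r s. G P e \<noteq> 0) \<and> sum (G P) (between r s) = T P" by metis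
  let ?\<gamma> = "\<lambda>e. G (\<rho> ` e) e"
  have *: "?\<gamma> e = G {r, s} e" if "e \<in> between r s" for r s e
    using that by (simp add: between_def)
  show thesis
  proof (rule that[of ?\<gamma>])
    show "?\<gamma> e \<noteq> 0" if "r \<noteq> s" "e \<in> between r s" for r s e
      using G[of "{r, s}" r s] * that by auto
    show "sum ?\<gamma> (between r s) = T {r, s}" if "r \<noteq> s" "between r s \<noteq> {}" for r s
      using G[of "{r, s}" r s] * that by auto
  qed
qed

lemma cross_bound:
  assumes "\<And>e. e \<in> E \<Longrightarrow> \<bar>\<gamma> e\<bar> + 1 \<le> g" "norm t \<le> 1" "g \<ge> 1"
  shows "norm (cross \<gamma> t *v x) \<le> real CARD('n) * real CARD('n) * g * norm x"
proof (rule norm_matrix_vector_bound)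
  have t: "\<bar>t $ r $ s\<bar> \<le> 1" for r s
    using assms(2)
    by (metis Finite_Cartesian_Product.norm_nth_le order_trans real_norm_def)
  fix i j
  show "\<bar>cross \<gamma> t $ i $ j\<bar> \<le> g"
  proof (cases "{i, j} \<in> E")
    case True
    have "\<bar>(t $ \<rho> i $ \<rho> j + t $ \<rho> j $ \<rho> i) / 2\<bar> \<le> 1" 
      using t[of "\<rho> i" "\<rho> j"] t[of "\<rho> j" "\<rho> i"] by (simp add: abs_le_iff)
    then have "\<bar>\<gamma> {i, j} + (t $ \<rho> i $ \<rho> j + t $ \<rho> j $ \<rho> i) / 2\<bar> \<le> g"
      using assms(1)[OF True] abs_triangle_ineq[of "\<gamma> {i, j}" "(t $ \<rho> i $ \<rho> j + t $ \<rho> j $ \<rho> i) / 2"]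
      by linarith
    then show ?thesis using assms(3) by (auto simp: cross_def)
  qed (use assms(3) in \<open>auto simp: cross_def\<close>)
qed

text \<open>The quantitative form of continuity in \<open>t\<close> that makes the harmonic
  extensions Lipschitz in \<open>t\<close>.\<close>

lemma cross_lipschitz:
  "norm ((cross \<gamma> t - cross \<gamma> t') *v x) \<le> real CARD('n) * real CARD('n) * norm (t - t') * norm x"
proof (rule norm_matrix_vector_bound)
  have t: "\<bar>(t - t') $ r $ s\<bar> \<le> norm (t - t')" for r s
    by (metis Finite_Cartesian_Product.norm_nth_le order_trans real_norm_def)
  fix i j
  show "\<bar>(cross \<gamma> t - cross \<gamma> t') $ i $ j\<bar> \<le> norm (t - t')"
    using t[of "\<rho> i" "\<rho> j"] t[of "\<rho> j" "\<rho> i"] by (auto simp: cross_def field_simps)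
qed

lemma continuous_cross:
  "continuous_on S (\<lambda>t. cross \<gamma> t $ u $ v)"
  by (cases "{u, v} \<in> E \<and> \<rho> u \<noteq> \<rho> v")
     (auto simp: cross_def intro!: continuous_intros)

lemma norm_ind: "norm (ind s) \<le> real CARD('n)"
  using norm_le_component_bound[of "ind s" 1] by (auto simp: ind_def)

lemma between_commute: "between r s = between s r"
  by (auto simp: between_def)

text \<open>\<open>h s\<close> is the \<open>A\<close>-harmonic extension of the unit boundary value
  at \<open>s\<close>, and \<open>(A *v h s) $ r\<close> is the \<open>(r, s)\<close> entry of the
  Schur complement of \<open>A\<close> onto the representatives. Singletons \<open>{r, r}\<close>
  make \<open>T\<close> prescribe the diagonal too. The last clause is uniqueness of the Dirichlet
  problem, from which separation arguments draw.\<close>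

definition response_matrix :: "real^'n^'n \<Rightarrow> ('n \<Rightarrow> real^'n) \<Rightarrow> ('n set \<Rightarrow> real) \<Rightarrow> bool" where
  "response_matrix A h T \<longleftrightarrow> A \<in> sym_matrices E \<and>
    (\<forall>t\<in>range \<rho>. \<forall>s\<in>range \<rho>. h s $ t = (if t = s then 1 else 0)) \<and>
    (\<forall>s\<in>range \<rho>. \<forall>v. v \<notin> range \<rho> \<longrightarrow> (A *v h s) $ v = 0) \<and>
    (\<forall>r\<in>range \<rho>. \<forall>s\<in>range \<rho>. r = s \<or> between r s \<noteq> {} \<longrightarrow> (A *v h s) $ r = T {r, s}) \<and>
    (\<forall>y. (\<forall>u\<in>range \<rho>. y $ u = 0) \<longrightarrow> (\<forall>u. u \<notin> range \<rho> \<longrightarrow> (A *v y) $ u = 0) \<longrightarrow> y = 0)"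

text \<open>Base weights with the right totals give the right responses up to an error of order
  \<epsilon>. A fixed point in a small ball of corrections removes this error, and the ball is too
  small for any weight to reach zero.\<close>

lemma response_exists:
  fixes T :: "'n set \<Rightarrow> real"
  assumes tgt: "\<And>r s. r \<noteq> s \<Longrightarrow> between r s \<noteq> {} \<Longrightarrow> T {r, s} \<noteq> 0 \<or> 2 \<le> card (between r s)"
  shows "\<exists>A h. response_matrix A h T"
proof -
  let ?K = "range \<rho>" and ?N = "real CARD('n)"
  have N: "?N \<ge> 1" by (simp add: Suc_le_eq)
  obtain \<gamma> where \<gamma>0: "\<And>r s e. r \<noteq> s \<Longrightarrow> e \<in> between r s \<Longrightarrow> \<gamma> e \<noteq> 0"
    and \<gamma>T: "\<And>r s. r \<noteq> s \<Longrightarrow> between r s \<noteq> {} \<Longrightarrow> sum \<gamma> (between r s) = T {r, s}"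
    using weights_exist[OF tgt] by metis
  define X where "X = {e. \<exists>r s. r \<noteq> s \<and> e \<in> between r s}"
  \<comment> \<open>The radius of the ball of corrections: strictly below every base weight in
    absolute value, so that no corrected weight vanishes, and at most 1, so that \<open>g\<close>
    below bounds all corrected weights.\<close>
  obtain \<eta> where \<eta>: "0 < \<eta>" "\<eta> \<le> 1" "\<And>e. e \<in> X \<Longrightarrow> \<eta> < \<bar>\<gamma> e\<bar>"
  proof -
    let ?m = "Min (insert 1 ((\<lambda>e. \<bar>\<gamma> e\<bar>) ` X))"
    have "?m > 0" using \<gamma>0 by (subst Min_gr_iff) (auto simp: X_def)
    moreover have "?m \<le> \<bar>\<gamma> e\<bar>" if "e \<in> X" for e using that by (intro Min_le) auto
    moreover have "?m \<le> 1" by (intro Min_le) auto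
    ultimately show thesis
      using that[of "?m / 2"] by (smt (verit) field_sum_of_halves)
  qed
  define g where "g = 1 + (\<Sum>e\<in>E. \<bar>\<gamma> e\<bar>)"
  have g1: "g \<ge> 1" by (simp add: g_def sum_nonneg)
  have gE: "\<bar>\<gamma> e\<bar> + 1 \<le> g" if "e \<in> E" for e
    using member_le_sum[OF that, of "\<lambda>e. \<bar>\<gamma> e\<bar>"] by (simp add: g_def)
  define b where "b = ?N * ?N * g"
  have b0: "b > 0" using g1 N by (simp add: b_def)
  have cb: "norm (cross \<gamma> t *v x) \<le> b * norm x" if "norm t \<le> \<eta>" for t x
    unfolding b_def by (rule cross_bound) (use gE g1 that \<eta> in auto)
  obtain c where c: "c > 0" "\<And>x. c * norm x \<le> norm (dirichlet ?K lap x)"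
    using dirichlet_bounded_below[of ?K lap] dirichlet_lap_injective by metis
  \<comment> \<open>The constant in front of \<epsilon> in the error of a response:
    \<open>2 / c * b * ?N\<close> comes from \<open>h_near\<close>, a factor \<open>b\<close> from
    applying \<open>cross\<close>, and \<open>?N\<close> from summing over a fibre.\<close>
  define k where "k = ?N * (b * (2 / c * b * ?N))"
  have k0: "k > 0" using b0 c N by (simp add: k_def)
  \<comment> \<open>The first bound keeps the Dirichlet problem solvable with constant
    \<open>c / 2\<close>; the second makes each response accurate to \<eta> divided by the number of
    matrix entries, so that the map \<open>F\<close> stays inside the ball.\<close>
  define \<epsilon> where "\<epsilon> = min (c / 2 / b) (\<eta> / (?N * ?N) / k)"
  have \<epsilon>0: "\<epsilon> > 0" using b0 c k0 N \<eta> by (simp add: \<epsilon>_def)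
  have \<epsilon>1: "\<epsilon> * b \<le> c / 2"
  proof -
    have "\<epsilon> * b \<le> (c / 2 / b) * b" using b0 by (intro mult_right_mono) (auto simp: \<epsilon>_def)
    then show ?thesis using b0 by simp
  qed
  have \<epsilon>2: "\<epsilon> * k \<le> \<eta> / (?N * ?N)"
  proof -
    have "\<epsilon> * k \<le> (\<eta> / (?N * ?N) / k) * k" using k0 by (intro mult_right_mono) (auto simp: \<epsilon>_def)
    then show ?thesis using k0 by simp
  qed
  define M where "M t = lap + \<epsilon> *\<^sub>R cross \<gamma> t" for t
  have M: "c / 2 * norm x \<le> norm (dirichlet ?K (M t) x)" if "norm t \<le> \<eta>" for t x
    unfolding M_def by (rule dirichlet_perturbed_bounded_below[OF c(2) cb[OF that]]) (use \<epsilon>0 \<epsilon>1 in auto)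
  have M': "norm x \<le> 2 / c * norm (dirichlet ?K (M t) x)" if "norm t \<le> \<eta>" for t x
    using M[OF that, of x] c(1) by (simp add: field_simps)
  have Minj: "x = 0" if "norm t \<le> \<eta>" "dirichlet ?K (M t) x = 0" for t x
    using M[OF that(1), of x] that(2) c(1) by (simp add: mult_le_0_iff)
  define h where "h t s = inv (dirichlet ?K (M t)) (axis s 1)" for t s
  have h: "dirichlet ?K (M t) (h t s) = axis s 1" if "norm t \<le> \<eta>" for t s
  proof -
    have "inj (dirichlet ?K (M t))"
      using Minj[OF that] linear_injective_0[OF linear_dirichlet] by blast
    then have "surj (dirichlet ?K (M t))"
      using linear_injective_imp_surjective[OF linear_dirichlet] by blast
    then show ?thesis unfolding h_def by (rule surj_f_inv_f)
  qed
  have hK: "h t s $ u = (if u = s then 1 else 0)" if "norm t \<le> \<eta>" "u \<in> ?K" for t s u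
    using arg_cong[OF h[OF that(1), of s], of "\<lambda>x. x $ u"] that(2) by (simp add: axis_def)
  have hM: "(M t *v h t s) $ u = 0" if "norm t \<le> \<eta>" "u \<notin> ?K" "s \<in> ?K" for t s u
    using arg_cong[OF h[OF that(1), of s], of "\<lambda>x. x $ u"] that(2,3) by (auto simp: axis_def)
  have hn: "norm (h t s) \<le> 2 / c" if "norm t \<le> \<eta>" for t s
    using M'[OF that, of "h t s"] h[OF that, of s] by simp
  have lap_ind': "(lap *v (\<chi> v. if \<rho> v = s then 1 else 0)) $ u = 0" for s u
    using lap_ind[of s] by (simp add: ind_def)
  \<comment> \<open>The indicator of the fibre has the same boundary values, and \<open>lap\<close>
    annihilates it, so its residual consists of the \<epsilon>-term alone.\<close>
  have h_near: "norm (h t s - ind s) \<le> 2 / c * (\<epsilon> * b * ?N)" if t: "norm t \<le> \<eta>" and s: "s \<in> ?K" for t s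
  proof -
    have "dirichlet ?K (M t) (h t s - ind s) = axis s 1 - dirichlet ?K (M t) (ind s)"
      using h[OF t] linear_diff[OF linear_dirichlet] by metis
    also have "\<dots> = (\<chi> u. if u \<in> ?K then 0 else - (\<epsilon> * (cross \<gamma> t *v ind s) $ u))"
      using s by (auto simp: vec_eq_iff M_def matrix_vector_mult_add_rdistrib lap_ind' axis_def ind_def idem
          scaleR_matrix_vector_assoc[symmetric])
    finally have eq: "dirichlet ?K (M t) (h t s - ind s) = 
        (\<chi> u. if u \<in> ?K then 0 else - (\<epsilon> * (cross \<gamma> t *v ind s) $ u))" .
    have "norm (dirichlet ?K (M t) (h t s - ind s)) \<le> norm (\<epsilon> *\<^sub>R (cross \<gamma> t *v ind s))"
      unfolding eq by (intro norm_le_componentwise_cart) auto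
    also have "\<dots> \<le> \<epsilon> * (b * norm (ind s))" using \<epsilon>0 cb[OF t, of "ind s"] by simp
    also have "\<dots> \<le> \<epsilon> * (b * ?N)" using \<epsilon>0 b0 norm_ind by simp
    finally have "norm (dirichlet ?K (M t) (h t s - ind s)) \<le> \<epsilon> * b * ?N" by (simp add: mult.assoc)
    then have "2 / c * norm (dirichlet ?K (M t) (h t s - ind s)) \<le> 2 / c * (\<epsilon> * b * ?N)"
      using c(1) by (intro mult_left_mono) auto
    then show ?thesis using M'[OF t, of "h t s - ind s"] by linarith
  qed
  have h_cont: "continuous_on (cball 0 \<eta>) (\<lambda>t. h t s)" for s
  proof -
    define C where "C = 2 / c * (\<epsilon> * (?N * ?N * (2 / c)))"
    have "C-lipschitz_on (cball 0 \<eta>) (\<lambda>t. h t s)"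
    proof (rule lipschitz_onI)
      show "C \<ge> 0" using c \<epsilon>0 by (simp add: C_def)
      fix t t' :: "real^'n^'n" assume "t \<in> cball 0 \<eta>" "t' \<in> cball 0 \<eta>"
      then have t: "norm t \<le> \<eta>" "norm t' \<le> \<eta>" by auto
      have "dirichlet ?K (M t) (h t s - h t' s) = dirichlet ?K (M t') (h t' s) - dirichlet ?K (M t) (h t' s)"
        using h[OF t(1)] h[OF t(2)] linear_diff[OF linear_dirichlet] by metis
      also have "\<dots> = (\<chi> u. if u \<in> ?K then 0 else \<epsilon> * ((cross \<gamma> t' - cross \<gamma> t) *v h t' s) $ u)"
        by (simp add: vec_eq_iff M_def matrix_vector_mult_add_rdistrib matrix_vector_mult_diff_rdistrib
          scaleR_matrix_vector_assoc[symmetric] right_diff_distrib)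
      finally have eq: "dirichlet ?K (M t) (h t s - h t' s) = 
         (\<chi> u. if u \<in> ?K then 0 else \<epsilon> * ((cross \<gamma> t' - cross \<gamma> t) *v h t' s) $ u)" .
      have "norm (dirichlet ?K (M t) (h t s - h t' s)) \<le> norm (\<epsilon> *\<^sub>R ((cross \<gamma> t' - cross \<gamma> t) *v h t' s))"
        unfolding eq by (intro norm_le_componentwise_cart) auto
      also have "\<dots> \<le> \<epsilon> * (?N * ?N * norm (t' - t) * norm (h t' s))"
        using \<epsilon>0 cross_lipschitz[of \<gamma> t' t "h t' s"] by simp
      also have "\<dots> \<le> \<epsilon> * (?N * ?N * norm (t' - t) * (2 / c))"
        using \<epsilon>0 hn[OF t(2), of s] N by (intro mult_left_mono) auto
      finally have "norm (dirichlet ?K (M t) (h t s - h t' s)) \<le> \<epsilon> * (?N * ?N * norm (t' - t) * (2 / c))" .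
      then have "2 / c * norm (dirichlet ?K (M t) (h t s - h t' s)) \<le> 2 / c * (\<epsilon> * (?N * ?N * norm (t' - t) * (2 / c)))"
        using c(1) by (intro mult_left_mono) auto
      then have "norm (h t s - h t' s) \<le> 2 / c * (\<epsilon> * (?N * ?N * norm (t' - t) * (2 / c)))"
        using M'[OF t(1), of "h t s - h t' s"] by linarith
      also have "\<dots> = C * norm (t - t')" by (simp add: C_def norm_minus_commute)
      finally show "dist (h t s) (h t' s) \<le> C * dist t t'" by (simp add: dist_norm)
    qed
    then show ?thesis by (rule lipschitz_on_continuous_on)
  qed
  \<comment> \<open>The response of the rescaled matrix \<open>A0\<close> below, written as a sum
    over the fibre so that the term with \<open>lap\<close> has already cancelled.\<close>
  define \<Phi> where "\<Phi> t r s = (\<Sum>u | \<rho> u = r. (cross \<gamma> t *v h t s) $ u)" for t r s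
  have \<Phi>_cont: "continuous_on (cball 0 \<eta>) (\<lambda>t. \<Phi> t r s)" for r s
    unfolding \<Phi>_def matrix_vector_mult_def
    by (simp, intro continuous_intros continuous_cross continuous_on_component h_cont)
  define m where "m r s = real (card (between r s))" for r s
  define \<sigma> where "\<sigma> t r s = (t $ r $ s + t $ s $ r) / 2" for t :: "real^'n^'n" and r s
  have \<Phi>_near: "\<bar>\<Phi> t r s - (sum \<gamma> (between r s) + m r s * \<sigma> t r s)\<bar> \<le> \<eta> / (?N * ?N)"
    if t: "norm t \<le> \<eta>" and rs: "r \<noteq> s" "s \<in> ?K" for t r s
  proof -
    have "\<Phi> t r s - (sum \<gamma> (between r s) + m r s * \<sigma> t r s) = 
       \<Phi> t r s - (\<Sum>u | \<rho> u = r. (cross \<gamma> t *v ind s) $ u)"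
      using cross_response[OF rs(1), of \<gamma> t] by (simp add: m_def \<sigma>_def)
    also have "\<dots> = (\<Sum>u | \<rho> u = r. (cross \<gamma> t *v (h t s - ind s)) $ u)"
      unfolding \<Phi>_def by (simp add: sum_subtractf matrix_vector_mult_diff_distrib)
    also have "\<bar>\<dots>\<bar> \<le> (\<Sum>u | \<rho> u = r. \<bar>(cross \<gamma> t *v (h t s - ind s)) $ u\<bar>)" by (rule sum_abs)
    also have "\<dots> \<le> (\<Sum>u\<in>UNIV. \<bar>(cross \<gamma> t *v (h t s - ind s)) $ u\<bar>)"
      by (rule sum_mono2) auto
    also have "\<dots> \<le> (\<Sum>u\<in>(UNIV::'n set). norm (cross \<gamma> t *v (h t s - ind s)))"
      by (rule sum_mono) (rule component_le_norm_cart)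
    also have "\<dots> = ?N * norm (cross \<gamma> t *v (h t s - ind s))" by simp
    also have "\<dots> \<le> ?N * (b * (2 / c * (\<epsilon> * b * ?N)))"
      using cb[OF t, of "h t s - ind s"] mult_left_mono[OF h_near[OF t rs(2)], of b] b0 
      by (intro mult_left_mono) linarith+
    also have "\<dots> = \<epsilon> * k" by (simp add: k_def)
    also have "\<dots> \<le> \<eta> / (?N * ?N)" by (rule \<epsilon>2)
    finally show ?thesis .
  qed
  define ok where "ok r s \<longleftrightarrow> r \<noteq> s \<and> r \<in> ?K \<and> s \<in> ?K \<and> between r s \<noteq> {}" for r s
  have m1: "m r s \<ge> 1" if "ok r s" for r s
    using that by (simp add: m_def ok_def Suc_le_eq card_gt_0_iff)
  \<comment> \<open>A simplified Newton step: \<open>m r s\<close> is the derivative of the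
    approximate response with respect to \<sigma>. Replacing the response by its approximation turns
    the entry into zero, so the entries of \<open>F t\<close> are mere error terms.\<close>
  define F :: "real^'n^'n \<Rightarrow> real^'n^'n" where
    "F t = (\<chi> r s. if ok r s then \<sigma> t r s - (\<Phi> t r s - T {r, s}) / m r s else 0)" for t
  have "F \<in> cball 0 \<eta> \<rightarrow> cball 0 \<eta>"
  proof
    fix t :: "real^'n^'n" assume "t \<in> cball 0 \<eta>"
    then have t: "norm t \<le> \<eta>" by simp
    have "\<bar>F t $ r $ s\<bar> \<le> \<eta> / (?N * ?N)" for r s
    proof (cases "ok r s")
      case True
      have "\<bar>F t $ r $ s\<bar> = \<bar>\<Phi> t r s - (sum \<gamma> (between r s) + m r s * \<sigma> t r s)\<bar> / m r s"
        using True \<gamma>T[of r s] m1[OF True] by (auto simp: F_def ok_def field_simps abs_if)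
      also have "\<dots> \<le> \<bar>\<Phi> t r s - (sum \<gamma> (between r s) + m r s * \<sigma> t r s)\<bar> / 1"
        using m1[OF True] by (intro divide_left_mono) auto
      also have "\<dots> \<le> \<eta> / (?N * ?N)" using \<Phi>_near[OF t, of r s] True by (auto simp: ok_def)
      finally show ?thesis .
    qed (use \<eta> in \<open>auto simp: F_def\<close>)
    then have row: "norm (F t $ r) \<le> ?N * (\<eta> / (?N * ?N))" for r by (intro norm_le_component_bound)
    have "norm (F t) \<le> (\<Sum>r\<in>UNIV. norm (F t $ r))" unfolding norm_vec_def by (rule L2_set_le_sum) auto
    also have "\<dots> \<le> (\<Sum>r\<in>(UNIV::'n set). ?N * (\<eta> / (?N * ?N)))" by (intro sum_mono row)
    also have "\<dots> = \<eta>" by simp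
    finally show "F t \<in> cball 0 \<eta>" by simp
  qed
  moreover have "continuous_on (cball 0 \<eta>) F"
    unfolding F_def
  proof (intro continuous_on_vec_lambda)
    fix r s
    show "continuous_on (cball 0 \<eta>) (\<lambda>t. if ok r s then \<sigma> t r s - (\<Phi> t r s - T {r, s}) / m r s else 0)"
      using m1[of r s] unfolding \<sigma>_def
      by (cases "ok r s") (auto intro!: continuous_intros \<Phi>_cont)
  qed
  ultimately obtain t where t: "t \<in> cball 0 \<eta>" "F t = t"
    using brouwer[of "cball 0 \<eta>" F] \<eta> by auto
  then have tn: "norm t \<le> \<eta>" by simp
  \<comment> \<open>This is \<open>M t\<close> divided by \<epsilon>: it has the same harmonic
    functions, but cross weights of their true size.\<close>
  define A0 where "A0 = (1 / \<epsilon>) *\<^sub>R lap + cross \<gamma> t"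
  have A0M: "A0 *v x = (1 / \<epsilon>) *\<^sub>R (M t *v x)" for x
    using \<epsilon>0 by (simp add: A0_def M_def matrix_vector_mult_add_rdistrib scaleR_matrix_vector_assoc[symmetric]
        scaleR_right_distrib)
  have A0off: "(A0 *v h t s) $ u = 0" if "u \<notin> ?K" "s \<in> ?K" for s u
    using hM[OF tn that] by (simp add: A0M)
  \<comment> \<open>The residual of \<open>h t s\<close> vanishes off the representatives, so its
    value at \<open>r\<close> equals its sum over the whole fibre of \<open>r\<close>.\<close>
  have A0\<Phi>: "(A0 *v h t s) $ r = \<Phi> t r s" if "r \<in> ?K" "s \<in> ?K" for r s
  proof -
    have r: "\<rho> r = r" using that idem by auto
    have "(A0 *v h t s) $ r = (\<Sum>u\<in>{r}. (A0 *v h t s) $ u)" by simp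
    also have "\<dots> = (\<Sum>u | \<rho> u = r. (A0 *v h t s) $ u)"
    proof (rule sum.mono_neutral_left)
      show "\<forall>i\<in>{u. \<rho> u = r} - {r}. (A0 *v h t s) $ i = 0"
      proof
        fix i assume i: "i \<in> {u. \<rho> u = r} - {r}"
        then have "i \<notin> ?K" using idem by auto
        then show "(A0 *v h t s) $ i = 0" using A0off that by simp
      qed
    qed (use r in auto)
    also have "\<dots> = (1 / \<epsilon>) * (\<Sum>u | \<rho> u = r. (lap *v h t s) $ u) + \<Phi> t r s"
      by (simp add: A0_def matrix_vector_mult_add_rdistrib scaleR_matrix_vector_assoc[symmetric] sum.distrib
         sum_divide_distrib \<Phi>_def)
    finally show ?thesis by (simp add: lap_fibre_sum)
  qed
  have A0sym: "A0 $ u $ v = A0 $ v $ u" for u v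
    using lap_sym cross_sym by (simp add: A0_def)
  have A0dot: "(A0 *v h t s) $ r = h t r \<bullet> (A0 *v h t s)" if "r \<in> ?K" "s \<in> ?K" for r s
  proof -
    have "h t r \<bullet> (A0 *v h t s) = (\<Sum>u\<in>UNIV. h t r $ u * (A0 *v h t s) $ u)" by (simp add: inner_vec_def)
    also have "\<dots> = (\<Sum>u\<in>{r}. h t r $ u * (A0 *v h t s) $ u)"
      using A0off[OF _ that(2)] hK[OF tn] that by (intro sum.mono_neutral_right) fastforce+
    finally show ?thesis using hK[OF tn that(1)] by simp
  qed
  have \<Phi>sym: "\<Phi> t r s = \<Phi> t s r" if "r \<in> ?K" "s \<in> ?K" for r s
  proof -
    have "transpose A0 = A0" using A0sym by (simp add: transpose_def vec_eq_iff)
    then have "h t r \<bullet> (A0 *v h t s) = h t s \<bullet> (A0 *v h t r)"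
      by (metis dot_lmul_matrix inner_commute transpose_matrix_vector)
    then show ?thesis using A0dot A0\<Phi> that by metis
  qed
  have \<Phi>T: "\<Phi> t r s = T {r, s}" if "ok r s" for r s
  proof -
    have ok': "ok s r" using that between_commute by (auto simp: ok_def)
    have 1: "t $ r $ s = \<sigma> t r s - (\<Phi> t r s - T {r, s}) / m r s"
      using arg_cong[OF t(2), of "\<lambda>x. x $ r $ s"] that by (simp add: F_def)
    have 2: "t $ s $ r = \<sigma> t r s - (\<Phi> t r s - T {r, s}) / m r s"
      using arg_cong[OF t(2), of "\<lambda>x. x $ s $ r"] ok' \<Phi>sym[of r s] that
      by (simp add: F_def \<sigma>_def m_def between_commute insert_commute ok_def add.commute)
    \<comment> \<open>Symmetry of the response gives both orientations the same correction
      \<open>q\<close>; averaging the two fixed-point equations leaves \<open>q = 0\<close>.\<close>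
    have "q = 0" if "a = (a + b) / 2 - q" "b = (a + b) / 2 - q" for a b q :: real
      using that by (simp add: field_simps)
    from this[OF 1[unfolded \<sigma>_def] 2[unfolded \<sigma>_def]]
    have "(\<Phi> t r s - T {r, s}) / m r s = 0" .
    then show ?thesis using m1[OF that] by simp
  qed
  have tt: "\<bar>\<sigma> t r s\<bar> \<le> \<eta>" for r s
  proof -
    have "\<bar>t $ r $ s\<bar> \<le> \<eta>" for r s
      using tn by (metis Finite_Cartesian_Product.norm_nth_le order_trans real_norm_def)
    from this[of r s] this[of s r] show ?thesis by (simp add: \<sigma>_def)
  qed
  have A0pat: "A0 $ u $ v \<noteq> 0 \<longleftrightarrow> {u, v} \<in> E" if "u \<noteq> v" for u v
  proof (cases "{u, v} \<in> E")
    case False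
    then show ?thesis using that by (simp add: A0_def lap_def cross_def intra_def)
  next
    case True
    show ?thesis
    proof (cases "\<rho> u = \<rho> v")
      case True
      then show ?thesis using that \<open>{u, v} \<in> E\<close> \<epsilon>0 by (simp add: A0_def lap_def cross_def intra_def)
    next
      case False
      then have "{u, v} \<in> X" using True by (auto simp: X_def between_def)
      then have "\<gamma> {u, v} + \<sigma> t (\<rho> u) (\<rho> v) \<noteq> 0" using \<eta>(3)[of "{u, v}"] tt[of "\<rho> u" "\<rho> v"] by linarith
      then show ?thesis using that True False by (simp add: A0_def lap_def cross_def intra_def \<sigma>_def)
    qed
  qed
  \<comment> \<open>Diagonal entries are free. Changing them at representatives only sets the
    diagonal responses and disturbs no equation elsewhere.\<close>
  define d where "d u = (if u \<in> ?K then T {u} - (A0 *v h t u) $ u else 0)" for u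
  define A where "A = (\<chi> u v. A0 $ u $ v + (if u = v then d u else 0))"
  have A: "(A *v x) $ u = (A0 *v x) $ u + d u * x $ u" for x u
    by (simp add: A_def matrix_vector_mult_def distrib_right sum.distrib if_distrib[of "\<lambda>a. a * _"] cong: if_cong)
  have "response_matrix A (h t) T"
    unfolding response_matrix_def
  proof (intro conjI ballI allI impI)
    show "A \<in> sym_matrices E"
      using A0sym A0pat by (auto simp: sym_matrices_def A_def transpose_def vec_eq_iff)
    show "h t s $ u = (if u = s then 1 else 0)" if "u \<in> ?K" "s \<in> ?K" for s u
      using hK[OF tn that(1)] .
    show "(A *v h t s) $ v = 0" if "s \<in> ?K" "v \<notin> ?K" for s v
      using A0off[OF that(2,1)] that by (simp add: A d_def)
    show "(A *v h t s) $ r = T {r, s}" if "r \<in> ?K" "s \<in> ?K" "r = s \<or> between r s \<noteq> {}" for r s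
    proof (cases "r = s")
      case True
      then show ?thesis using hK[OF tn that(1), of s] that(1) by (simp add: A d_def)
    next
      case False
      then have "ok r s" using that by (auto simp: ok_def)
      then show ?thesis using hK[OF tn that(1), of s] False \<Phi>T A0\<Phi> that by (simp add: A)
    qed
    show "y = 0" if y: "\<forall>u\<in>?K. y $ u = 0" "\<forall>u. u \<notin> ?K \<longrightarrow> (A *v y) $ u = 0" for y
    proof (rule Minj[OF tn])
      have "(M t *v y) $ u = 0" if "u \<notin> ?K" for u
        using y(2) that \<epsilon>0 by (simp add: A A0M d_def)
      then show "dirichlet ?K (M t) y = 0" using y(1) by (auto simp: vec_eq_iff)
    qed
  qed
  then show ?thesis by blast
qed

end

text \<open>The coordinates in \<open>I\<close> are dual to the vectors \<open>f i\<close>, which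
  forces linear independence.\<close>

lemma card_le_dim_of_dual:
  fixes f :: "'n \<Rightarrow> real^'n"
  assumes "\<And>i. i \<in> I \<Longrightarrow> f i \<in> V"
    and \<delta>: "\<And>i j. i \<in> I \<Longrightarrow> j \<in> I \<Longrightarrow> f i $ j = (if i = j then 1 else 0)"
  shows "card I \<le> dim V"
proof -
  have inj: "inj_on f I"
    by (rule inj_onI) (metis \<delta> zero_neq_one)
  have "independent (f ` I)"
  proof (rule independent_if_scalars_zero)
    show "finite (f ` I)" by simp
    fix c x assume 0: "(\<Sum>x\<in>f ` I. c x *\<^sub>R x) = 0" and x: "x \<in> f ` I"
    from x obtain j where j: "j \<in> I" "x = f j" by auto
    have "0 = (\<Sum>i\<in>I. c (f i) *\<^sub>R f i) $ j"
      using 0 inj by (simp add: sum.reindex)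
    also have "\<dots> = (\<Sum>i\<in>I. c (f i) * f i $ j)" by simp
    also have "\<dots> = (\<Sum>i\<in>I. if i = j then c (f j) else 0)"
      using \<delta> j by (intro sum.cong) auto
    also have "\<dots> = c x" using j by simp
    finally show "c x = 0" by simp
  qed
  moreover have "f ` I \<subseteq> V" using assms by auto
  ultimately have "card (f ` I) \<le> dim V" by (metis independent_card_le_dim)
  then show ?thesis using inj by (simp add: card_image)
qed

context branching begin

text \<open>Pairing \<open>h r\<close> with \<open>A *v h s\<close> sees only the coordinate
  \<open>r\<close>, because one factor vanishes off the representatives and the other at all other
  representatives. The pairing is symmetric.\<close>

lemma response_sym:
  assumes "response_matrix A h T" "r \<in> range \<rho>" "s \<in> range \<rho>"
  shows "(A *v h s) $ r = (A *v h r) $ s"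
proof -
  have dot: "(A *v h s) $ r = h r \<bullet> (A *v h s)" if rs: "r \<in> range \<rho>" "s \<in> range \<rho>" for r s
  proof -
    have h: "h r $ u = (if u = r then 1 else 0)" if "u \<in> range \<rho>" for u
      using assms(1) rs that unfolding response_matrix_def by blast
    have off: "(A *v h s) $ u = 0" if "u \<notin> range \<rho>" for u
      using assms(1) rs that unfolding response_matrix_def by blast
    have "h r \<bullet> (A *v h s) = (\<Sum>u\<in>UNIV. h r $ u * (A *v h s) $ u)" by (simp add: inner_vec_def)
    also have "\<dots> = (\<Sum>u\<in>{r}. h r $ u * (A *v h s) $ u)"
    proof (rule sum.mono_neutral_right)
      show "\<forall>u\<in>UNIV - {r}. h r $ u * (A *v h s) $ u = 0"
        using h off by (metis DiffE insertI1 mult_eq_0_iff)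
    qed auto
    finally show ?thesis using h[OF rs(1)] by simp
  qed
  have "transpose A = A" using assms(1) by (simp add: response_matrix_def sym_matrices_def)
  then have "h r \<bullet> (A *v h s) = h s \<bullet> (A *v h r)"
    by (metis dot_lmul_matrix inner_commute transpose_matrix_vector)
  then show ?thesis using dot assms(2,3) by metis
qed

text \<open>By uniqueness of the Dirichlet problem \<open>h s\<close> vanishes on \<open>X\<close>.\<close>

lemma response_separated:
  assumes R: "response_matrix A h T" and r: "r \<in> range \<rho>" and s: "s \<in> range \<rho>" and X: "r \<in> X" "s \<notin> X"
    and bd: "\<And>u w. u \<in> X \<Longrightarrow> w \<notin> X \<Longrightarrow> {u, w} \<in> E \<Longrightarrow> w \<in> range \<rho> \<and> w \<noteq> s"
  shows "(A *v h s) $ r = 0"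
proof -
  have h: "h s $ u = (if u = s then 1 else 0)" if "u \<in> range \<rho>" for u
    using R s that unfolding response_matrix_def by blast
  have off: "(A *v h s) $ u = 0" if "u \<notin> range \<rho>" for u
    using R s that unfolding response_matrix_def by blast
  have uniq: "y = 0" if "\<And>u. u \<in> range \<rho> \<Longrightarrow> y $ u = 0" "\<And>u. u \<notin> range \<rho> \<Longrightarrow> (A *v y) $ u = 0" for y
    using R that unfolding response_matrix_def by blast
  have edge: "{u, w} \<in> E" if "A $ u $ w \<noteq> 0" "u \<noteq> w" for u w
    using R that by (auto simp: response_matrix_def sym_matrices_def)
  have out: "A $ u $ w * h s $ w = 0" if "u \<in> X" "w \<notin> X" for u w
    proof (rule ccontr)
      assume "A $ u $ w * h s $ w \<noteq> 0"
      then have "A $ u $ w \<noteq> 0" "h s $ w \<noteq> 0" by auto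
      moreover have "u \<noteq> w" using that by auto
      ultimately have "w \<in> range \<rho>" "w \<noteq> s" using edge bd that by metis+
      then show False using h[of w] s \<open>h s $ w \<noteq> 0\<close> by simp
    qed
    \<comment> \<open>Cutting \<open>h s\<close> off at \<open>X\<close> changes no residual in
      \<open>X\<close>, since \<open>h s\<close> vanishes at the outer ends of the edges leaving
      \<open>X\<close>; outside \<open>X\<close> these ends are representatives and carry no
      equation. So \<open>y\<close> solves the homogeneous problem.\<close>
    define y :: "real^'n" where "y = (\<chi> u. if u \<in> X then h s $ u else 0)"
    have "(A *v y) $ u = (A *v h s) $ u" if "u \<in> X" for u
      unfolding matrix_vector_mult_def using out[OF that] by (auto simp: y_def intro!: sum.cong)
    moreover have "(A *v y) $ u = 0" if u: "u \<notin> X" "u \<notin> range \<rho>" for u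
    proof -
      have "A $ u $ w * y $ w = 0" for w
      proof (cases "w \<in> X")
        case True
        then have "{w, u} \<notin> E" using bd[of w u] u by auto
        then have "A $ u $ w = 0" using edge[of u w] True u by (auto simp: insert_commute)
        then show ?thesis by simp
      qed (simp add: y_def)
      then show ?thesis unfolding matrix_vector_mult_def by (simp add: sum.neutral)
    qed
    ultimately have "(A *v y) $ u = 0" if "u \<notin> range \<rho>" for u
      using off that by (cases "u \<in> X") auto
    then have "y = 0"
      using h X(2) by (intro uniq) (auto simp: y_def)
    then have y0: "y $ w = 0" for w by simp
    have "h s $ w = 0" if "w \<in> X" for w
      using y0[of w] that by (simp add: y_def)
    then have "A $ r $ w * h s $ w = 0" for w using out[OF X(1), of w] by (cases "w \<in> X") auto
    then show ?thesis unfolding matrix_vector_mult_def by (simp add: sum.neutral)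
qed

lemma response_matrix_exists:
  fixes T :: "'n set \<Rightarrow> real"
  assumes tgt: "\<And>e. e \<in> E \<Longrightarrow> card (\<rho> ` e) = 2 \<Longrightarrow> T (\<rho> ` e) \<noteq> 0 \<or> (\<exists>e'\<in>E. e' \<noteq> e \<and> \<rho> ` e' = \<rho> ` e)"
  obtains A h where "response_matrix A h T"
proof -
  have "T {r, s} \<noteq> 0 \<or> 2 \<le> card (between r s)" if rs: "r \<noteq> s" "between r s \<noteq> {}" for r s
  proof -
    obtain e where e: "e \<in> E" "\<rho> ` e = {r, s}" using rs unfolding between_def by blast
    then have "T {r, s} \<noteq> 0 \<or> (\<exists>e'\<in>E. e' \<noteq> e \<and> \<rho> ` e' = {r, s})" using tgt[of e] rs by auto
    moreover have "2 \<le> card (between r s)" if "e' \<in> E" "e' \<noteq> e" "\<rho> ` e' = {r, s}" for e'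
    proof -
      have "card {e, e'} \<le> card (between r s)"
        using that e by (intro card_mono) (auto simp: between_def)
      then show ?thesis using that(2) by auto
    qed
    ultimately show ?thesis by auto
  qed
  then show thesis using response_exists[of T] that by blast
qed

end

section \<open>Configurations that produce a large kernel\<close>

definition nullity_attained :: "'n::finite set set \<Rightarrow> nat \<Rightarrow> bool" where
  "nullity_attained E k \<longleftrightarrow> (\<exists>A\<in>sym_matrices E. k \<le> dim {x. A *v x = 0})"

lemma null_vectorI:
  fixes A :: "real^'n^'n"
  assumes "\<And>v. v \<notin> K \<Longrightarrow> (A *v x) $ v = 0" "\<And>v. v \<in> K \<Longrightarrow> (A *v x) $ v = 0"
  shows "x \<in> {x. A *v x = 0}"
  using assms by (auto simp: vec_eq_iff)

context branching begin

text \<open>With target zero every harmonic extension \<open>h s\<close> is itself a null vector.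
  Doubling makes zero totals attainable with nonzero weights; branch sets without a common edge must
  be separated by other representatives.\<close>

lemma doubled_clique_nullity:
  assumes doubled: "\<And>e. e \<in> E \<Longrightarrow> card (\<rho> ` e) = 2 \<Longrightarrow> (\<exists>e'\<in>E. e' \<noteq> e \<and> \<rho> ` e' = \<rho> ` e)"
    and adj: "\<And>r s. r \<in> range \<rho> \<Longrightarrow> s \<in> range \<rho> \<Longrightarrow> r \<noteq> s \<Longrightarrow> (\<exists>e\<in>E. \<rho> ` e = {r, s}) \<or>
       (\<exists>X. r \<in> X \<and> s \<notin> X \<and> (\<forall>u\<in>X. \<forall>w. w \<notin> X \<longrightarrow> {u, w} \<in> E \<longrightarrow> w \<in> range \<rho> \<and> w \<noteq> s))"
  shows "nullity_attained E (card (range \<rho>))"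
proof -
  obtain A h where R: "response_matrix A h (\<lambda>_. 0)"
    using response_matrix_exists[of "\<lambda>_. 0"] doubled by metis
  have A: "A \<in> sym_matrices E"
    and h: "\<And>s t. t \<in> range \<rho> \<Longrightarrow> s \<in> range \<rho> \<Longrightarrow> h s $ t = (if t = s then 1 else 0)"
    and off: "\<And>s v. s \<in> range \<rho> \<Longrightarrow> v \<notin> range \<rho> \<Longrightarrow> (A *v h s) $ v = 0"
    using R unfolding response_matrix_def by blast+
  have resp: "(A *v h s) $ r = 0"
    if "r \<in> range \<rho>" "s \<in> range \<rho>" "r = s \<or> (\<exists>e\<in>E. \<rho> ` e = {r, s})" for r s
    using R that unfolding response_matrix_def between_def by blast
  have "(A *v h s) $ r = 0" if "r \<in> range \<rho>" "s \<in> range \<rho>" for r s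
    using adj[OF that] resp[OF that] response_separated[OF R that] by metis
  then have "h s \<in> {x. A *v x = 0}" if "s \<in> range \<rho>" for s
    using that off by (intro null_vectorI[of "range \<rho>"]) auto
  then have "card (range \<rho>) \<le> dim {x. A *v x = 0}"
    by (rule card_le_dim_of_dual) (use h in auto)
  then show ?thesis using A by (auto simp: nullity_attained_def)
qed

text \<open>The target is the all-ones matrix, whose off-diagonal entries are nonzero, so single
  edges suffice. It has rank one, and differences of two harmonic extensions are null
  vectors.\<close>

lemma clique_minor_nullity:
  assumes adj: "\<And>r s. r \<in> range \<rho> \<Longrightarrow> s \<in> range \<rho> \<Longrightarrow> r \<noteq> s \<Longrightarrow> \<exists>e\<in>E. \<rho> ` e = {r, s}"
  shows "nullity_attained E (card (range \<rho>) - 1)"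
proof -
  obtain A h where R: "response_matrix A h (\<lambda>_. 1)"
    using response_matrix_exists[of "\<lambda>_. 1"] by (metis zero_neq_one)
  have A: "A \<in> sym_matrices E"
    and h: "\<And>s t. t \<in> range \<rho> \<Longrightarrow> s \<in> range \<rho> \<Longrightarrow> h s $ t = (if t = s then 1 else 0)"
    and off: "\<And>s v. s \<in> range \<rho> \<Longrightarrow> v \<notin> range \<rho> \<Longrightarrow> (A *v h s) $ v = 0"
    using R unfolding response_matrix_def by blast+
  have resp: "(A *v h s) $ r = 1"
    if "r \<in> range \<rho>" "s \<in> range \<rho>" "r = s \<or> (\<exists>e\<in>E. \<rho> ` e = {r, s})" for r s
    using R that unfolding response_matrix_def between_def by blast
  have 1: "(A *v h s) $ r = 1" if "r \<in> range \<rho>" "s \<in> range \<rho>" for r s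
    using adj[OF that] resp[OF that] by metis
  obtain a where a: "a \<in> range \<rho>" by blast
  have "h s - h a \<in> {x. A *v x = 0}" if "s \<in> range \<rho> - {a}" for s
    using that off 1 a by (intro null_vectorI[of "range \<rho>"]) (auto simp: matrix_vector_mult_diff_distrib)
  then have "card (range \<rho> - {a}) \<le> dim {x. A *v x = 0}"
    by (rule card_le_dim_of_dual) (use h a in auto)
  then show ?thesis using A a by (auto simp: nullity_attained_def card_Diff_singleton)
qed

text \<open>The response between \<open>u\<close> and \<open>w\<close> is not under control, but the diagonal entries there
  are free and can be set equal to it.\<close>

lemma three_bridges_nullity:
  assumes uw: "u \<in> range \<rho>" "w \<in> range \<rho>" "u \<noteq> w" and three: "card (range \<rho> - {u, w}) = 3"
    and adj: "\<And>x. x \<in> range \<rho> - {u, w} \<Longrightarrow> (\<exists>e\<in>E. \<rho> ` e = {x, u}) \<and> (\<exists>e\<in>E. \<rho> ` e = {x, w})"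
    and sep: "\<And>a b. \<rho> a \<notin> {u, w} \<Longrightarrow> \<rho> b \<noteq> \<rho> a \<Longrightarrow> {a, b} \<in> E \<Longrightarrow> b \<in> {u, w}"
  shows "nullity_attained E 3"
proof -
  let ?K = "range \<rho>"
  \<comment> \<open>Diagonal responses 0, responses along edges 1. The latter makes \<open>u\<close>
    and \<open>w\<close> look alike from each of the three branch sets.\<close>
  define T :: "'n set \<Rightarrow> real" where "T P = (if card P = 1 then 0 else 1)" for P
  have "T (\<rho> ` e) \<noteq> 0 \<or> (\<exists>e'\<in>E. e' \<noteq> e \<and> \<rho> ` e' = \<rho> ` e)"
    if "e \<in> E" "card (\<rho> ` e) = 2" for e using that by (simp add: T_def)
  then obtain A h where R: "response_matrix A h T"
    using response_matrix_exists[of T] by metis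
  have A: "A \<in> sym_matrices E"
    and h: "\<And>s t. t \<in> range \<rho> \<Longrightarrow> s \<in> range \<rho> \<Longrightarrow> h s $ t = (if t = s then 1 else 0)"
    and off: "\<And>s v. s \<in> range \<rho> \<Longrightarrow> v \<notin> range \<rho> \<Longrightarrow> (A *v h s) $ v = 0"
    using R unfolding response_matrix_def by blast+
  have resp: "(A *v h s) $ r = T {r, s}"
    if "r \<in> range \<rho>" "s \<in> range \<rho>" "r = s \<or> (\<exists>e\<in>E. \<rho> ` e = {r, s})" for r s
    using R that unfolding response_matrix_def between_def by blast
  note sym = response_sym[OF R] and sp = response_separated[OF R]
  define \<gamma> where "\<gamma> = (A *v h w) $ u"
  define A' where "A' = (\<chi> a b. A $ a $ b + (if a = b \<and> a \<in> {u, w} then \<gamma> else 0))"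
  have A': "(A' *v x) $ a = (A *v x) $ a + (if a \<in> {u, w} then \<gamma> * x $ a else 0)" for x a
    by (simp add: A'_def matrix_vector_mult_def distrib_right sum.distrib if_distrib[of "\<lambda>a. a * _"] 
        if_conn cong: if_cong)
  have A'S: "A' \<in> sym_matrices E"
    using A by (auto simp: sym_matrices_def A'_def transpose_def vec_eq_iff)
  have idK: "\<rho> r = r" if "r \<in> ?K" for r using that idem by auto
  \<comment> \<open>Edges leaving the fibre of \<open>x\<close> end in \<open>u\<close> or
    \<open>w\<close>, so this fibre can serve as the separating set.\<close>
  have xx: "(A *v h y) $ x = 0" if x: "x \<in> ?K - {u, w}" and y: "y \<in> ?K - {u, w}" for x y
  proof (cases "x = y")
    case False
    show ?thesis
    proof (rule sp[of x y "{v. \<rho> v = x}"])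
      show "c \<in> ?K \<and> c \<noteq> y" if "a \<in> {v. \<rho> v = x}" "c \<notin> {v. \<rho> v = x}" "{a, c} \<in> E" for a c
      proof -
        have "c \<in> {u, w}" using sep[of a c] that x by auto
        then show ?thesis using y uw by auto
      qed
    qed (use x y False idK[of x] idK[of y] in simp_all)
  next
    case True
    then show ?thesis using resp[of x x] x by (simp add: T_def)
  qed
  have ux: "(A *v h s) $ x = 1" if "x \<in> ?K - {u, w}" "s \<in> {u, w}" for x s
  proof -
    have "\<exists>e\<in>E. \<rho> ` e = {x, s}" using adj[OF that(1)] that(2) by auto
    moreover have "card {x, s} = 2" using that by auto
    moreover have "x \<in> ?K" "s \<in> ?K" using that uw by blast+
    ultimately show ?thesis using resp[of x s] by (simp add: T_def)
  qed
  have xu: "(A *v h x) $ s = 1" if "x \<in> ?K - {u, w}" "s \<in> {u, w}" for x s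
  proof -
    have "x \<in> ?K" "s \<in> ?K" using that uw by blast+
    then show ?thesis using ux[OF that] sym[of x s] by simp
  qed
  have \<gamma>': "(A *v h u) $ w = \<gamma>" using sym[of u w] uw by (simp add: \<gamma>_def)
  have uu: "(A *v h u) $ u = 0" "(A *v h w) $ w = 0" using resp[of u u] resp[of w w] uw by (auto simp: T_def)
  obtain a where a: "a \<in> ?K - {u, w}" using three by (metis card.empty ex_in_conv zero_neq_numeral)
  \<comment> \<open>The rows of \<open>u\<close> and \<open>w\<close> now agree, and so do the rows
    of the three remaining branch sets. Subtracting one reference column within each class,
    \<open>w\<close> and \<open>a\<close>, leaves three null vectors.\<close>
  let ?f = "\<lambda>s. if s = u then h u - h w else h s - h a"
  let ?I = "?K - {w, a}"
  have "?f s \<in> {x. A' *v x = 0}" if s: "s \<in> ?I" for s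
  proof (cases "s = u")
    case True
    show ?thesis
    proof (rule null_vectorI[of ?K])
      fix v assume "v \<notin> ?K"
      then show "(A' *v ?f s) $ v = 0" using True off uw by (auto simp: A' matrix_vector_mult_diff_distrib)
    next
      fix v assume v: "v \<in> ?K"
      consider "v = u" | "v = w" | "v \<in> ?K - {u, w}" using v by auto
      then show "(A' *v ?f s) $ v = 0"
        using True uw ux[of v] uu \<gamma>' h[of u u] h[of u w] h[of w u] h[of w w]
        by cases (auto simp: A' matrix_vector_mult_diff_distrib \<gamma>_def)
    qed
  next
    case False
    then have s': "s \<in> ?K - {u, w}" using s by auto
    show ?thesis
    proof (rule null_vectorI[of ?K])
      fix v assume "v \<notin> ?K"
      then show "(A' *v ?f s) $ v = 0" using False off uw s a by (auto simp: A' matrix_vector_mult_diff_distrib)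
    next
      fix v assume v: "v \<in> ?K"
      show "(A' *v ?f s) $ v = 0"
      proof (cases "v \<in> {u, w}")
        case True
        then have "h s $ v = 0" "h a $ v = 0" using h[OF v] s' a by auto
        then show ?thesis using False True xu[OF s'] xu[OF a] by (simp add: A' matrix_vector_mult_diff_distrib)
      next
        case F: False
        then show ?thesis using False v xx[of v s] xx[of v a] s' a by (simp add: A' matrix_vector_mult_diff_distrib)
      qed
    qed
  qed
  then have "card ?I \<le> dim {x. A' *v x = 0}"
    by (rule card_le_dim_of_dual) (use h uw a in auto)
  moreover have "card ?I = 3"
  proof -
    have "card ?K = card (insert u (insert w (?K - {u, w})))" using uw by (intro arg_cong[of _ _ card]) auto
    also have " \<dots> = 5" using three uw by (subst card_insert_disjoint; force)+
    finally have "card ?K = 5" .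
    then show ?thesis using a uw by (subst card_Diff_subset) auto
  qed
  ultimately show ?thesis using A'S by (auto simp: nullity_attained_def)
qed

end

section \<open>Connectivity and cut vertices\<close>

definition inside :: "'n set set \<Rightarrow> 'n set \<Rightarrow> ('n \<times> 'n) set" where
  "inside E X = {(x, y). {x, y} \<in> E \<and> x \<in> X \<and> y \<in> X}"

definition connected_in :: "'n set set \<Rightarrow> 'n set \<Rightarrow> bool" where
  "connected_in E X \<longleftrightarrow> (\<forall>a\<in>X. \<forall>b\<in>X. (a, b) \<in> (inside E X)\<^sup>*)"

lemma inside_rtrancl_sym: "(a, b) \<in> (inside E X)\<^sup>* \<Longrightarrow> (b, a) \<in> (inside E X)\<^sup>*"
proof -
  have "sym (inside E X)" by (auto simp: sym_def inside_def insert_commute)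
  then show "(a, b) \<in> (inside E X)\<^sup>* \<Longrightarrow> (b, a) \<in> (inside E X)\<^sup>*"
    by (meson sym_rtrancl symD)
qed

lemma inside_rtrancl_mono: "(a, b) \<in> (inside E X)\<^sup>* \<Longrightarrow> X \<subseteq> Y \<Longrightarrow> (a, b) \<in> (inside E Y)\<^sup>*"
  by (rule rtrancl_mono[THEN subsetD, rotated]) (auto simp: inside_def)

lemma connected_inI:
  assumes "\<And>x. x \<in> X \<Longrightarrow> (r, x) \<in> (inside E X)\<^sup>*"
  shows "connected_in E X"
  unfolding connected_in_def using assms inside_rtrancl_sym by (metis rtrancl_trans)

lemma connected_in_singleton [simp]: "connected_in E {x}"
  by (rule connected_inI[of _ x]) auto

lemma connected_in_Un:
  assumes "connected_in E A" "connected_in E B" "a \<in> A" "b \<in> B" "{a, b} \<in> E"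
  shows "connected_in E (A \<union> B)"
proof (rule connected_inI[of _ a])
  fix x assume "x \<in> A \<union> B"
  then show "(a, x) \<in> (inside E (A \<union> B))\<^sup>*"
  proof
    assume "x \<in> A"
    then show ?thesis using assms(1,3) inside_rtrancl_mono[of a x E A] by (auto simp: connected_in_def)
  next
    assume "x \<in> B"
    then have "(b, x) \<in> (inside E (A \<union> B))\<^sup>*"
      using assms(2,4) inside_rtrancl_mono[of b x E B] by (auto simp: connected_in_def)
    moreover have "(a, b) \<in> inside E (A \<union> B)" using assms by (auto simp: inside_def)
    ultimately show ?thesis by (meson converse_rtrancl_into_rtrancl)
  qed
qed

lemma connected_in_insert:
  assumes "connected_in E A" "a \<in> A" "{a, b} \<in> E"
  shows "connected_in E (insert b A)"
  using connected_in_Un[OF assms(1) connected_in_singleton assms(2) _ assms(3), of b] by simp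

lemma reach_subset:
  assumes "(a, b) \<in> (inside E X)\<^sup>*" "a \<in> T" "\<And>x y. x \<in> T \<Longrightarrow> y \<in> X \<Longrightarrow> {x, y} \<in> E \<Longrightarrow> y \<in> T"
  shows "b \<in> T"
  using assms(1,2) by (induction rule: rtrancl_induct) (use assms(3) in \<open>auto simp: inside_def\<close>)

lemma connected_in_exit:
  assumes "connected_in E X" "T \<noteq> {}" "T \<subset> X"
  obtains a b where "a \<in> T" "b \<in> X - T" "{a, b} \<in> E"
proof -
  obtain t x where "t \<in> T" "x \<in> X - T" using assms by auto
  then have "(t, x) \<in> (inside E X)\<^sup>*" using assms by (auto simp: connected_in_def)
  then show thesis using reach_subset[of t x E X T] \<open>t \<in> T\<close> \<open>x \<in> X - T\<close> that by blast
qed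

text \<open>A largest connected proper subset containing \<open>v\<close> can be enlarged by a
  vertex along an edge leaving it. By maximality the result is all of \<open>X\<close>, so that
  vertex can be removed.\<close>

lemma non_cut_vertex:
  fixes X :: "'n::finite set"
  assumes "connected_in E X" "v \<in> X" "X \<noteq> {v}"
  obtains r where "r \<in> X" "r \<noteq> v" "connected_in E (X - {r})"
proof -
  let ?P = "\<lambda>T. v \<in> T \<and> T \<subset> X \<and> connected_in E T"
  have P: "?P {v}" using assms by auto
  have bound: "\<forall>T. ?P T \<longrightarrow> card T < Suc CARD('n)"
    by (auto simp: less_Suc_eq_le intro: card_mono)
  obtain T where "?P T \<and> (\<forall>T'. ?P T' \<longrightarrow> card T' \<le> card T)"
    using ex_has_greatest_nat[of ?P, OF P bound] by (elim exE)
  then have T: "?P T" "\<And>T'. ?P T' \<Longrightarrow> card T' \<le> card T" by simp_all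
  obtain a r where r: "a \<in> T" "r \<in> X - T" "{a, r} \<in> E"
    using connected_in_exit[OF assms(1), of T] T by blast
  have "connected_in E (insert r T)" using connected_in_insert[of E T a r] T r by auto
  moreover have "card (insert r T) > card T" using r by simp
  ultimately have "insert r T = X" using T(1) T(2)[of "insert r T"] r by auto
  then have "T = X - {r}" using r by auto
  then show thesis using that[of r] r T by auto
qed

definition component :: "'n set set \<Rightarrow> 'n set \<Rightarrow> 'n \<Rightarrow> 'n set" where
  "component E X x = {y. (x, y) \<in> (inside E X)\<^sup>*}"

lemma component_subset: "x \<in> X \<Longrightarrow> component E X x \<subseteq> X"
  using reach_subset[of x _ E X X] by (auto simp: component_def)

lemma component_closed: "a \<in> component E X x \<Longrightarrow> x \<in> X \<Longrightarrow> {a, b} \<in> E \<Longrightarrow> b \<in> X \<Longrightarrow> b \<in> component E X x"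
  using component_subset[of x X E] by (force simp: component_def inside_def intro: rtrancl_into_rtrancl)

lemma component_self: "x \<in> component E X x"
  by (simp add: component_def)

lemma connected_in_component: "connected_in E (component E X x)"
proof (rule connected_inI[of _ x])
  fix y assume "y \<in> component E X x"
  then have "(x, y) \<in> (inside E X)\<^sup>*" by (simp add: component_def)
  then show "(x, y) \<in> (inside E (component E X x))\<^sup>*"
  proof (induction rule: rtrancl_induct)
    case (step y z)
    then have "(y, z) \<in> inside E (component E X x)"
      by (auto simp: inside_def component_def intro: rtrancl_into_rtrancl)
    then show ?case using step by (meson rtrancl_into_rtrancl)
  qed simp
qed

abbreviation edge_path :: "'n set set \<Rightarrow> 'n list \<Rightarrow> bool" where
  "edge_path E p \<equiv> successively (\<lambda>x y. {x, y} \<in> E) p"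

lemma connected_in_path:
  assumes "connected_in E X" "a \<in> X" "b \<in> X"
  obtains p where "p \<noteq> []" "hd p = a" "last p = b" "distinct p" "set p \<subseteq> X" "edge_path E p"
proof -
  have "(a, b) \<in> (inside E X)\<^sup>*" using assms by (auto simp: connected_in_def)
  then have "\<exists>p. p \<noteq> [] \<and> hd p = a \<and> last p = b \<and> distinct p \<and> set p \<subseteq> X \<and> edge_path E p"
  proof (induction rule: rtrancl_induct)
    case base
    show ?case using assms by (intro exI[of _ "[a]"]) auto
  next
    case (step y z)
    then obtain p where p: "p \<noteq> []" "hd p = a" "last p = y" "distinct p" "set p \<subseteq> X" "edge_path E p" by auto
    show ?case
    proof (cases "z \<in> set p")
      case True
      then obtain q r where "p = q @ z # r" by (meson split_list)
      then show ?thesis using p by (intro exI[of _ "q @ [z]"])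
          (auto simp: successively_append_iff hd_append split: if_splits)
    next
      case False
      then show ?thesis using p step(2) by (intro exI[of _ "p @ [z]"])
         (auto simp: successively_append_iff inside_def)
    qed
  qed
  then show thesis using that by blast
qed

lemma edge_path_connected: "edge_path E p \<Longrightarrow> connected_in E (set p)"
proof (induction p rule: induct_list012)
  case (3 x y zs)
  then show ?case using connected_in_insert[of E "set (y # zs)" y x] by (auto simp: insert_commute)
qed (auto simp: connected_in_def)

text \<open>Trades the reachability condition of the locale for connectedness of each fibre.\<close>

lemma branchingI:
  assumes "simple_graph E" "\<And>v. \<rho> (\<rho> v) = \<rho> v" "\<And>r. r \<in> range \<rho> \<Longrightarrow> connected_in E {v. \<rho> v = r}"
  shows "branching E \<rho>"
proof
  fix v
  have "(v, \<rho> v) \<in> (inside E {u. \<rho> u = \<rho> v})\<^sup>*"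
    using assms(2) assms(3)[of "\<rho> v"] by (auto simp: connected_in_def)
  then show "(v, \<rho> v) \<in> {(a, b). {a, b} \<in> E \<and> \<rho> a = \<rho> b}\<^sup>*"
    by (rule rtrancl_mono[THEN subsetD, rotated]) (auto simp: inside_def)
qed (use assms in auto)

lemma degree_two_neighbours:
  fixes E :: "'n::finite set set"
  assumes "simple_graph E" "2 \<le> vertex_degree E v"
  obtains a b where "a \<noteq> b" "{v, a} \<in> E" "{v, b} \<in> E" "a \<noteq> v" "b \<noteq> v"
proof -
  have "\<not> card {e \<in> E. v \<in> e} \<le> Suc 0" using assms(2) by (simp add: vertex_degree_def)
  then obtain e e' where e: "e \<in> E" "v \<in> e" "e' \<in> E" "v \<in> e'" "e' \<noteq> e"
    by (auto simp: card_le_Suc0_iff_eq)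
  have "\<exists>a. f = {v, a} \<and> a \<noteq> v" if f: "f \<in> E" "v \<in> f" for f
  proof -
    obtain x y where xy: "f = {x, y}" "x \<noteq> y" using assms(1) f(1) by (metis card_2_iff simple_graph_def)
    then consider "v = x" | "v = y" using f(2) by blast
    then show ?thesis
    proof cases
      case 1
      then show ?thesis using xy by metis
    next
      case 2
      then show ?thesis using xy by (metis insert_commute)
    qed
  qed
  from this[of e] this[of e'] e obtain a b where "e = {v, a}" "a \<noteq> v" "e' = {v, b}" "b \<noteq> v"
    by blast
  then show thesis using that[of a b] e by blast
qed

lemma graph_connected_iff: "graph_connected E \<longleftrightarrow> connected_in E UNIV"
  by (simp add: graph_connected_def connected_in_def inside_def)

lemma edge_distinct: "simple_graph E \<Longrightarrow> {a, b} \<in> E \<Longrightarrow> a \<noteq> b"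
  by (auto simp: simple_graph_def)

lemma edge_card_image_2:
  assumes "simple_graph E" "e \<in> E" "card (\<rho> ` e) = 2"
  obtains a b where "e = {a, b}" "\<rho> a \<noteq> \<rho> b"
proof -
  obtain a b where "e = {a, b}" using assms by (metis card_2_iff simple_graph_def)
  then show thesis using that[of a b] assms(3) by (cases "\<rho> a = \<rho> b") auto
qed

text \<open>Two branch sets: a vertex that is not a cut vertex, and all the rest. The degree
  condition supplies two edges between them.\<close>

lemma C2_nullity_two:
  fixes E :: "'n::finite set set"
  assumes E: "simple_graph E" "C2_graph E"
  shows "nullity_attained E 2"
proof -
  obtain v :: 'n where True by simp
  have conn: "connected_in E UNIV" using E by (simp add: C2_graph_def graph_connected_iff)
  have deg: "2 \<le> vertex_degree E x" for x using E by (simp add: C2_graph_def)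
  obtain a where "a \<noteq> v" using degree_two_neighbours[OF E(1) deg[of v]] by metis
  then obtain r where r: "r \<noteq> v" "connected_in E (UNIV - {r})"
    using non_cut_vertex[OF conn, of v] by blast
  let ?\<rho> = "\<lambda>x. if x = r then r else v"
  have range: "range ?\<rho> = {r, v}" using r by auto
  interpret branching E ?\<rho>
  proof (rule branchingI)
    show "connected_in E {x. ?\<rho> x = s}" if "s \<in> range ?\<rho>" for s
    proof (cases "s = r")
      case True
      then have "{x. ?\<rho> x = s} = {r}" using r by auto
      then show ?thesis by simp
    next
      case False
      then have "{x. ?\<rho> x = s} = UNIV - {r}" using that by auto
      then show ?thesis using r by simp
    qed
  qed (use E r in auto)
  obtain b c where bc: "b \<noteq> c" "{r, b} \<in> E" "{r, c} \<in> E" "b \<noteq> r" "c \<noteq> r"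
    using degree_two_neighbours[OF E(1) deg[of r]] by metis
  have "nullity_attained E (card (range ?\<rho>))"
  proof (rule doubled_clique_nullity)
    fix e assume e: "e \<in> E" "card (?\<rho> ` e) = 2"
    then have "?\<rho> ` e = {r, v}" 
      by (intro card_subset_eq) (use r in auto)
    moreover have "?\<rho> ` {r, b} = {r, v}" "?\<rho> ` {r, c} = {r, v}" using bc by auto
    moreover have "{r, b} \<noteq> {r, c}" using bc by (auto simp: doubleton_eq_iff)
    ultimately show "\<exists>e'\<in>E. e' \<noteq> e \<and> ?\<rho> ` e' = ?\<rho> ` e" using bc by metis
  next
    fix p s assume "p \<in> range ?\<rho>" "s \<in> range ?\<rho>" "p \<noteq> s"
    then have "{p, s} = {r, v}" unfolding range by auto
    moreover have "?\<rho> ` {r, b} = {r, v}" using bc by auto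
    ultimately have "\<exists>e\<in>E. ?\<rho> ` e = {p, s}" using bc by metis
    then show "(\<exists>e\<in>E. ?\<rho> ` e = {p, s}) \<or>
       (\<exists>X. p \<in> X \<and> s \<notin> X \<and> (\<forall>u\<in>X. \<forall>w. w \<notin> X \<longrightarrow> {u, w} \<in> E \<longrightarrow> w \<in> range ?\<rho> \<and> w \<noteq> s))" ..
  qed
  then show ?thesis using r unfolding range by (simp add: eval_nat_numeral)
qed

text \<open>On each side of the cut vertex choose a vertex whose removal leaves that side connected
  to \<open>v\<close>. These two singletons and the rest, represented by \<open>v\<close>, are three
  branch sets; both singletons have at least two edges into the rest, and \<open>v\<close> separates
  them from each other.\<close>

lemma cut_vertex_nullity:
  fixes E :: "'n::finite set set"
  assumes E: "simple_graph E" "C2_graph E"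
    and cover: "C \<union> D \<union> {v} = UNIV" "C \<inter> D = {}" "v \<notin> C" "v \<notin> D" "C \<noteq> {}" "D \<noteq> {}"
    and sep: "\<And>a b. a \<in> C \<Longrightarrow> b \<in> D \<Longrightarrow> {a, b} \<notin> E"
  shows "nullity_attained E 3"
proof -
  have conn: "connected_in E UNIV" using E by (simp add: C2_graph_def graph_connected_iff)
  have deg: "2 \<le> vertex_degree E x" for x using E by (simp add: C2_graph_def)
  have sep': "{b, a} \<notin> E" if "a \<in> C" "b \<in> D" for a b using sep[OF that] by (simp add: insert_commute)
  \<comment> \<open>A part of \<open>X\<close> that \<open>v\<close> does not reach within
    \<open>X\<close> would have no edge to the outside at all, against connectivity of the
    graph.\<close>
  have side: "connected_in E (X \<union> {v})" if X: "\<And>a b. a \<in> X \<Longrightarrow> {a, b} \<in> E \<Longrightarrow> b \<in> X \<union> {v}" for X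
  proof (rule connected_inI[of _ v])
    fix x assume x: "x \<in> X \<union> {v}"
    have "x \<in> component E (X \<union> {v}) v"
    proof (rule ccontr)
      let ?T = "X - component E (X \<union> {v}) v"
      assume "x \<notin> component E (X \<union> {v}) v"
      then have "x \<in> ?T" using x component_self[of v E] by auto
      moreover have "v \<notin> ?T" using component_self[of v E] by auto
      ultimately obtain a b where ab: "a \<in> ?T" "b \<in> UNIV - ?T" "{a, b} \<in> E"
        using connected_in_exit[OF conn, of ?T] by blast
      then have "b \<in> component E (X \<union> {v}) v" using X[of a b] component_self[of v E] by auto
      then have "a \<in> component E (X \<union> {v}) v"
        using ab component_closed[of b E "X \<union> {v}" v a] by (auto simp: insert_commute)
      then show False using ab by auto
    qed
    then show "(v, x) \<in> (inside E (X \<union> {v}))\<^sup>*" by (simp add: component_def)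
  qed
  have cC: "connected_in E (C \<union> {v})" by (rule side) (use sep cover in blast)
  have cD: "connected_in E (D \<union> {v})" by (rule side) (use sep' cover in blast)
  have "C \<union> {v} \<noteq> {v}" using cover(3,5) by auto
  then obtain r1 where "r1 \<in> C \<union> {v}" "r1 \<noteq> v" and r1': "connected_in E (C \<union> {v} - {r1})"
    using non_cut_vertex[OF cC, of v] by blast
  then have r1: "r1 \<in> C" "connected_in E (C \<union> {v} - {r1})" by auto
  have "D \<union> {v} \<noteq> {v}" using cover(4,6) by auto
  then obtain r2 where "r2 \<in> D \<union> {v}" "r2 \<noteq> v" and r2': "connected_in E (D \<union> {v} - {r2})"
    using non_cut_vertex[OF cD, of v] by blast
  then have r2: "r2 \<in> D" "connected_in E (D \<union> {v} - {r2})" by auto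
  have r12: "r1 \<noteq> r2" "r1 \<noteq> v" "r2 \<noteq> v" using r1 r2 cover by auto
  define \<rho> where "\<rho> x = (if x = r1 then r1 else if x = r2 then r2 else v)" for x
  have range: "range \<rho> = {r1, r2, v}" using r12 by (auto simp: \<rho>_def)
  have rest: "connected_in E (UNIV - {r1, r2})"
  proof (rule connected_inI[of _ v])
    fix x assume "x \<in> UNIV - {r1, r2}"
    then have "x \<in> C \<union> {v} - {r1} \<or> x \<in> D \<union> {v} - {r2}" using cover by auto
    then show "(v, x) \<in> (inside E (UNIV - {r1, r2}))\<^sup>*"
    proof
      assume "x \<in> C \<union> {v} - {r1}"
      then have "(v, x) \<in> (inside E (C \<union> {v} - {r1}))\<^sup>*" using r1 r12 unfolding connected_in_def by auto
      then show ?thesis by (rule inside_rtrancl_mono) (use r2 r12 cover in auto)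
    next
      assume "x \<in> D \<union> {v} - {r2}"
      then have "(v, x) \<in> (inside E (D \<union> {v} - {r2}))\<^sup>*" using r2 r12 unfolding connected_in_def by auto
      then show ?thesis by (rule inside_rtrancl_mono) (use r1 r12 cover in auto)
    qed
  qed
  interpret branching E \<rho>
  proof (rule branchingI)
    show "connected_in E {x. \<rho> x = s}" if s: "s \<in> range \<rho>" for s
    proof -
      have fibres: "{x. \<rho> x = r1} = {r1}" "{x. \<rho> x = r2} = {r2}" "{x. \<rho> x = v} = UNIV - {r1, r2}"
        using r12 by (auto simp: \<rho>_def)
      consider "s = r1" | "s = r2" | "s = v" using s unfolding range by blast
      then show ?thesis
        by cases (simp_all only: fibres rest connected_in_singleton)
    qed
  qed (use E r12 in \<open>auto simp: \<rho>_def\<close>)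
  have two: "\<exists>a b. {s, a} \<noteq> {s, b} \<and> {s, a} \<in> E \<and> {s, b} \<in> E \<and> \<rho> ` {s, a} = {s, v} \<and> \<rho> ` {s, b} = {s, v}"
    if s: "s \<in> {r1, r2}" for s
  proof -
    obtain a b where ab: "a \<noteq> b" "{s, a} \<in> E" "{s, b} \<in> E" "a \<noteq> s" "b \<noteq> s"
      using degree_two_neighbours[OF E(1) deg[of s]] by metis
    have "{r1, r2} \<notin> E" "{r2, r1} \<notin> E" using sep sep' r1 r2 by auto
    then have "\<rho> a = v" "\<rho> b = v" using ab s by (auto simp: \<rho>_def)
    moreover have "\<rho> s = s" using s by (auto simp: \<rho>_def)
    ultimately have "\<rho> ` {s, a} = {s, v}" "\<rho> ` {s, b} = {s, v}" by simp_all
    then show ?thesis using ab by (intro exI[of _ a] exI[of _ b]) (auto simp: doubleton_eq_iff)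
  qed
  have "nullity_attained E (card (range \<rho>))"
  proof (rule doubled_clique_nullity)
    fix e assume e: "e \<in> E" "card (\<rho> ` e) = 2"
    obtain a b where ab: "e = {a, b}" "\<rho> a \<noteq> \<rho> b" using edge_card_image_2[OF E(1) e] by metis
    have "{r1, r2} \<notin> E" "{r2, r1} \<notin> E" using sep sep' r1 r2 by auto
    then obtain s where s: "s \<in> {r1, r2}" "\<rho> ` e = {s, v}"
      using ab e(1) r12 by (auto simp: \<rho>_def split: if_splits)
    show "\<exists>e'\<in>E. e' \<noteq> e \<and> \<rho> ` e' = \<rho> ` e" using two[OF s(1)] s(2) by metis
  next
    fix p s assume ps: "p \<in> range \<rho>" "s \<in> range \<rho>" "p \<noteq> s"
    show "(\<exists>e\<in>E. \<rho> ` e = {p, s}) \<or>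
       (\<exists>X. p \<in> X \<and> s \<notin> X \<and> (\<forall>u\<in>X. \<forall>w. w \<notin> X \<longrightarrow> {u, w} \<in> E \<longrightarrow> w \<in> range \<rho> \<and> w \<noteq> s))"
    proof (cases "p = v \<or> s = v")
      case True
      then obtain q where "q \<in> {r1, r2}" "{p, s} = {q, v}" using ps unfolding range by auto
      then show ?thesis using two[of q] by metis
    next
      case False
      then consider "p = r1" "s = r2" | "p = r2" "s = r1" using ps unfolding range by auto
      then show ?thesis
      proof cases
        case 1
        \<comment> \<open>The side containing \<open>r1\<close> is the separating set: its only
          outside neighbour is the representative \<open>v\<close>.\<close>
        have "w = v" if "u \<in> C" "w \<notin> C" "{u, w} \<in> E" for u w using sep[of u w] that cover(1) by auto
        moreover have "r2 \<notin> C" using r1 r2 cover(2) by auto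
        ultimately have "r1 \<in> C \<and> r2 \<notin> C \<and> 
            (\<forall>u\<in>C. \<forall>w. w \<notin> C \<longrightarrow> {u, w} \<in> E \<longrightarrow> w \<in> range \<rho> \<and> w \<noteq> r2)"
          using r1 r2 r12 unfolding range by auto
        then show ?thesis using 1 by blast
      next
        case 2
        have "w = v" if "u \<in> D" "w \<notin> D" "{u, w} \<in> E" for u w using sep'[of w u] that cover(1) by auto
        moreover have "r1 \<notin> D" using r1 r2 cover(2) by auto
        ultimately have "r2 \<in> D \<and> r1 \<notin> D \<and> 
            (\<forall>u\<in>D. \<forall>w. w \<notin> D \<longrightarrow> {u, w} \<in> E \<longrightarrow> w \<in> range \<rho> \<and> w \<noteq> r1)"
          using r1 r2 r12 unfolding range by auto
        then show ?thesis using 2 by blast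
      qed
    qed
  qed
  then show ?thesis using r12 unfolding range by (simp add: eval_nat_numeral)
qed

section \<open>Graphs of nullity at most two\<close>

locale low_nullity =
  fixes E :: "'n::finite set set"
  assumes simple: "simple_graph E" and C2: "C2_graph E" and low: "\<not> nullity_attained E 3"
begin

lemma connected_UNIV: "connected_in E UNIV"
  using C2 by (simp add: C2_graph_def graph_connected_iff)

lemma degree: "2 \<le> vertex_degree E v"
  using C2 by (simp add: C2_graph_def)

text \<open>Otherwise \<open>v\<close> would separate \<open>C\<close> from a nonempty remainder,
  and a cut vertex yields nullity three.\<close>

lemma no_cut_vertex:
  assumes "C \<noteq> {}" "v \<notin> C" "\<And>a b. a \<in> C \<Longrightarrow> {a, b} \<in> E \<Longrightarrow> b \<in> C \<or> b = v"
  shows "C \<union> {v} = UNIV"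
proof (rule ccontr)
  assume "C \<union> {v} \<noteq> UNIV"
  then have "nullity_attained E 3"
    by (intro cut_vertex_nullity[OF simple C2, of C "UNIV - C - {v}" v]) (use assms in auto)
  then show False using low by simp
qed

lemma no_K4:
  assumes "branching E \<rho>" "card (range \<rho>) = 4"
    "\<And>r s. r \<in> range \<rho> \<Longrightarrow> s \<in> range \<rho> \<Longrightarrow> r \<noteq> s \<Longrightarrow> \<exists>e\<in>E. \<rho> ` e = {r, s}"
  shows False
  using branching.clique_minor_nullity[OF assms(1,3)] assms(2) low by simp

definition bridge :: "'n \<Rightarrow> 'n \<Rightarrow> 'n set \<Rightarrow> bool" where
  "bridge u w S \<longleftrightarrow> connected_in E S \<and> u \<notin> S \<and> w \<notin> S \<and> (\<exists>a\<in>S. {a, u} \<in> E) \<and> (\<exists>a\<in>S. {a, w} \<in> E)"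

lemma bridge_nonempty: "bridge u w S \<Longrightarrow> S \<noteq> {}"
  by (auto simp: bridge_def)

lemma bridge_insert:
  assumes "bridge u w S" "a \<in> S" "{a, b} \<in> E" "b \<noteq> u" "b \<noteq> w"
  shows "bridge u w (insert b S)"
  using assms connected_in_insert[of E S a b] by (auto simp: bridge_def)

text \<open>An edge between \<open>A\<close> and \<open>B\<close> completes a
  \<open>K\<^sub>4\<close> with the branch sets \<open>A\<close>, \<open>B\<close>,
  \<open>{w}\<close> and the rest: the rest contains \<open>u\<close>, and the third bridge
  \<open>C\<close> makes it adjacent to \<open>w\<close>.\<close>

lemma no_adjacent_bridges:
  assumes uw: "u \<noteq> w" and br: "bridge u w A" "bridge u w B" "bridge u w C"
    and disj: "A \<inter> B = {}" "A \<inter> C = {}" "B \<inter> C = {}"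
    and R: "connected_in E (UNIV - (A \<union> B \<union> C \<union> {w}))"
    and ab: "a \<in> A" "b \<in> B" "{a, b} \<in> E"
  shows False
proof -
  obtain cu cw where c: "cu \<in> C" "{cu, u} \<in> E" "cw \<in> C" "{cw, w} \<in> E" using br by (auto simp: bridge_def)
  obtain au aw where au: "au \<in> A" "{au, u} \<in> E" "aw \<in> A" "{aw, w} \<in> E" using br by (auto simp: bridge_def)
  obtain bu bw where bu: "bu \<in> B" "{bu, u} \<in> E" "bw \<in> B" "{bw, w} \<in> E" using br by (auto simp: bridge_def)
  have un: "u \<notin> A" "u \<notin> B" "u \<notin> C" "w \<notin> A" "w \<notin> B" "w \<notin> C" using br by (auto simp: bridge_def)
  define \<rho> where "\<rho> x = (if x \<in> A then a else if x \<in> B then b else if x = w then w else u)" for x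
  have \<rho>: "\<And>x. x \<in> A \<Longrightarrow> \<rho> x = a" "\<And>x. x \<in> B \<Longrightarrow> \<rho> x = b" "\<rho> w = w" "\<rho> u = u" "\<And>x. x \<in> C \<Longrightarrow> \<rho> x = u"
    using disj un uw by (auto simp: \<rho>_def)
  have range: "range \<rho> = {a, b, w, u}"
  proof
    show "range \<rho> \<subseteq> {a, b, w, u}" by (auto simp: \<rho>_def)
    show "{a, b, w, u} \<subseteq> range \<rho>" using \<rho> ab by (metis empty_subsetI insert_subset rangeI)
  qed
  have distinct: "a \<noteq> b" "a \<noteq> w" "a \<noteq> u" "b \<noteq> w" "b \<noteq> u" using ab un disj by auto
  have fibres: "{x. \<rho> x = a} = A" "{x. \<rho> x = b} = B" "{x. \<rho> x = w} = {w}"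
    "{x. \<rho> x = u} = UNIV - (A \<union> B \<union> C \<union> {w}) \<union> C"
    using distinct uw disj un by (auto simp: \<rho>_def)
  have "connected_in E (UNIV - (A \<union> B \<union> C \<union> {w}) \<union> C)"
    by (rule connected_in_Un[OF R, of C u cu]) (use br c un uw in \<open>auto simp: bridge_def insert_commute\<close>)
  then have 1: "connected_in E {x. \<rho> x = r}" if "r \<in> range \<rho>" for r
    using that fibres br connected_in_singleton unfolding range bridge_def by force
  have 2: "\<rho> (\<rho> x) = \<rho> x" for x
    using \<rho> ab unfolding \<rho>_def[of x] by auto
  have B: "branching E \<rho>" using branchingI[OF simple 2 1] by simp
  have "\<rho> ` {a, b} = {a, b}" "\<rho> ` {au, u} = {a, u}" "\<rho> ` {aw, w} = {a, w}" 
    "\<rho> ` {bu, u} = {b, u}" "\<rho> ` {bw, w} = {b, w}" "\<rho> ` {cw, w} = {u, w}"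
    using \<rho> ab au bu c by auto
  then have adj: "\<exists>e\<in>E. \<rho> ` e = {a, b}" "\<exists>e\<in>E. \<rho> ` e = {a, u}" "\<exists>e\<in>E. \<rho> ` e = {a, w}"
    "\<exists>e\<in>E. \<rho> ` e = {b, u}" "\<exists>e\<in>E. \<rho> ` e = {b, w}" "\<exists>e\<in>E. \<rho> ` e = {u, w}"
    using ab au bu c by blast+
  show False
  proof (rule no_K4[OF B])
    show "card (range \<rho>) = 4" unfolding range using distinct uw by (simp add: eval_nat_numeral)
    fix r s assume "r \<in> range \<rho>" "s \<in> range \<rho>" "r \<noteq> s"
    then have "{r, s} \<in> {{a, b}, {a, u}, {a, w}, {b, u}, {b, w}, {u, w}}"
      unfolding range by (elim insertE; auto simp: insert_commute)
    then show "\<exists>e\<in>E. \<rho> ` e = {r, s}"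
      by (elim insertE emptyE; simp only: adj)
  qed
qed

text \<open>When no bridge can grow, an edge leaving a bridge ends in \<open>u\<close>,
  \<open>w\<close> or another bridge. The last case would give a \<open>K\<^sub>4\<close>, so the
  bridges are separated by \<open>u\<close> and \<open>w\<close>, and \<open>{w}\<close>, the three
  bridges and the rest around \<open>u\<close> form the five branch sets of the nullity
  bound.\<close>

lemma no_three_bridges_maximal:
  assumes uw: "u \<noteq> w" and br: "\<And>i. i < 3 \<Longrightarrow> bridge u w (Y i)"
    and disj: "\<And>i j. i < 3 \<Longrightarrow> j < 3 \<Longrightarrow> i \<noteq> j \<Longrightarrow> Y i \<inter> Y j = {}"
    and maximal: "\<And>i a b. i < (3::nat) \<Longrightarrow> a \<in> Y i \<Longrightarrow> {a, b} \<in> E \<Longrightarrow> b \<in> (\<Union>j<3. Y j) \<union> {u, w}"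
  shows False
proof -
  define U where "U = (\<Union>j<3. Y j)"
  define R where "R = UNIV - (U \<union> {w})"
  have U3: "U = Y 0 \<union> Y 1 \<union> Y 2" by (auto simp: U_def eval_nat_numeral lessThan_Suc)
  have un: "u \<notin> Y i" "w \<notin> Y i" if "i < 3" for i using br[OF that] by (auto simp: bridge_def)
  have uR: "u \<in> R" using uw un by (auto simp: R_def U_def)
  \<comment> \<open>A part of \<open>R\<close> not reached from \<open>u\<close> has no edge to a
    bridge by maximality, so \<open>w\<close> would be its only outside neighbour and hence a cut
    vertex.\<close>
  have R: "connected_in E R"
  proof -
    have "R \<subseteq> component E R u"
    proof (rule ccontr)
      let ?C = "R - component E R u"
      assume "\<not> R \<subseteq> component E R u"
      then have ne: "?C \<noteq> {}" by auto
      have "?C \<union> {w} = UNIV"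
      proof (rule no_cut_vertex[OF ne])
        show "w \<notin> ?C" by (auto simp: R_def)
        fix a b assume a: "a \<in> ?C" and ab: "{a, b} \<in> E"
        have "a \<noteq> u" using a component_self[of u E R] by auto
        then have "b \<notin> U" using maximal[of _ b a] a ab by (auto simp: U_def R_def insert_commute)
        moreover have "b \<notin> component E R u"
        proof
          assume "b \<in> component E R u"
          then have "a \<in> component E R u" using component_closed[of b E R u a] uR a ab by (auto simp: insert_commute)
          then show False using a by simp
        qed
        ultimately show "b \<in> ?C \<or> b = w" by (auto simp: R_def)
      qed
      moreover have "u \<notin> ?C \<union> {w}" using uw component_self[of u E R] by auto
      ultimately show False by auto
    qed
    then have "R = component E R u" using component_subset[OF uR] by auto
    then show ?thesis using connected_in_component by metis
  qed
  have nonadj: "{a, b} \<notin> E" if ij: "i < 3" "j < 3" "i \<noteq> j" "a \<in> Y i" "b \<in> Y j" for i j a b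
  proof
    assume ab: "{a, b} \<in> E"
    \<comment> \<open>The indices 0, 1 and 2 add up to 3, so this is the remaining one.\<close>
    define k where "k = 3 - i - j"
    have k: "k < 3" "k \<noteq> i" "k \<noteq> j" "Y i \<union> Y j \<union> Y k = U"
      using ij by (auto simp: k_def U3 less_Suc_eq eval_nat_numeral)
    show False
      by (rule no_adjacent_bridges[OF uw br[OF ij(1)] br[OF ij(2)] br[OF k(1)], of a b])
         (use disj ij k ab R in \<open>auto simp: R_def\<close>)
  qed
  have "\<exists>y. y \<in> Y i" if "i < 3" for i using bridge_nonempty[OF br[OF that]] by auto
  then obtain y where y: "\<And>i. i < 3 \<Longrightarrow> y i \<in> Y i" by metis
  define \<rho> where "\<rho> x = (if x \<in> Y 0 then y 0 else if x \<in> Y 1 then y 1 else if x \<in> Y 2 then y 2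
     else if x = w then w else u)" for x
  have \<rho>Y: "\<rho> x = y i" if "x \<in> Y i" "i < 3" for x i
    using disj[of 0 1] disj[of 0 2] disj[of 1 2] that 
    by (auto simp: \<rho>_def less_Suc_eq eval_nat_numeral)
  have \<rho>uw: "\<rho> u = u" "\<rho> w = w" using un[of 0] un[of 1] un[of 2] uw by (auto simp: \<rho>_def)
  have yuw: "y i \<noteq> u" "y i \<noteq> w" if "i < 3" for i using y[OF that] un[OF that] by auto
  have yy: "y i \<noteq> y j" if "i < 3" "j < 3" "i \<noteq> j" for i j using y disj that by (metis disjoint_iff)
  have cases: "(\<exists>i<3. x \<in> Y i) \<or> x = w \<or> (\<rho> x = u \<and> x \<in> R)" for x
  proof -
    have "x \<in> U \<or> x = w \<or> (\<rho> x = u \<and> x \<in> R)" by (auto simp: \<rho>_def R_def U3)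
    then show ?thesis unfolding U_def by blast
  qed
  have range: "range \<rho> = insert u (insert w (y ` {..<3}))"
  proof
    show "range \<rho> \<subseteq> insert u (insert w (y ` {..<3}))"
    proof
      fix r assume "r \<in> range \<rho>"
      then obtain x where "r = \<rho> x" by auto
      then show "r \<in> insert u (insert w (y ` {..<3}))" using cases[of x] \<rho>Y \<rho>uw by auto
    qed
    show "insert u (insert w (y ` {..<3})) \<subseteq> range \<rho>"
      using \<rho>Y \<rho>uw y by (auto intro: range_eqI[of _ _ u] range_eqI[of _ _ w]) (metis rangeI)
  qed
  have card_y: "card (y ` {..<3}) = 3"
    using yy by (subst card_image) (auto simp: inj_on_def)
  have diff: "range \<rho> - {u, w} = y ` {..<3}" unfolding range using yuw by auto
  have fib: "{x. \<rho> x = y i} = Y i" if "i < 3" for i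
  proof
    show "{x. \<rho> x = y i} \<subseteq> Y i"
    proof
      fix x assume "x \<in> {x. \<rho> x = y i}"
      then show "x \<in> Y i" using cases[of x] \<rho>Y[of x] \<rho>uw yuw[OF that] yy[OF that] by auto
    qed
  qed (use \<rho>Y that in auto)
  have w_only: "x = w" if "\<rho> x = w" for x
    using cases[of x] \<rho>Y yuw(2) uw that by metis
  have u_only: "x \<in> R" if "\<rho> x = u" for x
    using cases[of x] \<rho>Y \<rho>uw(2) yuw(1) uw that by metis
  have fibw: "{x. \<rho> x = w} = {w}" using w_only \<rho>uw by auto
  have "\<rho> x = u" if "x \<in> R" for x
    using that unfolding R_def U3 \<rho>_def by simp
  then have fibu: "{x. \<rho> x = u} = R" using u_only by blast
  have B: "branching E \<rho>"
  proof (rule branchingI[OF simple])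
    show "\<rho> (\<rho> x) = \<rho> x" for x using cases[of x] \<rho>Y \<rho>uw y by auto
    fix r assume "r \<in> range \<rho>"
    then consider "r = u" | "r = w" | i where "i < 3" "r = y i" unfolding range by auto
    then show "connected_in E {x. \<rho> x = r}"
      by cases (use fib fibu fibw R br in \<open>auto simp: bridge_def\<close>)
  qed
  have "nullity_attained E 3"
  proof (rule branching.three_bridges_nullity[OF B _ _ uw])
    show "u \<in> range \<rho>" "w \<in> range \<rho>" by (auto simp: range)
    show "card (range \<rho> - {u, w}) = 3" using diff card_y by simp
    fix x assume "x \<in> range \<rho> - {u, w}"
    then obtain i where i: "i < 3" "x = y i" unfolding diff by auto
    then obtain au aw where au: "au \<in> Y i" "{au, u} \<in> E" "aw \<in> Y i" "{aw, w} \<in> E"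
      using br[OF i(1)] by (auto simp: bridge_def)
    then have "\<rho> ` {au, u} = {x, u}" "\<rho> ` {aw, w} = {x, w}" using \<rho>Y i \<rho>uw by auto
    then show "(\<exists>e\<in>E. \<rho> ` e = {x, u}) \<and> (\<exists>e\<in>E. \<rho> ` e = {x, w})" using au by blast
  next
    fix a b assume ab: "\<rho> a \<notin> {u, w}" "\<rho> b \<noteq> \<rho> a" "{a, b} \<in> E"
    then obtain i where i: "i < 3" "a \<in> Y i" using cases[of a] \<rho>uw by auto
    then consider j where "j < 3" "b \<in> Y j" | "b \<in> {u, w}" using maximal[OF i ab(3)] by auto
    then show "b \<in> {u, w}"
    proof cases
      case 1
      then have "i = j" using nonadj[OF i(1) 1(1) _ i(2) 1(2)] ab by auto
      then show ?thesis using \<rho>Y i 1 ab by auto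
    qed
  qed
  then show False using low by simp
qed

text \<open>Among all triples of disjoint bridges take one of largest total size: absorbing a
  further neighbour would contradict its choice.\<close>

lemma no_three_bridges:
  assumes uw: "u \<noteq> w" and br: "bridge u w A" "bridge u w B" "bridge u w C"
    and disj: "A \<inter> B = {}" "A \<inter> C = {}" "B \<inter> C = {}"
  shows False
proof -
  let ?P = "\<lambda>Y :: nat \<Rightarrow> 'n set. (\<forall>i<3. bridge u w (Y i)) \<and> (\<forall>i<3. \<forall>j<3. i \<noteq> j \<longrightarrow> Y i \<inter> Y j = {})"
  let ?f = "\<lambda>Y :: nat \<Rightarrow> 'n set. \<Sum>i<3. card (Y i)"
  have P: "?P (\<lambda>i. if i = 0 then A else if i = 1 then B else C)"
    using br disj by (auto simp: less_Suc_eq eval_nat_numeral)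
  have "?f Y \<le> 3 * CARD('n)" for Y
  proof -
    have "?f Y \<le> of_nat (card {..<3::nat}) * CARD('n)" by (rule sum_bounded_above) (simp add: card_mono)
    then show ?thesis by simp
  qed
  then have bound: "\<forall>Y. ?P Y \<longrightarrow> ?f Y < Suc (3 * CARD('n))" by (simp add: less_Suc_eq_le)
  obtain Y where "?P Y \<and> (\<forall>Z. ?P Z \<longrightarrow> ?f Z \<le> ?f Y)"
    using ex_has_greatest_nat[of ?P, OF P bound] by (elim exE)
  then have Y: "?P Y" and max: "\<And>Z. ?P Z \<Longrightarrow> ?f Z \<le> ?f Y" by blast+
  show False
  proof (rule no_three_bridges_maximal[OF uw, of Y])
    fix i a b assume i: "i < (3::nat)" "a \<in> Y i" "{a, b} \<in> E"
    show "b \<in> (\<Union>j<3. Y j) \<union> {u, w}"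
    proof (rule ccontr)
      assume b: "b \<notin> (\<Union>j<3. Y j) \<union> {u, w}"
      let ?Z = "Y(i := insert b (Y i))"
      have "bridge u w (insert b (Y i))" using Y i b by (intro bridge_insert[of _ _ _ a]) auto
      then have "?P ?Z" using Y b i(1) by auto
      moreover have "?f ?Z > ?f Y"
        using i b by (intro sum_strict_mono_ex1) (auto intro!: bexI[of _ i])
      moreover have "?f ?Z \<le> ?f Y" using max \<open>?P ?Z\<close> by blast
      ultimately show False using leD by blast
    qed
  qed (use Y in auto)
qed

section \<open>Existence of a Hamiltonian cycle\<close>

definition closed_path :: "'n list \<Rightarrow> bool" where
  "closed_path xs \<longleftrightarrow> 3 \<le> length xs \<and> distinct xs \<and> edge_path E xs \<and> {last xs, hd xs} \<in> E"

lemma closed_path_rotate: "closed_path (p @ q) \<Longrightarrow> closed_path (q @ p)"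
  unfolding closed_path_def
  by (cases "p = []"; cases "q = []") (auto simp: successively_append_iff add.commute)

text \<open>A vertex that is not a cut vertex has two neighbours, which are joined by a path
  avoiding it.\<close>

lemma closed_path_exists: "\<exists>xs. closed_path xs"
proof -
  obtain v :: 'n where True by simp
  obtain a where "a \<noteq> v" using degree_two_neighbours[OF simple degree[of v]] by metis
  then obtain r where r: "r \<noteq> v" "connected_in E (UNIV - {r})"
    using non_cut_vertex[OF connected_UNIV, of v] by blast
  obtain b c where bc: "b \<noteq> c" "{r, b} \<in> E" "{r, c} \<in> E" "b \<noteq> r" "c \<noteq> r"
    using degree_two_neighbours[OF simple degree[of r]] by metis
  obtain p where p: "p \<noteq> []" "hd p = b" "last p = c" "distinct p" "set p \<subseteq> UNIV - {r}" "edge_path E p"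
    using connected_in_path[OF r(2), of b c] bc by auto
  have "length p \<ge> 2"
    using p bc(1) by (cases p; cases "tl p") auto
  then have "closed_path (r # p)"
    using p bc by (cases p) (auto simp: closed_path_def insert_commute)
  then show ?thesis ..
qed

text \<open>A component \<open>D\<close> off a longest cycle is attached to two cycle vertices. If
  these are neighbours on the cycle, a detour through \<open>D\<close> gives a longer cycle;
  otherwise the two arcs between them and \<open>D\<close> are three bridges.\<close>

lemma hamiltonian: "\<exists>xs. closed_path xs \<and> set xs = UNIV"
proof -
  obtain xs0 where xs0: "closed_path xs0" using closed_path_exists by auto
  have bound: "\<forall>xs. closed_path xs \<longrightarrow> length xs < Suc (CARD('n))"
  proof (intro allI impI)
    fix xs assume "closed_path xs"
    then have "length xs = card (set xs)" by (simp add: closed_path_def distinct_card)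
    also have "\<dots> \<le> CARD('n)" by (simp add: card_mono)
    finally show "length xs < Suc (CARD('n))" by simp
  qed
  obtain xs where "closed_path xs \<and> (\<forall>ys. closed_path ys \<longrightarrow> length ys \<le> length xs)"
    using ex_has_greatest_nat[of closed_path, OF xs0 bound] by (elim exE)
  then have xs: "closed_path xs" and max: "\<And>ys. closed_path ys \<Longrightarrow> length ys \<le> length xs" by auto
  have "set xs = UNIV"
  proof (rule ccontr)
    assume "set xs \<noteq> UNIV"
    then obtain x where x: "x \<in> - set xs" by auto
    define D where "D = component E (- set xs) x"
    have D: "D \<subseteq> - set xs" "x \<in> D" "connected_in E D"
      using component_subset[OF x] component_self connected_in_component by (auto simp: D_def)
    have nD: "b \<in> D \<or> b \<in> set xs" if "a \<in> D" "{a, b} \<in> E" for a b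
      using component_closed[of a E "- set xs" x b] x that by (auto simp: D_def)
    have big: "card (set xs) \<ge> 3" using xs by (simp add: closed_path_def distinct_card)
    \<comment> \<open>A single attachment vertex would be a cut vertex, while the cycle has at least
      three vertices.\<close>
    have "\<exists>u w. u \<in> set xs \<and> w \<in> set xs \<and> u \<noteq> w \<and> (\<exists>d\<in>D. {d, u} \<in> E) \<and> (\<exists>d\<in>D. {d, w} \<in> E)"
    proof (rule ccontr)
      assume contra: "\<not> ?thesis"
      have "set xs \<noteq> {}" using big by auto
      then obtain u where u: "u \<in> set xs" "\<And>w d. w \<in> set xs \<Longrightarrow> d \<in> D \<Longrightarrow> {d, w} \<in> E \<Longrightarrow> w = u"
        using contra by (metis ex_in_conv)
      have "D \<union> {u} = UNIV"
      proof (rule no_cut_vertex)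
        show "b \<in> D \<or> b = u" if "a \<in> D" "{a, b} \<in> E" for a b
          using nD[OF that] u(2)[of b a] that by metis
      qed (use D u(1) in auto)
      then have "set xs \<subseteq> {u}" using D by auto
      then show False using big card_mono[of "{u}" "set xs"] by auto
    qed
    then obtain u w du dw where uw: "u \<in> set xs" "w \<in> set xs" "u \<noteq> w"
      "du \<in> D" "{du, u} \<in> E" "dw \<in> D" "{dw, w} \<in> E" by blast
    obtain p q where pq: "xs = p @ u # q" using uw(1) by (meson split_list)
    have "w \<in> set (q @ p)" using uw pq by auto
    then obtain A B where AB: "q @ p = A @ w # B" by (meson split_list)
    \<comment> \<open>After rotation the cycle starts at \<open>u\<close>; \<open>A\<close> and
      \<open>B\<close> are the two open arcs between \<open>u\<close> and \<open>w\<close>.\<close>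
    have cyc: "closed_path (u # A @ w # B)"
      using closed_path_rotate[of p "u # q"] xs pq AB by auto
    have len: "length (u # A @ w # B) = length xs" 
      using pq arg_cong[OF AB, of length] by simp
    have set: "set (u # A @ w # B) = set xs" using pq arg_cong[OF AB, of set] by auto
    have c: "distinct (u # A @ w # B)" "edge_path E (u # A @ w # B)" "{last (u # A @ w # B), u} \<in> E"
      using cyc by (auto simp: closed_path_def)
    show False
    proof (cases "A = [] \<or> B = []")
      case True
      then show False
      proof
        assume A: "A = []"
        obtain P where P: "P \<noteq> []" "hd P = du" "last P = dw" "distinct P" "set P \<subseteq> D" "edge_path E P"
          using connected_in_path[OF D(3) uw(4,6)] by metis
        have "set P \<inter> set xs = {}" using P D by auto
        then have "closed_path (u # P @ w # B)"
          using P c A uw set D cyc by (cases P) (auto simp: closed_path_def successively_append_iff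
              successively_Cons insert_commute split: if_splits)
        then show False using max[of "u # P @ w # B"] len A P(1) by (cases P) auto
      next
        assume B: "B = []"
        obtain P where P: "P \<noteq> []" "hd P = dw" "last P = du" "distinct P" "set P \<subseteq> D" "edge_path E P"
          using connected_in_path[OF D(3) uw(6,4)] by metis
        have "set P \<inter> set xs = {}" using P D by auto
        then have "closed_path ((u # A @ [w]) @ P)"
          unfolding closed_path_def successively_append_iff
          using P c B uw set D cyc by (auto simp: closed_path_def insert_commute)
        then show False using max[of "(u # A @ [w]) @ P"] len B P(1) by (cases P) auto
      qed
    next
      case False
      then have ne: "A \<noteq> []" "B \<noteq> []" by auto
      have "edge_path E (u # A)" "edge_path E (w # B)" "{last A, w} \<in> E"
        using c(2) ne successively_append_iff[of _ "u # A" "w # B"] by auto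
      then have parts: "edge_path E A" "{u, hd A} \<in> E" "edge_path E B" "{w, hd B} \<in> E" "{last A, w} \<in> E"
        using ne by (metis list.exhaust_sel successively_Cons)+
      have last: "{last B, u} \<in> E" using c(3) ne by simp
      have "bridge u w (set A)" unfolding bridge_def
        using edge_path_connected[OF parts(1)] c(1) parts(2,5) ne
          hd_in_set[of A] last_in_set[of A] by (auto simp: insert_commute)
      moreover have "bridge u w (set B)" unfolding bridge_def
        using edge_path_connected[OF parts(3)] c(1) parts(4) last ne
          hd_in_set[of B] last_in_set[of B] by (auto simp: insert_commute)
      moreover have "bridge u w D" unfolding bridge_def using D uw by auto
      ultimately show False
        by (rule no_three_bridges[OF uw(3)]) (use c(1) D set in auto)
    qed
  qed
  then show ?thesis using xs by blast
qed

end

section \<open>Chords of a Hamiltonian cycle, numbered periodically so that a window may start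
  anywhere\<close>

locale hamiltonian_cycle = low_nullity E for E :: "'n::finite set set" +
  fixes z :: "nat \<Rightarrow> 'n" and N :: nat
  assumes N3: "3 \<le> N" and z_eq: "\<And>i j. z i = z j \<longleftrightarrow> i mod N = j mod N"
    and z_surj: "\<And>v. \<exists>i. z i = v" and z_step: "\<And>i. {z i, z (Suc i)} \<in> E"
begin

lemma z_shift [simp]: "z (i + N) = z i"
  by (simp add: z_eq)

lemma z_inj: "z i = z j \<Longrightarrow> a \<le> i \<Longrightarrow> i < a + N \<Longrightarrow> a \<le> j \<Longrightarrow> j < a + N \<Longrightarrow> i = j"
proof (induction i j rule: linorder_wlog)
  case (le i j)
  then have "N dvd j - i" by (metis z_eq mod_eq_dvd_iff_nat)
  then show ?case using le by (auto dest!: dvd_imp_le)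
qed auto

lemma inj_on_window: "inj_on z {a..<a + N}"
  by (rule inj_onI) (use z_inj in auto)

lemma window: "z ` {a..<a + N} = UNIV"
proof -
  have "UNIV \<subseteq> z ` {..<N}"
  proof
    fix v :: 'n
    obtain i where "z i = v" using z_surj by auto
    then have "v = z (i mod N)" by (metis z_eq mod_mod_trivial)
    then show "v \<in> z ` {..<N}" using N3 by auto
  qed
  then have "CARD('n) \<le> N" by (metis card_image_le card_lessThan card_mono finite_lessThan finite order_trans)
  moreover have "card (z ` {a..<a + N}) = N" using inj_on_window by (simp add: card_image)
  moreover have "card (z ` {a..<a + N}) \<le> CARD('n)" by (simp add: card_mono)
  ultimately have "card (z ` {a..<a + N}) = CARD('n)" by linarith
  then show ?thesis by (simp add: card_eq_UNIV_imp_eq_UNIV)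
qed

definition idx :: "nat \<Rightarrow> 'n \<Rightarrow> nat" where
  "idx a = inv_into {a..<a + N} z"

lemma idx: "a \<le> idx a v" "idx a v < a + N" "z (idx a v) = v"
proof -
  have "v \<in> z ` {a..<a + N}" using window by auto
  from inv_into_into[OF this] f_inv_into_f[OF this] show "a \<le> idx a v" "idx a v < a + N" "z (idx a v) = v"
    by (auto simp: idx_def)
qed

lemma idx_z: "a \<le> i \<Longrightarrow> i < a + N \<Longrightarrow> idx a (z i) = i"
  using z_inj[of "idx a (z i)" i a] idx[of a "z i"] by auto

text \<open>Branch sets are arcs of the cycle, cut open in front of position \<open>a\<close>:
  \<open>f\<close> sends a position in the window to the first position of its arc.\<close>

definition arc_map :: "nat \<Rightarrow> (nat \<Rightarrow> nat) \<Rightarrow> 'n \<Rightarrow> 'n" where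
  "arc_map a f v = z (f (idx a v))"

lemma arc_map_z: "a \<le> i \<Longrightarrow> i < a + N \<Longrightarrow> arc_map a f (z i) = z (f i)"
  by (simp add: arc_map_def idx_z)

lemma range_arc_map: "range (arc_map a f) = z ` f ` {a..<a + N}"
proof
  show "range (arc_map a f) \<subseteq> z ` f ` {a..<a + N}" using idx(1,2)[of a] by (auto simp: arc_map_def)
  show "z ` f ` {a..<a + N} \<subseteq> range (arc_map a f)"
    by (auto simp: arc_map_z[symmetric])
qed

text \<open>The positions from \<open>f i\<close> up to \<open>i\<close> lie in one fibre and follow
  each other on the cycle, so every vertex of a fibre is linked to its representative inside the
  fibre.\<close>

lemma arc_branching:
  assumes f: "\<And>i. a \<le> i \<Longrightarrow> i < a + N \<Longrightarrow> a \<le> f i \<and> f i \<le> i"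
    and const: "\<And>i k. a \<le> i \<Longrightarrow> i < a + N \<Longrightarrow> f i \<le> k \<Longrightarrow> k \<le> i \<Longrightarrow> f k = f i"
  shows "branching E (arc_map a f)"
proof (rule branchingI[OF simple])
  have ff: "f (f i) = f i" if "a \<le> i" "i < a + N" for i using const[OF that, of "f i"] f[OF that] by auto
  show "arc_map a f (arc_map a f v) = arc_map a f v" for v
  proof -
    have "a \<le> f (idx a v)" "f (idx a v) < a + N" using f[OF idx(1,2)[of a v]] idx(2)[of a v] by auto
    then have "arc_map a f (z (f (idx a v))) = z (f (f (idx a v)))" by (rule arc_map_z)
    then show ?thesis using ff idx(1,2)[of a v] by (simp add: arc_map_def[of a f v])
  qed
  fix r assume "r \<in> range (arc_map a f)"
  then obtain i0 where i0: "a \<le> i0" "i0 < a + N" "r = z (f i0)" by (auto simp: range_arc_map)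
  let ?F = "{v. arc_map a f v = r}"
  show "connected_in E ?F"
  proof (rule connected_inI[of _ r])
    fix v assume v: "v \<in> ?F"
    define i where "i = idx a v"
    have i: "a \<le> i" "i < a + N" "z i = v" using idx by (auto simp: i_def)
    have "z (f i) = z (f i0)" using v i i0 arc_map_z[OF i(1,2)] by auto
    then have fi: "f i = f i0" using z_inj[of "f i" "f i0" a] f[OF i(1,2)] f[OF i0(1,2)] i i0 by auto
    have "(r, z k) \<in> (inside E ?F)\<^sup>*" if "f i \<le> k" "k \<le> i" for k
      using that
    proof (induction k rule: dec_induct)
      case base
      then show ?case using i0 fi by simp
    next
      case (step k)
      have "arc_map a f (z l) = r" if "f i \<le> l" "l \<le> i" for l
        using arc_map_z[of a l f] const[OF i(1,2) that] f[OF i(1,2)] i that i0 fi by auto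
      from this[of k] this[of "Suc k"] have "(z k, z (Suc k)) \<in> inside E ?F"
        using step z_step[of k] by (auto simp: inside_def)
      then show ?case using step by (meson Suc_leD rtrancl_into_rtrancl)
    qed
    from this[of i] show "(r, v) \<in> (inside E ?F)\<^sup>*" using i f[OF i(1,2)] by auto
  qed
qed

text \<open>The four arcs starting at the ends of two crossing chords form a
  \<open>K\<^sub>4\<close>-minor: four cycle edges join consecutive arcs, the chords join opposite
  ones.\<close>

lemma chords_do_not_cross:
  assumes abcd: "a < b" "b < c" "c < d" "d < a + N"
    and chords: "{z a, z c} \<in> E" "{z b, z d} \<in> E"
  shows False
proof -
  define f where "f i = (if i < b then a else if i < c then b else if i < d then c else d)" for i
  have B: "branching E (arc_map a f)"
    by (rule arc_branching) (use abcd in \<open>auto simp: f_def split: if_splits\<close>)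
  have "f ` {a..<a + N} = {a, b, c, d}"
  proof
    show "f ` {a..<a + N} \<subseteq> {a, b, c, d}" by (auto simp: f_def)
    have "f a = a" "f b = b" "f c = c" "f d = d" using abcd by (auto simp: f_def)
    then show "{a, b, c, d} \<subseteq> f ` {a..<a + N}"
      using abcd image_eqI[of a f a "{a..<a + N}"] image_eqI[of b f b "{a..<a + N}"]
        image_eqI[of c f c "{a..<a + N}"] image_eqI[of d f d "{a..<a + N}"] by simp
  qed
  then have range: "range (arc_map a f) = {z a, z b, z c, z d}" by (simp add: range_arc_map)
  have ne: "z i \<noteq> z j" if "i \<in> {a, b, c, d}" "j \<in> {a, b, c, d}" "i \<noteq> j" for i j
    using z_inj[of i j a] that abcd by auto
  have card: "card (range (arc_map a f)) = 4"
    unfolding range using ne abcd by (simp add: eval_nat_numeral)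
  have \<rho>: "arc_map a f (z i) = z (f i)" if "a \<le> i" "i < a + N" for i using arc_map_z[OF that] .
  have edge: "\<exists>e\<in>E. arc_map a f ` e = {z p, z q}"
    if "{z i, z j} \<in> E" "f i = p" "f j = q" "a \<le> i" "i < a + N" "a \<le> j" "j < a + N" for i j p q
  proof -
    have "arc_map a f ` {z i, z j} = {z p, z q}" using that \<rho>[of i] \<rho>[of j] by simp
    then show ?thesis using that(1) by metis
  qed
  have step: "{z (b - 1), z b} \<in> E" "{z (c - 1), z c} \<in> E" "{z (d - 1), z d} \<in> E" "{z (a + N - 1), z a} \<in> E"
    using z_step[of "b - 1"] z_step[of "c - 1"] z_step[of "d - 1"] z_step[of "a + N - 1"] N3 abcd by auto
  have fv: "f (b - 1) = a" "f (c - 1) = b" "f (d - 1) = c" "f (a + N - 1) = d" "f a = a" "f b = b" "f c = c" "f d = d"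
    using abcd by (auto simp: f_def)
  have adj: "\<exists>e\<in>E. arc_map a f ` e = {z a, z b}" "\<exists>e\<in>E. arc_map a f ` e = {z b, z c}"
     "\<exists>e\<in>E. arc_map a f ` e = {z c, z d}" "\<exists>e\<in>E. arc_map a f ` e = {z d, z a}"
     "\<exists>e\<in>E. arc_map a f ` e = {z a, z c}" "\<exists>e\<in>E. arc_map a f ` e = {z b, z d}"
    by (rule edge[OF step(1) fv(1,6)] edge[OF step(2) fv(2,7)] edge[OF step(3) fv(3,8)] 
        edge[OF step(4) fv(4,5)] edge[OF chords(1) fv(5,7)] edge[OF chords(2) fv(6,8)]; use abcd N3 in linarith)+
  show False
  proof (rule no_K4[OF B card])
    fix r s assume "r \<in> range (arc_map a f)" "s \<in> range (arc_map a f)" "r \<noteq> s"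
    then have "{r, s} \<in> {{z a, z b}, {z b, z c}, {z c, z d}, {z d, z a}, {z a, z c}, {z b, z d}}"
      unfolding range by (elim insertE; auto simp: insert_commute)
    then show "\<exists>e\<in>E. arc_map a f ` e = {r, s}"
      by (elim insertE emptyE; simp only: adj)
  qed
qed

text \<open>Cut the cycle just behind \<open>a\<close>, \<open>c\<close> and \<open>e\<close>. Each
  cut edge and the chord starting at the same vertex join the same two arcs, so the three arcs form
  a triangle with doubled edges.\<close>

lemma no_three_facing_chords:
  assumes ab: "a + 2 \<le> b" "b \<le> c" "c + 2 \<le> d" "d \<le> e" "e + 2 \<le> g" "g \<le> a + N"
    and chords: "{z a, z b} \<in> E" "{z c, z d} \<in> E" "{z e, z g} \<in> E"
  shows False
proof -
  \<comment> \<open>The window starts behind \<open>a\<close>, so \<open>z a\<close> occurs in it at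
    position \<open>a + N\<close>, in the third arc.\<close>
  let ?a = "Suc a"
  define f where "f i = (if i \<le> c then Suc a else if i \<le> e then Suc c else Suc e)" for i
  let ?\<rho> = "arc_map ?a f"
  have B: "branching E ?\<rho>"
    by (rule arc_branching) (use ab in \<open>auto simp: f_def split: if_splits\<close>)
  have fv: "f (Suc a) = Suc a" "f b = Suc a" "f c = Suc a" "f (Suc c) = Suc c" "f d = Suc c" "f e = Suc c" 
     "f (Suc e) = Suc e" "f g = Suc e" "f (a + N) = Suc e" using ab by (auto simp: f_def)
  have "f ` {?a..<?a + N} = {Suc a, Suc c, Suc e}"
  proof
    show "f ` {?a..<?a + N} \<subseteq> {Suc a, Suc c, Suc e}" by (auto simp: f_def)
    show "{Suc a, Suc c, Suc e} \<subseteq> f ` {?a..<?a + N}" 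
      using fv ab image_eqI[of "Suc a" f "Suc a" "{?a..<?a + N}"]
        image_eqI[of "Suc c" f "Suc c" "{?a..<?a + N}"] image_eqI[of "Suc e" f "Suc e" "{?a..<?a + N}"] by simp
  qed
  then have range: "range ?\<rho> = {z (Suc a), z (Suc c), z (Suc e)}" by (simp add: range_arc_map)
  have ne: "z i \<noteq> z j" if "?a \<le> i" "i < ?a + N" "?a \<le> j" "j < ?a + N" "i \<noteq> j" for i j
    using z_inj[of i j ?a] that by auto
  have card: "card (range ?\<rho>) = 3"
    unfolding range using ne[of "Suc a" "Suc c"] ne[of "Suc a" "Suc e"] ne[of "Suc c" "Suc e"] ab 
    by (simp add: eval_nat_numeral)
  have \<rho>: "?\<rho> (z i) = z (f i)" if "?a \<le> i" "i < ?a + N" for i using arc_map_z[OF that] .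
  have \<rho>s: "?\<rho> (z (Suc a)) = z (Suc a)" "?\<rho> (z b) = z (Suc a)" "?\<rho> (z c) = z (Suc a)" 
     "?\<rho> (z (Suc c)) = z (Suc c)" "?\<rho> (z d) = z (Suc c)" "?\<rho> (z e) = z (Suc c)"
     "?\<rho> (z (Suc e)) = z (Suc e)" "?\<rho> (z g) = z (Suc e)" "?\<rho> (z a) = z (Suc e)"
    using \<rho>[of "Suc a"] \<rho>[of b] \<rho>[of c] \<rho>[of "Suc c"] \<rho>[of d] \<rho>[of e] \<rho>[of "Suc e"] \<rho>[of g] \<rho>[of "a + N"] fv ab by auto
  have two: "\<exists>e1\<in>E. \<exists>e2\<in>E. e1 \<noteq> e2 \<and> ?\<rho> ` e1 = P \<and> ?\<rho> ` e2 = P"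
    if "P \<in> {{z (Suc a), z (Suc c)}, {z (Suc c), z (Suc e)}, {z (Suc e), z (Suc a)}}" for P
  proof -
    have "{z c, z (Suc c)} \<noteq> {z c, z d}" "{z e, z (Suc e)} \<noteq> {z e, z g}" "{z a, z (Suc a)} \<noteq> {z a, z b}"
      using ne[of "Suc c" d] ne[of "Suc e" g] ne[of "Suc a" b] ab by (auto simp: doubleton_eq_iff)
    moreover have "?\<rho> ` {z c, z (Suc c)} = {z (Suc a), z (Suc c)}" "?\<rho> ` {z c, z d} = {z (Suc a), z (Suc c)}"
      "?\<rho> ` {z e, z (Suc e)} = {z (Suc c), z (Suc e)}" "?\<rho> ` {z e, z g} = {z (Suc c), z (Suc e)}"
      "?\<rho> ` {z a, z (Suc a)} = {z (Suc e), z (Suc a)}" "?\<rho> ` {z a, z b} = {z (Suc e), z (Suc a)}"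
      using \<rho>s by auto
    ultimately show ?thesis using that chords z_step by (elim insertE emptyE) metis+
  qed
  have pairs: "{r, s} \<in> {{z (Suc a), z (Suc c)}, {z (Suc c), z (Suc e)}, {z (Suc e), z (Suc a)}}"
    if "r \<in> range ?\<rho>" "s \<in> range ?\<rho>" "r \<noteq> s" for r s
    using that unfolding range by (elim insertE; auto simp: insert_commute)
  have "nullity_attained E (card (range ?\<rho>))"
  proof (rule branching.doubled_clique_nullity[OF B])
    fix e1 assume e1: "e1 \<in> E" "card (?\<rho> ` e1) = 2"
    obtain u v where "e1 = {u, v}" "?\<rho> u \<noteq> ?\<rho> v" using edge_card_image_2[OF simple e1] by metis
    then have "?\<rho> ` e1 \<in> {{z (Suc a), z (Suc c)}, {z (Suc c), z (Suc e)}, {z (Suc e), z (Suc a)}}"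
      using pairs[of "?\<rho> u" "?\<rho> v"] by auto
    from two[OF this] show "\<exists>e'\<in>E. e' \<noteq> e1 \<and> ?\<rho> ` e' = ?\<rho> ` e1" by metis
  next
    fix r s assume "r \<in> range ?\<rho>" "s \<in> range ?\<rho>" "r \<noteq> s"
    from two[OF pairs[OF this]] show "(\<exists>e\<in>E. ?\<rho> ` e = {r, s}) \<or>
       (\<exists>X. r \<in> X \<and> s \<notin> X \<and> (\<forall>u\<in>X. \<forall>w. w \<notin> X \<longrightarrow> {u, w} \<in> E \<longrightarrow> w \<in> range ?\<rho> \<and> w \<noteq> s))" by blast
  qed
  then show False using card low by simp
qed

end

lemma induced_path_rev:
  assumes "induced_path E ps"
  shows "induced_path E (rev ps)"
  unfolding induced_path_def
proof (intro conjI allI impI)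
  fix i j assume ij: "i < length (rev ps)" "j < length (rev ps)"
  let ?n = "length ps"
  have "{rev ps ! i, rev ps ! j} \<in> E \<longleftrightarrow> {ps ! (?n - Suc i), ps ! (?n - Suc j)} \<in> E"
    using ij by (simp add: rev_nth)
  also have "\<dots> \<longleftrightarrow> ?n - Suc j = Suc (?n - Suc i) \<or> ?n - Suc i = Suc (?n - Suc j)"
    using assms ij by (simp add: induced_path_def)
  also have "\<dots> \<longleftrightarrow> j = Suc i \<or> i = Suc j" using ij by auto
  finally show "{rev ps ! i, rev ps ! j} \<in> E \<longleftrightarrow> j = Suc i \<or> i = Suc j" .
qed (use assms in \<open>auto simp: induced_path_def\<close>)

text \<open>The first vertex of an induced path covering the graph has at most one
  neighbour.\<close>

lemma C2_not_path_graph: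
  fixes E :: "'n::finite set set"
  assumes "simple_graph E" "C2_graph E"
  shows "\<not> is_path_graph E"
proof
  assume "is_path_graph E"
  then obtain ps where ps: "induced_path E ps" "set ps = UNIV" by (auto simp: is_path_graph_def)
  have "2 \<le> vertex_degree E (ps ! 0)" using assms by (simp add: C2_graph_def)
  then obtain a b where ab: "a \<noteq> b" "{ps ! 0, a} \<in> E" "{ps ! 0, b} \<in> E"
    using degree_two_neighbours[OF assms(1)] by metis
  have "c = ps ! 1" if "{ps ! 0, c} \<in> E" for c
  proof -
    obtain j where "j < length ps" "ps ! j = c" using ps(2) by (metis UNIV_I in_set_conv_nth)
    then show ?thesis using ps(1) that by (auto simp: induced_path_def)
  qed
  then show False using ab by metis
qed

context hamiltonian_cycle begin

lemma induced_arc: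
  assumes "p < q" "q \<le> p + N"
    and chord: "\<And>i j. p \<le> i \<Longrightarrow> i < j \<Longrightarrow> j < q \<Longrightarrow> {z i, z j} \<in> E \<Longrightarrow> j = Suc i"
  shows "induced_path E (map z [p..<q])"
  unfolding induced_path_def
proof (intro conjI allI impI)
  show "distinct (map z [p..<q])"
    using assms(2) by (auto simp: distinct_map intro: inj_on_subset[OF inj_on_window[of p]])
  fix i j assume "i < length (map z [p..<q])" "j < length (map z [p..<q])"
  then have ij: "p + i < q" "p + j < q" by auto
  have "{z (p + i), z (p + j)} \<in> E \<longleftrightarrow> j = Suc i \<or> i = Suc j"
  proof
    assume e: "{z (p + i), z (p + j)} \<in> E"
    then have "i \<noteq> j" using edge_distinct[OF simple e] by auto
    then show "j = Suc i \<or> i = Suc j"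
      using chord[of "p + i" "p + j"] chord[of "p + j" "p + i"] e ij by (auto simp: insert_commute neq_iff)
  next
    assume "j = Suc i \<or> i = Suc j"
    then show "{z (p + i), z (p + j)} \<in> E"
      using z_step[of "p + i"] z_step[of "p + j"] by (auto simp: insert_commute)
  qed
  then show "{map z [p..<q] ! i, map z [p..<q] ! j} \<in> E \<longleftrightarrow> j = Suc i \<or> i = Suc j"
    using ij by simp
qed (use assms in simp)

text \<open>Removing the cycle edges behind \<open>s\<close> and behind \<open>t\<close> leaves two
  arcs without inner chords. The second is reversed so that both paths start at the edge removed
  behind \<open>s\<close>; a crossing of edges is then a crossing of chords.\<close>

lemma two_arcs_parallel:
  assumes st: "s < t" "t < s + N"
    and left: "\<And>i j. s < i \<Longrightarrow> i < j \<Longrightarrow> j \<le> t \<Longrightarrow> {z i, z j} \<in> E \<Longrightarrow> j = Suc i"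
    and right: "\<And>i j. t < i \<Longrightarrow> i < j \<Longrightarrow> j \<le> s + N \<Longrightarrow> {z i, z j} \<in> E \<Longrightarrow> j = Suc i"
  shows "two_parallel_paths E"
proof -
  let ?ps = "map z [Suc s..<Suc t]" and ?qs = "rev (map z [Suc t..<Suc (s + N)])"
  have 1: "induced_path E ?ps" by (rule induced_arc) (use st left in auto)
  have 2: "induced_path E ?qs" by (rule induced_path_rev, rule induced_arc) (use st right in auto)
  have 3: "set ?ps \<inter> set ?qs = {}"
  proof (rule equals0I)
    fix v assume "v \<in> set ?ps \<inter> set ?qs"
    then obtain i j where "Suc s \<le> i" "i < Suc t" "v = z i" "Suc t \<le> j" "j < Suc (s + N)" "v = z j"
      by (auto simp del: upt_Suc)
    then show False using z_inj[of i j "Suc s"] st by auto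
  qed
  have "set ?ps \<union> set ?qs = z ` ({Suc s..<Suc t} \<union> {Suc t..<Suc (s + N)})" by (simp add: image_Un del: upt_Suc)
  also have "{Suc s..<Suc t} \<union> {Suc t..<Suc (s + N)} = {Suc s..<Suc s + N}" using st by auto
  finally have 4: "set ?ps \<union> set ?qs = UNIV" by (simp only: window)
  have 5: "\<not> crossing E ?ps ?qs"
  proof
    assume "crossing E ?ps ?qs"
    then obtain i j k l where ijkl: "i < k" "k < length ?ps" "l < j" "j < length ?qs"
      "{?ps ! i, ?qs ! j} \<in> E" "{?ps ! k, ?qs ! l} \<in> E" unfolding crossing_def by blast
    have p: "?ps ! i = z (Suc s + i)" "?ps ! k = z (Suc s + k)" using ijkl(1,2) by (simp_all del: upt_Suc)
    have q: "?qs ! j = z (s + N - j)" "?qs ! l = z (s + N - l)" 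
    proof -
      have "Suc (s + N - Suc j) = s + N - j" "Suc (s + N - Suc l) = s + N - l" using ijkl(3,4) st by auto
      then show "?qs ! j = z (s + N - j)" "?qs ! l = z (s + N - l)"
        using ijkl(3,4) by (simp_all add: rev_nth del: upt_Suc)
    qed
    show False
      by (rule chords_do_not_cross[of "Suc s + i" "Suc s + k" "s + N - j" "s + N - l"])
        (use ijkl p q st in \<open>auto simp del: upt_Suc\<close>)
  qed
  show ?thesis
    unfolding two_parallel_paths_def using C2_not_path_graph[OF simple C2] 1 2 3 4 5 by blast
qed

text \<open>Cut inside a shortest chord and inside a shortest chord on its far side. A chord with
  both ends in one remaining arc either lies under one of these two and is too short, crosses one of
  them, or faces away from both and completes three facing chords.\<close>

lemma two_parallel_paths: "two_parallel_paths E"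
\<comment> \<open>The bounds on \<open>m\<close> single out genuine chords: spans 1 and
  \<open>N - 1\<close> are cycle edges.\<close>
proof (cases "\<exists>m s. 2 \<le> m \<and> m + 2 \<le> N \<and> {z s, z (s + m)} \<in> E")
  case False
  have no: "\<not> {z i, z j} \<in> E" if "i + 2 \<le> j" "j + 2 \<le> i + N" for i j
  proof
    assume "{z i, z j} \<in> E"
    then have "2 \<le> j - i \<and> j - i + 2 \<le> N \<and> {z i, z (i + (j - i))} \<in> E" using that by auto
    then show False using False by blast
  qed
  show ?thesis
  proof (rule two_arcs_parallel[of 0 1])
    fix i j assume "1 < i" "i < j" "j \<le> 0 + N" "{z i, z j} \<in> E"
    then show "j = Suc i" using no[of i j] by force
  qed (use N3 in auto)
next
  case True
  define m where "m = (LEAST m. \<exists>s. 2 \<le> m \<and> m + 2 \<le> N \<and> {z s, z (s + m)} \<in> E)"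
  have "\<exists>s. 2 \<le> m \<and> m + 2 \<le> N \<and> {z s, z (s + m)} \<in> E"
    unfolding m_def using True by (rule LeastI_ex)
  then obtain s where s: "2 \<le> m" "m + 2 \<le> N" "{z s, z (s + m)} \<in> E" by auto
  have min_m: "m \<le> j - i" if "i + 2 \<le> j" "j + 2 \<le> i + N" "{z i, z j} \<in> E" for i j
    unfolding m_def by (rule Least_le) (use that in \<open>auto intro!: exI[of _ i]\<close>)
  let ?Q = "\<lambda>l. \<exists>a. s + m \<le> a \<and> a + l \<le> s + N \<and> 2 \<le> l \<and> {z a, z (a + l)} \<in> E"
  define l where "l = (LEAST l. ?Q l)"
  have "?Q (N - m)"
    using s by (intro exI[of _ "s + m"]) (auto simp: insert_commute)
  then have "?Q l" unfolding l_def by (rule LeastI)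
  then obtain a where a: "s + m \<le> a" "a + l \<le> s + N" "2 \<le> l" "{z a, z (a + l)} \<in> E" by auto
  have min_l: "l \<le> j - i" if "s + m \<le> i" "j \<le> s + N" "i + 2 \<le> j" "{z i, z j} \<in> E" for i j
    unfolding l_def by (rule Least_le) (use that in \<open>auto intro!: exI[of _ i]\<close>)
  show ?thesis
  proof (rule two_arcs_parallel[of s a])
    show "s < a" "a < s + N" using s a by auto
    fix i j assume ij: "s < i" "i < j" "j \<le> a" "{z i, z j} \<in> E"
    show "j = Suc i"
    proof (rule ccontr)
      assume "j \<noteq> Suc i"
      then have far: "i + 2 \<le> j" using ij by auto
      consider "j \<le> s + m" | "s + m \<le> i" | "i < s + m" "s + m < j" by linarith
      then show False
      proof cases
        case 1
        then show False using min_m[OF far _ ij(4)] ij s by auto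
      next
        case 2
        show False
          by (rule no_three_facing_chords[of s "s + m" i j a "a + l"]) (use 2 ij far s a in auto)
      next
        case 3
        show False
          by (rule chords_do_not_cross[of s i "s + m" j]) (use 3 ij s a in auto)
      qed
    qed
  next
    fix i j assume ij: "a < i" "i < j" "j \<le> s + N" "{z i, z j} \<in> E"
    show "j = Suc i"
    proof (rule ccontr)
      assume "j \<noteq> Suc i"
      then have far: "i + 2 \<le> j" using ij by auto
      consider "j \<le> a + l" | "a + l \<le> i" | "i < a + l" "a + l < j" by linarith
      then show False
      proof cases
        case 1
        then show False using min_l[of i j] far ij a by auto
      next
        case 2
        show False
          by (rule no_three_facing_chords[of s "s + m" a "a + l" i j]) (use 2 ij far s a in auto)
      next
        case 3
        show False
          by (rule chords_do_not_cross[of a i "a + l" j]) (use 3 ij s a in auto)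
      qed
    qed
  qed
qed

end

lemma low_nullity_two_parallel_paths:
  fixes E :: "'n::finite set set"
  assumes "simple_graph E" "C2_graph E" "\<not> nullity_attained E 3"
  shows "two_parallel_paths E"
proof -
  interpret low_nullity E by unfold_locales (use assms in auto)
  obtain xs where xs: "closed_path xs" "set xs = UNIV" using hamiltonian by auto
  let ?N = "length xs"
  have N: "3 \<le> ?N" "distinct xs" "edge_path E xs" "{last xs, hd xs} \<in> E" using xs(1) by (auto simp: closed_path_def)
  define z where "z i = xs ! (i mod ?N)" for i
  have mod: "i mod ?N < ?N" for i using N by (intro mod_less_divisor) auto
  interpret hamiltonian_cycle E z ?N
  proof
    show "z i = z j \<longleftrightarrow> i mod ?N = j mod ?N" for i j
      using N(2) mod by (simp add: z_def nth_eq_iff_index_eq)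
    show "\<exists>i. z i = v" for v
      using xs(2) by (metis UNIV_I in_set_conv_nth mod_less z_def)
    show "{z i, z (Suc i)} \<in> E" for i
    proof (cases "Suc (i mod ?N) = ?N")
      case True
      then have "i mod ?N = ?N - 1" "Suc i mod ?N = 0" by (auto simp: mod_Suc)
      moreover have "xs \<noteq> []" using N(1) by auto
      ultimately show ?thesis using N(4) by (simp add: z_def last_conv_nth hd_conv_nth)
    next
      case False
      then have "Suc i mod ?N = Suc (i mod ?N)" "Suc (i mod ?N) < ?N" using mod[of i] by (auto simp: mod_Suc)
      then show ?thesis using N(3) successively_nth[of _ xs "i mod ?N"] by (auto simp: z_def)
    qed
  qed (use N in auto)
  show ?thesis by (rule two_parallel_paths)
qed

section \<open>Zero forcing in LSEAC graphs\<close>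

text \<open>Closure under the colour change rule of zero forcing, except that the vertices of
  \<open>f\<close> never force. Forcing up to \<open>f\<close> therefore remains valid when a
  further cell is glued on along \<open>f\<close>.\<close>

definition force_closed :: "'n set set \<Rightarrow> 'n set \<Rightarrow> 'n set \<Rightarrow> bool" where
  "force_closed E f Z \<longleftrightarrow> (\<forall>v\<in>Z. v \<notin> f \<longrightarrow>
     (\<forall>u. {v, u} \<in> E \<longrightarrow> (\<forall>w. {v, w} \<in> E \<longrightarrow> w \<noteq> u \<longrightarrow> w \<in> Z) \<longrightarrow> u \<in> Z))"

definition forces :: "'n set set \<Rightarrow> 'n set \<Rightarrow> 'n set \<Rightarrow> bool" where
  "forces E e f \<longleftrightarrow> (\<forall>Z. e \<subseteq> Z \<longrightarrow> force_closed E f Z \<longrightarrow> \<Union>E \<subseteq> Z)"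

lemma cycle_periodic:
  assumes "is_cycle C"
  obtains z m where "3 \<le> (m::nat)" "\<And>i j. z i = z j \<longleftrightarrow> i mod m = j mod m" "C = {{z i, z (Suc i)} | i. True}"
proof -
  obtain xs where xs: "3 \<le> length xs" "distinct xs" "C = {{xs ! i, xs ! (Suc i mod length xs)} | i. i < length xs}"
    using assms by (auto simp: is_cycle_def)
  let ?m = "length xs"
  define z where "z i = xs ! (i mod ?m)" for i
  have mod: "i mod ?m < ?m" for i using xs by (intro mod_less_divisor) auto
  have "C = {{z i, z (Suc i)} | i. True}"
  proof
    show "C \<subseteq> {{z i, z (Suc i)} | i. True}" 
    proof
      fix e assume "e \<in> C"
      then obtain i where "i < ?m" "e = {xs ! i, xs ! (Suc i mod ?m)}" unfolding xs(3) by blast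
      then have "e = {z i, z (Suc i)}" by (simp add: z_def)
      then show "e \<in> {{z i, z (Suc i)} | i. True}" by blast
    qed
    show "{{z i, z (Suc i)} | i. True} \<subseteq> C"
    proof
      fix e assume "e \<in> {{z i, z (Suc i)} | i. True}"
      then obtain i where "e = {z i, z (Suc i)}" by auto
      then have "e = {xs ! (i mod ?m), xs ! (Suc (i mod ?m) mod ?m)}" by (simp add: z_def mod_Suc_eq)
      then show "e \<in> C" using mod[of i] unfolding xs(3) by blast
    qed
  qed
  moreover have "z i = z j \<longleftrightarrow> i mod ?m = j mod ?m" for i j
    using xs(2) mod by (simp add: z_def nth_eq_iff_index_eq)
  ultimately show thesis using that[of ?m z] xs(1) by auto
qed

locale cycle =
  fixes C :: "'n set set" and z :: "nat \<Rightarrow> 'n" and m :: nat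
  assumes m3: "3 \<le> m" and z_eq: "\<And>i j. z i = z j \<longleftrightarrow> i mod m = j mod m"
    and C_eq: "C = {{z i, z (Suc i)} | i. True}"
begin

lemma shift [simp]: "z (i + m) = z i"
  by (simp add: z_eq)

lemma z_inj: "z i = z j \<Longrightarrow> a \<le> i \<Longrightarrow> i < a + m \<Longrightarrow> a \<le> j \<Longrightarrow> j < a + m \<Longrightarrow> i = j"
proof (induction i j rule: linorder_wlog)
  case (le i j)
  then have "m dvd j - i" by (metis z_eq mod_eq_dvd_iff_nat)
  then show ?case using le by (auto dest!: dvd_imp_le)
qed auto

lemma edge: "{z i, z (Suc i)} \<in> C"
  by (auto simp: C_eq)

lemma z_Suc_cong: "z i = z j \<longleftrightarrow> z (Suc i) = z (Suc j)"
proof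
  assume "z i = z j"
  then show "z (Suc i) = z (Suc j)" by (metis z_eq mod_Suc_eq)
next
  assume "z (Suc i) = z (Suc j)"
  then have "Suc i mod m = Suc j mod m" by (simp add: z_eq)
  then have "(Suc i + (m - 1)) mod m = (Suc j + (m - 1)) mod m" by (metis mod_add_left_eq)
  then show "z i = z j" using m3 by (simp add: z_eq)
qed

lemma neighbour:
  assumes "{z (Suc i), u} \<in> C"
  shows "u = z i \<or> u = z (Suc (Suc i))"
proof -
  obtain j where "{z (Suc i), u} = {z j, z (Suc j)}" using assms unfolding C_eq by blast
  then have "z (Suc i) = z j \<and> u = z (Suc j) \<or> z (Suc i) = z (Suc j) \<and> u = z j"
    by (simp add: doubleton_eq_iff)
  then show ?thesis using z_Suc_cong by metis
qed

lemma vertex: "v \<in> \<Union>C \<Longrightarrow> \<exists>i\<ge>a. i < a + m \<and> v = z i"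
proof -
  assume "v \<in> \<Union>C"
  then obtain j where j: "v = z j" by (auto simp: C_eq)
  let ?i = "a + (j + (m - 1) * a) mod m"
  have "?i mod m = (a + (j + (m - 1) * a)) mod m" by (simp add: mod_add_right_eq)
  also have "a + (j + (m - 1) * a) = j + m * a" using m3 by (cases m) (auto simp: algebra_simps)
  finally have "z ?i = v" using j by (simp add: z_eq)
  then show ?thesis using m3 by (intro exI[of _ ?i]) auto
qed

lemma two_neighbours:
  assumes "{v, u} \<in> C" "{v, w} \<in> C" "{v, x} \<in> C" "u \<noteq> w" "x \<noteq> u"
  shows "x = w"
proof -
  have "v \<in> \<Union>C" using assms(1) by auto
  then obtain i where "i \<ge> 1" "v = z i" using vertex[of v 1] by auto
  then obtain j where "v = z (Suc j)" by (cases i) auto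
  then show ?thesis using neighbour assms by metis
qed

lemma card_edge:
  assumes "e \<in> C"
  shows "card e = 2"
proof -
  obtain i where "e = {z i, z (Suc i)}" using assms unfolding C_eq by blast
  moreover have "z i \<noteq> z (Suc i)" using z_inj[of i "Suc i" i] m3 by auto
  ultimately show ?thesis by simp
qed

text \<open>A cycle has at least three edges, so besides an edge \<open>g\<close> used for gluing
  two others remain.\<close>

lemma two_more_edges: "\<exists>e\<in>C. \<exists>f\<in>C. e \<noteq> f \<and> e \<noteq> g \<and> f \<noteq> g"
proof -
  have ne: "z i \<noteq> z j" if "i < 3" "j < 3" "i \<noteq> j" for i j using z_inj[of i j 0] that m3 by auto
  have "z 3 \<noteq> z 1" "z 3 \<noteq> z 2" using z_inj[of 3 1 1] z_inj[of 3 2 1] m3 by auto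
  then have "{z 0, z 1} \<noteq> {z 1, z 2}" "{z 0, z 1} \<noteq> {z 2, z 3}" "{z 1, z 2} \<noteq> {z 2, z 3}"
    using ne[of 0 1] ne[of 0 2] ne[of 1 2] by (auto simp: doubleton_eq_iff)
  moreover have "{z 0, z 1} \<in> C" "{z 1, z 2} \<in> C" "{z 2, z 3} \<in> C"
    using edge[of 0] edge[of 1] edge[of 2] by (auto simp: eval_nat_numeral)
  ultimately show ?thesis by metis
qed

lemma three_vertices: "3 \<le> card V" if "\<Union>C \<subseteq> V" "finite V"
proof -
  have "z ` {..<3} \<subseteq> V" using edge that(1) by auto
  moreover have "card (z ` {..<3}) = 3" 
    by (subst card_image) (use z_inj[of _ _ 0] m3 in \<open>auto simp: inj_on_def\<close>)
  ultimately show ?thesis using that(2) by (metis card_mono)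
qed

text \<open>From \<open>e\<close> the zeros spread along the cycle in both directions until they
  meet at \<open>f\<close>. Each direction arrives at its own end of \<open>f\<close>, so neither
  end of \<open>f\<close> has to force.\<close>

lemma propagation:
  assumes ef: "e \<in> C" "f \<in> C" "e \<noteq> f" "e \<subseteq> Z"
    and step: "\<And>v u w. v \<in> Z \<Longrightarrow> v \<notin> f \<Longrightarrow> {v, u} \<in> C \<Longrightarrow> {v, w} \<in> C \<Longrightarrow> u \<noteq> w \<Longrightarrow> w \<in> Z \<Longrightarrow> u \<in> Z"
  shows "\<Union>C \<subseteq> Z"
proof -
  obtain a where a: "e = {z a, z (Suc a)}" using ef by (auto simp: C_eq)
  obtain j0 where j0: "f = {z j0, z (Suc j0)}" using ef by (auto simp: C_eq)
  have "z j0 \<in> \<Union>C" using j0 ef by auto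
  then obtain j where j: "j \<ge> a" "j < a + m" "z j0 = z j" using vertex[of "z j0" a] by auto
  then have f: "f = {z j, z (Suc j)}" using j0 z_Suc_cong by metis
  have "j \<noteq> a" using f a ef by auto
  then have ja: "a < j" using j by simp
  have far: "z i \<noteq> z (Suc (Suc i))" for i using z_inj[of i "Suc (Suc i)" i] m3 by auto
  have fwd: "z i \<in> Z \<and> z (Suc i) \<in> Z" if "a \<le> i" "i < j" for i
    using that
  proof (induction i rule: dec_induct)
    case base
    then show ?case using ef a by auto
  next
    case (step i)
    then have Z: "z i \<in> Z" "z (Suc i) \<in> Z" by auto
    have "z (Suc i) \<noteq> z j" using z_inj[of "Suc i" j a] step j by auto
    moreover have "z (Suc i) \<noteq> z (Suc j)" using z_inj[of "Suc i" "Suc j" "Suc a"] step j by auto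
    ultimately have "z (Suc i) \<notin> f" using f by auto
    then have "z (Suc (Suc i)) \<in> Z"
      using assms(5)[of "z (Suc i)" "z (Suc (Suc i))" "z i"] Z edge[of i] edge[of "Suc i"] far[of i]
      by (auto simp: insert_commute)
    then show ?case using Z by simp
  qed
  \<comment> \<open>The backward walk starts at \<open>e\<close> again, shifted by one
    period.\<close>
  have bwd: "z i \<in> Z \<and> z (Suc i) \<in> Z" if "i \<le> a + m" "j < i" for i
    using that
  proof (induction i rule: inc_induct)
    case base
    then show ?case using ef a shift[of "Suc a"] by auto
  next
    case (step i)
    then have Z: "z (Suc i) \<in> Z" "z (Suc (Suc i)) \<in> Z" by auto
    have "z (Suc i) \<noteq> z j" using z_inj[of "Suc i" j "Suc a"] step ja j by auto
    moreover have "z (Suc i) \<noteq> z (Suc j)" using z_inj[of "Suc i" "Suc j" "Suc a"] step ja j by auto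
    ultimately have "z (Suc i) \<notin> f" using f by auto
    then have "z i \<in> Z"
      using assms(5)[of "z (Suc i)" "z i" "z (Suc (Suc i))"] Z edge[of i] edge[of "Suc i"] far[of i]
      by (auto simp: insert_commute)
    then show ?case using Z by simp
  qed
  show ?thesis
  proof
    fix v assume "v \<in> \<Union>C"
    then obtain i where i: "i \<ge> Suc a" "i < Suc a + m" "v = z i" using vertex[of v "Suc a"] by auto
    show "v \<in> Z"
    proof (cases "i \<le> j")
      case True
      then show ?thesis using fwd[of "i - 1"] i by auto
    next
      case False
      then show ?thesis using bwd[of i] i by auto
    qed
  qed
qed

end

lemma is_cycle_locale: "is_cycle C \<Longrightarrow> \<exists>z m. cycle C z m"
  by (erule cycle_periodic) (auto simp: cycle_def)

lemma cycle_forces: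
  assumes "is_cycle C" "e \<in> C" "f \<in> C" "e \<noteq> f"
  shows "forces C e f"
  unfolding forces_def
proof (intro allI impI)
  fix Z assume Z: "e \<subseteq> Z" "force_closed C f Z"
  obtain z m where "cycle C z m" using is_cycle_locale[OF assms(1)] by auto
  then interpret cycle C z m .
  show "\<Union>C \<subseteq> Z"
  proof (rule propagation[OF assms(2-4) Z(1)])
    fix v u w assume *: "v \<in> Z" "v \<notin> f" "{v, u} \<in> C" "{v, w} \<in> C" "u \<noteq> w" "w \<in> Z"
    then have "\<forall>x. {v, x} \<in> C \<longrightarrow> x \<noteq> u \<longrightarrow> x \<in> Z" using two_neighbours by metis
    then show "u \<in> Z" using Z(2) * unfolding force_closed_def by blast
  qed
qed

text \<open>The new cell comes first: off \<open>g\<close> its vertices have no edges of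
  \<open>E\<close>, so the zeros run from \<open>e\<close> to \<open>g\<close>. Once the cell is
  filled, its edges no longer obstruct forcing within \<open>E\<close>.\<close>

lemma attach_forces_in:
  assumes old: "forces E g f" and C: "is_cycle C" "g \<in> C" "e \<in> C" "e \<noteq> g" "f \<in> E"
    and int: "\<Union>E \<inter> \<Union>C = g"
  shows "forces (E \<union> C) e f"
  unfolding forces_def
proof (intro allI impI)
  fix Z assume Z: "e \<subseteq> Z" "force_closed (E \<union> C) f Z"
  obtain z m where "cycle C z m" using is_cycle_locale[OF C(1)] by auto
  then interpret cycle C z m .
  have CZ: "\<Union>C \<subseteq> Z"
  proof (rule propagation[OF C(3,2,4) Z(1)])
    fix v u w assume *: "v \<in> Z" "v \<notin> g" "{v, u} \<in> C" "{v, w} \<in> C" "u \<noteq> w" "w \<in> Z"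
    have "v \<notin> \<Union>E" using * int by auto
    then have "v \<notin> f" "\<And>x. {v, x} \<notin> E" using C(5) by auto
    then have "\<forall>x. {v, x} \<in> E \<union> C \<longrightarrow> x \<noteq> u \<longrightarrow> x \<in> Z" using two_neighbours * by blast
    then show "u \<in> Z" using Z(2) * \<open>v \<notin> f\<close> unfolding force_closed_def by blast
  qed
  have "force_closed E f Z"
    unfolding force_closed_def
  proof (intro ballI allI impI)
    fix v u assume *: "v \<in> Z" "v \<notin> f" "{v, u} \<in> E" "\<forall>w. {v, w} \<in> E \<longrightarrow> w \<noteq> u \<longrightarrow> w \<in> Z"
    have "\<forall>w. {v, w} \<in> E \<union> C \<longrightarrow> w \<noteq> u \<longrightarrow> w \<in> Z" using * CZ by auto
    then show "u \<in> Z" using Z(2) * unfolding force_closed_def by blast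
  qed
  moreover have "g \<subseteq> Z" using CZ C(2) by auto
  ultimately have "\<Union>E \<subseteq> Z" using old by (auto simp: forces_def)
  then show "\<Union>(E \<union> C) \<subseteq> Z" using CZ by auto
qed

text \<open>The old graph comes first: only its vertices in \<open>g\<close> meet the new cell, and
  these do not force. Afterwards the zeros run through the new cell from \<open>g\<close> to
  \<open>e\<close>.\<close>

lemma attach_forces_out:
  assumes old: "forces E f g" and C: "is_cycle C" "g \<in> C" "e \<in> C" "e \<noteq> g" "g \<in> E"
    and int: "\<Union>E \<inter> \<Union>C = g"
  shows "forces (E \<union> C) f e"
  unfolding forces_def
proof (intro allI impI)
  fix Z assume Z: "f \<subseteq> Z" "force_closed (E \<union> C) e Z"
  obtain z m where "cycle C z m" using is_cycle_locale[OF C(1)] by auto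
  then interpret cycle C z m .
  have "force_closed E g Z"
    unfolding force_closed_def
  proof (intro ballI allI impI)
    fix v u assume *: "v \<in> Z" "v \<notin> g" "{v, u} \<in> E" "\<forall>w. {v, w} \<in> E \<longrightarrow> w \<noteq> u \<longrightarrow> w \<in> Z"
    have "v \<notin> \<Union>C" using * int by auto
    then have "v \<notin> e" "\<forall>w. {v, w} \<in> E \<union> C \<longrightarrow> w \<noteq> u \<longrightarrow> w \<in> Z" using * C(3) by auto
    then show "u \<in> Z" using Z(2) * unfolding force_closed_def by blast
  qed
  then have EZ: "\<Union>E \<subseteq> Z" using old Z(1) by (auto simp: forces_def)
  have "\<Union>C \<subseteq> Z"
  proof (rule propagation[OF C(2,3)])
    show "g \<subseteq> Z" using EZ C(5) by auto
    fix v u w assume *: "v \<in> Z" "v \<notin> e" "{v, u} \<in> C" "{v, w} \<in> C" "u \<noteq> w" "w \<in> Z"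
    have "\<forall>x. {v, x} \<in> E \<union> C \<longrightarrow> x \<noteq> u \<longrightarrow> x \<in> Z"
    proof (intro allI impI)
      fix x assume "{v, x} \<in> E \<union> C" "x \<noteq> u"
      then show "x \<in> Z" using two_neighbours[OF *(3,4) _ *(5)] *(6) EZ by auto
    qed
    then show "u \<in> Z" using Z(2) * unfolding force_closed_def by blast
  qed (use C(4) in auto)
  then show "\<Union>(E \<union> C) \<subseteq> Z" using EZ by auto
qed

text \<open>A common edge lies in the common vertex set \<open>g\<close>, and both have two
  elements.\<close>

lemma attach_common_edge:
  assumes "is_cycle C" "g \<in> C" "\<Union>E \<inter> \<Union>C = g"
  shows "C \<inter> E \<subseteq> {g}"
proof
  obtain z m where "cycle C z m" using is_cycle_locale[OF assms(1)] by auto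
  then interpret cycle C z m .
  fix e assume e: "e \<in> C \<inter> E"
  then have "e \<subseteq> g" using assms(3) by auto
  moreover have "card e = 2" "card g = 2" using card_edge e assms(2) by auto
  moreover have "finite g" using \<open>card g = 2\<close> by (metis card.infinite zero_neq_numeral)
  ultimately show "e \<in> {g}" by (simp add: card_subset_eq)
qed

text \<open>The last conjunct means that an edge outside \<open>As\<close> lies in just one cell; it
  persists because a new cycle shares only \<open>g\<close> with the old graph.\<close>

lemma seac_basic:
  assumes "seac E Cs As"
  shows "E = \<Union>Cs \<and> finite Cs \<and> As \<subseteq> E \<and> (\<forall>C\<in>Cs. is_cycle C) \<and> (\<forall>X\<in>Cs. \<forall>Y\<in>Cs. X \<noteq> Y \<longrightarrow> X \<inter> Y \<subseteq> As)"
  using assms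
proof (induction rule: seac.induct)
  case (attach E Cs As C g)
  then have IH: "E = \<Union>Cs" "finite Cs" "As \<subseteq> E" "\<forall>C\<in>Cs. is_cycle C"
    "\<And>X Y. X \<in> Cs \<Longrightarrow> Y \<in> Cs \<Longrightarrow> X \<noteq> Y \<Longrightarrow> X \<inter> Y \<subseteq> As" by auto
  have "C \<inter> E \<subseteq> {g}" using attach_common_edge[OF attach(2,5,6)] .
  then have C: "X \<inter> C \<subseteq> {g}" "C \<inter> X \<subseteq> {g}" if "X \<in> Cs" for X using IH(1) that by auto
  have "X \<inter> Y \<subseteq> insert g As" if "X \<in> insert C Cs" "Y \<in> insert C Cs" "X \<noteq> Y" for X Y
    using that IH(5)[of X Y] C[of X] C[of Y] by blast
  then have "\<forall>X\<in>insert C Cs. \<forall>Y\<in>insert C Cs. X \<noteq> Y \<longrightarrow> X \<inter> Y \<subseteq> insert g As" by simp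
  moreover have "E \<union> C = \<Union>(insert C Cs)" using IH(1) by auto
  moreover have "insert g As \<subseteq> E \<union> C" using IH(3) attach(3) by auto
  moreover have "finite (insert C Cs)" "\<forall>C\<in>insert C Cs. is_cycle C" using IH(2,4) attach(2) by auto
  ultimately show ?case by (intro conjI)
qed auto

text \<open>The two end cells \<open>C\<close> and \<open>D\<close> of the chain are the only cells to which a further cycle
  can be attached. Both directions of the forcing relation are needed, because a new cycle may
  be attached at either end.\<close>

definition chain_ends :: "'n set set \<Rightarrow> 'n set set set \<Rightarrow> 'n set set \<Rightarrow> 'n set set \<Rightarrow> 'n set set \<Rightarrow> bool" where
  "chain_ends E Cs As C D \<longleftrightarrow> C \<in> Cs \<and> D \<in> Cs \<and>
     (C = D \<longrightarrow> As = {}) \<and>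
     (C \<noteq> D \<longrightarrow> (\<exists>X\<in>Cs. neighbors As C X) \<and> (\<exists>X\<in>Cs. neighbors As D X)) \<and>
     (\<forall>X\<in>Cs. X \<noteq> C \<longrightarrow> X \<noteq> D \<longrightarrow> 2 \<le> card {Y \<in> Cs. neighbors As X Y}) \<and>
     (\<exists>e\<in>C - As. \<exists>e'\<in>C - As. e \<noteq> e') \<and> (\<exists>e\<in>D - As. \<exists>e'\<in>D - As. e \<noteq> e') \<and>
     (\<forall>e\<in>C - As. \<forall>f\<in>D - As. e \<noteq> f \<longrightarrow> forces E e f \<and> forces E f e)"

lemma chain_endsD:
  assumes "chain_ends E Cs As C D"
  shows "C \<in> Cs" "D \<in> Cs" "C = D \<Longrightarrow> As = {}"
    "C \<noteq> D \<Longrightarrow> \<exists>X\<in>Cs. neighbors As C X" "C \<noteq> D \<Longrightarrow> \<exists>X\<in>Cs. neighbors As D X"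
    "\<And>X. X \<in> Cs \<Longrightarrow> X \<noteq> C \<Longrightarrow> X \<noteq> D \<Longrightarrow> 2 \<le> card {Y \<in> Cs. neighbors As X Y}"
    "\<exists>e\<in>C - As. \<exists>e'\<in>C - As. e \<noteq> e'" "\<exists>e\<in>D - As. \<exists>e'\<in>D - As. e \<noteq> e'"
    "\<And>e f. e \<in> C - As \<Longrightarrow> f \<in> D - As \<Longrightarrow> e \<noteq> f \<Longrightarrow> forces E e f \<and> forces E f e"
  using assms unfolding chain_ends_def by (simp_all del: Diff_iff)

lemma chain_ends_sym:
  assumes "chain_ends E Cs As C D"
  shows "chain_ends E Cs As D C"
proof -
  note ends = chain_endsD[OF assms]
  have "\<forall>X\<in>Cs. X \<noteq> D \<longrightarrow> X \<noteq> C \<longrightarrow> 2 \<le> card {Y \<in> Cs. neighbors As X Y}" using ends(6) by blast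
  moreover have "\<forall>e\<in>D - As. \<forall>f\<in>C - As. e \<noteq> f \<longrightarrow> forces E e f \<and> forces E f e" using ends(9) by metis
  moreover have "D = C \<longrightarrow> As = {}" "D \<noteq> C \<longrightarrow> (\<exists>X\<in>Cs. neighbors As D X) \<and> (\<exists>X\<in>Cs. neighbors As C X)"
    using ends(3-5) by metis+
  ultimately show ?thesis
    unfolding chain_ends_def using ends(1,2,7,8) by (simp del: Diff_iff)
qed

text \<open>The new cell replaces \<open>C\<close> as an end and \<open>C\<close> becomes interior.
  Forcing between the new cell and \<open>D\<close> is composed at the edge \<open>g\<close>, for
  which the old forcing relation holds in both directions.\<close>

lemma chain_ends_attach:
  assumes S: "seac E Cs As" and ends: "chain_ends E Cs As C D" and C': "is_cycle C'"
    and g: "g \<in> C" "g \<notin> As" "g \<in> C'" and int: "\<Union>E \<inter> \<Union>C' = g" and fresh: "C' \<notin> Cs"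
  shows "chain_ends (E \<union> C') (insert C' Cs) (insert g As) C' D"
proof -
  note basic = seac_basic[OF S]
  have CD: "C \<in> Cs" "D \<in> Cs" using chain_endsD[OF ends] by auto
  have gE: "g \<in> E" using g CD basic by auto
  have common: "C' \<inter> E \<subseteq> {g}" using attach_common_edge[OF C' g(3) int] .
  have AsE: "As \<subseteq> E" and cyc: "\<And>X. X \<in> Cs \<Longrightarrow> is_cycle X" and E: "E = \<Union>Cs" using basic by auto
  have only_C: "g \<notin> X" if "X \<in> Cs" "X \<noteq> C" for X
    using basic CD(1) g that by blast
  have mono: "neighbors (insert g As) X Y" if "neighbors As X Y" for X Y
    using that by (auto simp: neighbors_def)
  have new: "neighbors (insert g As) C C'" "neighbors (insert g As) C' C"
    using g CD fresh by (auto simp: neighbors_def)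
  have fin: "finite (insert C' Cs)" using basic by simp
  have 1: "\<exists>X\<in>insert C' Cs. neighbors (insert g As) C' X" using new CD by auto
  have 2: "\<exists>X\<in>insert C' Cs. neighbors (insert g As) D X"
  proof (cases "C = D")
    case True
    then show ?thesis using new by auto
  next
    case False
    then obtain X where "X \<in> Cs" "neighbors As D X" using chain_endsD(5)[OF ends] by blast
    then show ?thesis using mono by auto
  qed
  have 3: "2 \<le> card {Y \<in> insert C' Cs. neighbors (insert g As) X Y}"
    if "X \<in> insert C' Cs" "X \<noteq> C'" "X \<noteq> D" for X
  proof (cases "X = C")
    case True
    then have "C \<noteq> D" using that by simp
    then obtain Y where Y: "Y \<in> Cs" "neighbors As C Y" using chain_endsD(4)[OF ends] by blast
    have "card {Y, C'} \<le> card {Y \<in> insert C' Cs. neighbors (insert g As) X Y}"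
      using fin Y new mono True by (intro card_mono) auto
    moreover have "Y \<noteq> C'" using Y fresh by auto
    ultimately show ?thesis by simp
  next
    case False
    then have "2 \<le> card {Y \<in> Cs. neighbors As X Y}" using chain_endsD(6)[OF ends] that by blast
    also have "\<dots> \<le> card {Y \<in> insert C' Cs. neighbors (insert g As) X Y}"
      using fin mono by (intro card_mono) auto
    finally show ?thesis .
  qed
  have 4: "\<exists>e\<in>C' - insert g As. \<exists>e'\<in>C' - insert g As. e \<noteq> e'"
  proof -
    obtain z m where "cycle C' z m" using is_cycle_locale[OF C'] by auto
    then obtain e f where "e \<in> C'" "f \<in> C'" "e \<noteq> f" "e \<noteq> g" "f \<noteq> g"
      using cycle.two_more_edges by metis
    moreover have "x \<notin> insert g As" if "x \<in> C'" "x \<noteq> g" for x using common AsE that by blast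
    ultimately show ?thesis by blast
  qed
  have 5: "\<exists>e\<in>D - insert g As. \<exists>e'\<in>D - insert g As. e \<noteq> e'"
  \<comment> \<open>If the chain was a single cycle, \<open>D\<close> itself loses the edge
    \<open>g\<close> but keeps two others. Otherwise \<open>g\<close> lies in \<open>C\<close>
    only.\<close>
  proof (cases "C = D")
    case True
    have As: "As = {}" using chain_endsD(3)[OF ends] True by simp
    obtain z m where "cycle D z m" using is_cycle_locale[OF cyc[OF CD(2)]] by blast
    then obtain e f where "e \<in> D" "f \<in> D" "e \<noteq> f" "e \<noteq> g" "f \<noteq> g"
      using cycle.two_more_edges by metis
    then show ?thesis using As by blast
  next
    case False
    then have "g \<notin> D" using only_C CD by auto
    then have "D - insert g As = D - As" by auto
    then show ?thesis using chain_endsD(8)[OF ends] by simp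
  qed
  have 6: "forces (E \<union> C') e f \<and> forces (E \<union> C') f e"
    if "e \<in> C' - insert g As" "f \<in> D - insert g As" for e f
  proof -
    have fE: "f \<in> E" using that CD E by blast
    have "forces E g f \<and> forces E f g" using chain_endsD(9)[OF ends, of g f] g that by blast
    then show ?thesis
      using attach_forces_in[OF _ C' g(3) _ _ _ int, of f e] attach_forces_out[OF _ C' g(3) _ _ gE int, of f e]
        that fE by blast
  qed
  have "C' \<noteq> D" using CD fresh by auto
  moreover have "\<forall>X\<in>insert C' Cs. X \<noteq> C' \<longrightarrow> X \<noteq> D \<longrightarrow>
      2 \<le> card {Y \<in> insert C' Cs. neighbors (insert g As) X Y}" using 3 by blast
  moreover have "\<forall>e\<in>C' - insert g As. \<forall>f\<in>D - insert g As. e \<noteq> f \<longrightarrow>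
      forces (E \<union> C') e f \<and> forces (E \<union> C') f e" using 6 by blast
  ultimately show ?thesis
    unfolding chain_ends_def using 1 2 4 5 CD(2) by (simp del: Diff_iff)
qed

text \<open>Gluing onto an interior cell would give it a third neighbour, so linearity forces every
  attachment to happen at an end.\<close>

lemma lseac_chain_ends:
  assumes "seac E Cs As" "\<forall>X\<in>Cs. card {Y \<in> Cs. neighbors As X Y} \<le> 2"
  shows "\<exists>C D. chain_ends E Cs As C D"
  using assms
proof (induction rule: seac.induct)
  case (start C)
  obtain z m where "cycle C z m" using is_cycle_locale[OF start(1)] by auto
  then obtain e f where "e \<in> C" "f \<in> C" "e \<noteq> f" using cycle.two_more_edges by metis
  then have "\<exists>e\<in>C. \<exists>e'\<in>C. e \<noteq> e'" by blast
  then have "chain_ends C {C} {} C C"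
    using cycle_forces[OF start(1)] by (simp add: chain_ends_def)
  then show ?case by blast
next
  case (attach E Cs As C' g)
  note basic = seac_basic[OF attach(1)]
  have fin: "finite (insert C' Cs)" using basic by simp
  \<comment> \<open>A cycle already present would have all its vertices in \<open>g\<close>, but a
    cycle has at least three.\<close>
  have fresh: "C' \<notin> Cs"
  proof
    assume "C' \<in> Cs"
    then have "\<Union>C' \<subseteq> g" using attach(6) basic by auto
    moreover obtain z m where "cycle C' z m" using is_cycle_locale[OF attach(2)] by auto
    moreover have "card g = 2" using cycle.card_edge[OF \<open>cycle C' z m\<close>] attach(5) by auto
    moreover have "finite g" using \<open>card g = 2\<close> by (metis card.infinite zero_neq_numeral)
    ultimately show False using cycle.three_vertices[of C' z m g] by auto
  qed
  have sub: "{Y \<in> Cs. neighbors As X Y} \<subseteq> {Y \<in> insert C' Cs. neighbors (insert g As) X Y}" for X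
    by (auto simp: neighbors_def)
  have lin: "card {Y \<in> insert C' Cs. neighbors (insert g As) X Y} \<le> 2" if "X \<in> Cs" for X
    using attach.prems that by blast
  have "card {Y \<in> Cs. neighbors As X Y} \<le> 2" if "X \<in> Cs" for X
    using card_mono[OF _ sub[of X]] fin lin[OF that] by simp
  then obtain C D where ends: "chain_ends E Cs As C D" using attach.IH by blast
  obtain X where X: "X \<in> Cs" "g \<in> X" using attach(3) basic by auto
  have "X = C \<or> X = D"
  proof (rule ccontr)
    assume "\<not> (X = C \<or> X = D)"
    then have "2 \<le> card {Y \<in> Cs. neighbors As X Y}" using chain_endsD(6)[OF ends] X by blast
    also have "\<dots> < card (insert C' {Y \<in> Cs. neighbors As X Y})" using fresh basic by auto
    also have "\<dots> \<le> card {Y \<in> insert C' Cs. neighbors (insert g As) X Y}"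
      using fin X attach(5) fresh by (intro card_mono) (auto simp: neighbors_def)
    finally show False using lin[OF X(1)] by simp
  qed
  then obtain D' where "chain_ends E Cs As X D'" using ends chain_ends_sym by blast
  then show ?case
    using chain_ends_attach[OF attach(1) _ attach(2) X(2) attach(4,5,6) fresh] by blast
qed

section \<open>Eigenvectors and zero forcing\<close>

lemma null_set_force_closed:
  assumes A: "A \<in> sym_matrices E" and x: "A *v x = c *\<^sub>R x"
  shows "force_closed E f {v. x $ v = 0}"
  unfolding force_closed_def
proof (intro ballI allI impI)
  fix v u assume v: "v \<in> {v. x $ v = 0}" and vu: "{v, u} \<in> E"
    and others: "\<forall>w. {v, w} \<in> E \<longrightarrow> w \<noteq> u \<longrightarrow> w \<in> {v. x $ v = 0}"
  show "u \<in> {v. x $ v = 0}"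
  proof (cases "u = v")
    case uv: False
    have xv: "x $ v = 0" using v by simp
    \<comment> \<open>In row \<open>v\<close> of the eigenvector equation every term but the one at
      \<open>u\<close> vanishes, whatever the diagonal entry and the eigenvalue, because
      \<open>x $ v = 0\<close>.\<close>
    have "A $ v $ w * x $ w = (if w = u then A $ v $ u * x $ u else 0)" for w
    proof (cases "w = v \<or> w = u")
      case False
      then have "v \<noteq> w" by auto
      then have "A $ v $ w \<noteq> 0 \<longleftrightarrow> {v, w} \<in> E" using A by (simp add: sym_matrices_def)
      then have "A $ v $ w = 0 \<or> x $ w = 0" using others False by auto
      then show ?thesis using False by auto
    next
      case True
      then show ?thesis using xv uv by (elim disjE) simp_all
    qed
    then have "(\<Sum>w\<in>UNIV. A $ v $ w * x $ w) = (\<Sum>w\<in>UNIV. if w = u then A $ v $ u * x $ u else 0)"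
      by (rule sum.cong[OF refl])
    then have "(A *v x) $ v = A $ v $ u * x $ u" unfolding matrix_vector_mult_def by simp
    moreover have "(A *v x) $ v = 0" using x v by simp
    moreover have "A $ v $ u \<noteq> 0" using A vu uv by (auto simp: sym_matrices_def)
    ultimately show ?thesis by simp
  qed (use v in auto)
qed

text \<open>An eigenvector vanishing at both ends of an edge of an end cell vanishes everywhere, so
  evaluation at these two vertices embeds the eigenspace into the plane.\<close>

lemma lseac_eig_multiplicity_le:
  fixes E :: "'n::finite set set"
  assumes "lseac_graph E" "A \<in> sym_matrices E"
  shows "eig_multiplicity A c \<le> 2"
proof -
  obtain Cs As where S: "\<Union>E = UNIV" "seac E Cs As" "\<forall>X\<in>Cs. card {Y \<in> Cs. neighbors As X Y} \<le> 2"
    using assms(1) by (auto simp: lseac_graph_def)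
  obtain C D where ends: "chain_ends E Cs As C D" using lseac_chain_ends[OF S(2,3)] by auto
  obtain e f where ef: "e \<in> C - As" "f \<in> D - As" "e \<noteq> f"
    using chain_endsD(7,8)[OF ends] by metis
  then have forces: "forces E e f" using chain_endsD(9)[OF ends] by blast
  obtain z m where "cycle C z m" 
    using is_cycle_locale seac_basic[OF S(2)] chain_endsD(1)[OF ends] by metis
  then have "card e = 2" using cycle.card_edge ef by blast
  then obtain u v where uv: "e = {u, v}" by (metis card_2_iff)
  let ?V = "{x. A *v x = c *\<^sub>R x}"
  let ?f = "\<lambda>x :: real^'n. (x $ u, x $ v)"
  have V: "subspace ?V"
    by (auto simp: subspace_def matrix_vector_right_distrib matrix_vector_mult_scaleR scaleR_right_distrib)
  have zero: "x = 0" if "x \<in> ?V" "?f x = 0" for x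
  proof -
    have "force_closed E f {v. x $ v = 0}" using null_set_force_closed[OF assms(2)] that by auto
    moreover have "e \<subseteq> {v. x $ v = 0}" using that uv by (auto simp: zero_prod_def)
    ultimately have "\<Union>E \<subseteq> {v. x $ v = 0}" using forces by (auto simp: forces_def)
    then show ?thesis using S(1) by (auto simp: vec_eq_iff)
  qed
  have lin: "linear ?f" by (rule linearI) auto
  have "inj_on ?f ?V"
  proof (rule inj_onI)
    fix x y assume xy: "x \<in> ?V" "y \<in> ?V" "?f x = ?f y"
    then have "x - y \<in> ?V" "?f (x - y) = 0" using subspace_diff[OF V] by (auto simp: zero_prod_def)
    then show "x = y" using zero by fastforce
  qed
  then have "dim (?f ` ?V) = dim ?V"
    by (intro dim_image_eq[OF lin]) (simp add: span_eq_iff[THEN iffD2, OF V])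
  moreover have "dim (?f ` ?V) \<le> 2" using dim_subset_UNIV[of "?f ` ?V"] by simp
  ultimately show ?thesis by (simp add: eig_multiplicity_def)
qed

section \<open>Cells between two parallel paths\<close>

fun path_edges :: "'a list \<Rightarrow> 'a set set" where
  "path_edges (x # y # zs) = insert {x, y} (path_edges (y # zs))"
| "path_edges _ = {}"

lemma path_edges_nth: "path_edges xs = {{xs ! t, xs ! Suc t} | t. Suc t < length xs}"
proof (induction xs rule: path_edges.induct)
  case (1 x y zs)
  have "{{(x # y # zs) ! t, (x # y # zs) ! Suc t} | t. Suc t < length (x # y # zs)} =
     insert {x, y} {{(y # zs) ! t, (y # zs) ! Suc t} | t. Suc t < length (y # zs)}" (is "?A = ?B")
  proof
    show "?A \<subseteq> ?B"
    proof
      fix e assume "e \<in> ?A"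
      then obtain t where t: "Suc t < length (x # y # zs)" "e = {(x # y # zs) ! t, (x # y # zs) ! Suc t}" by blast
      show "e \<in> ?B"
      proof (cases t)
        case 0
        then show ?thesis using t by simp
      next
        case (Suc s)
        then have "Suc s < length (y # zs)" "e = {(y # zs) ! s, (y # zs) ! Suc s}" using t by auto
        then show ?thesis by blast
      qed
    qed
    show "?B \<subseteq> ?A"
    proof
      fix e assume "e \<in> ?B"
      then consider "e = {x, y}" | t where "Suc t < length (y # zs)" "e = {(y # zs) ! t, (y # zs) ! Suc t}" by blast
      then show "e \<in> ?A"
      proof cases
        case 1
        then show ?thesis by (intro CollectI exI[of _ 0]) simp
      next
        case (2 t)
        then show ?thesis by (intro CollectI exI[of _ "Suc t"]) simp
      qed
    qed
  qed
  then show ?case using 1 by simp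
qed auto

lemma path_edges_append:
  "xs \<noteq> [] \<Longrightarrow> ys \<noteq> [] \<Longrightarrow> path_edges (xs @ ys) = path_edges xs \<union> path_edges ys \<union> {{last xs, hd ys}}"
proof (induction xs rule: path_edges.induct)
  case ("2_2" x)
  then show ?case by (cases ys) auto
qed auto

lemma path_edges_rev: "path_edges (rev xs) = path_edges xs"
proof (induction xs rule: path_edges.induct)
  case (1 x y zs)
  have "path_edges (rev (x # y # zs)) = path_edges (rev (y # zs) @ [x])" by simp
  also have "\<dots> = path_edges (rev (y # zs)) \<union> {{y, x}}"
    by (subst path_edges_append) (simp_all add: last_rev del: rev.simps)
  finally show ?case using 1 by (simp add: insert_commute del: rev.simps)
qed auto

lemma path_edges_map_upt: "path_edges (map f [a..<Suc b]) = {{f t, f (Suc t)} | t. a \<le> t \<and> t < b}" (is "_ = ?B")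
proof
  show "path_edges (map f [a..<Suc b]) \<subseteq> ?B"
  proof
    fix e assume "e \<in> path_edges (map f [a..<Suc b])"
    then obtain t where t: "Suc t < Suc b - a" "e = {map f [a..<Suc b] ! t, map f [a..<Suc b] ! Suc t}"
      unfolding path_edges_nth by (auto simp del: upt_Suc)
    then have "e = {f (a + t), f (Suc (a + t))}" by (simp del: upt_Suc)
    then show "e \<in> ?B" using t(1) by (intro CollectI exI[of _ "a + t"]) auto
  qed
  show "?B \<subseteq> path_edges (map f [a..<Suc b])"
  proof
    fix e assume "e \<in> ?B"
    then obtain t where "a \<le> t" "t < b" "e = {f t, f (Suc t)}" by blast
    then show "e \<in> path_edges (map f [a..<Suc b])"
      unfolding path_edges_nth by (intro CollectI exI[of _ "t - a"]) (simp add: Suc_diff_le[symmetric] del: upt_Suc)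
  qed
qed

lemma is_cycle_list:
  assumes "3 \<le> length xs" "distinct xs"
  shows "is_cycle (insert {last xs, hd xs} (path_edges xs))"
proof -
  let ?m = "length xs"
  have "insert {last xs, hd xs} (path_edges xs) = {{xs ! i, xs ! (Suc i mod ?m)} | i. i < ?m}" (is "?A = ?B")
  proof
    show "?A \<subseteq> ?B"
    proof
      fix e assume "e \<in> ?A"
      then consider "e = {last xs, hd xs}" | t where "Suc t < ?m" "e = {xs ! t, xs ! Suc t}"
        unfolding path_edges_nth by blast
      then show "e \<in> ?B"
      proof cases
        case 1
        moreover have "xs \<noteq> []" using assms by auto
        ultimately show ?thesis using assms
          by (intro CollectI exI[of _ "?m - 1"]) (simp add: last_conv_nth hd_conv_nth)
      next
        case 2
        then show ?thesis by (intro CollectI exI[of _ t]) simp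
      qed
    qed
    show "?B \<subseteq> ?A"
    proof
      fix e assume "e \<in> ?B"
      then obtain i where i: "i < ?m" "e = {xs ! i, xs ! (Suc i mod ?m)}" by blast
      show "e \<in> ?A"
      proof (cases "Suc i = ?m")
        case True
        moreover have "xs \<noteq> []" using assms by auto
        moreover have "i = ?m - 1" using True by simp
        ultimately show ?thesis using i by (simp add: last_conv_nth hd_conv_nth)
      next
        case False
        then have "Suc i < ?m" using i by simp
        then have "e \<in> path_edges xs" unfolding path_edges_nth using i by auto
        then show ?thesis by simp
      qed
    qed
  qed
  then show ?thesis unfolding is_cycle_def using assms by blast
qed

text \<open>The invariant for building the chain in one direction: the free edge \<open>r\<close>
  lies in just one cell, and that cell has room for another neighbour.\<close>

definition chain_tip :: "'n set set \<Rightarrow> 'n set set set \<Rightarrow> 'n set set \<Rightarrow> 'n set \<Rightarrow> bool" where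
  "chain_tip E Cs As r \<longleftrightarrow> seac E Cs As \<and> r \<notin> As \<and>
     (\<exists>L\<in>Cs. r \<in> L \<and> (\<forall>X\<in>Cs. r \<in> X \<longrightarrow> X = L) \<and> card {Y \<in> Cs. neighbors As L Y} \<le> 1) \<and>
     (\<forall>X\<in>Cs. card {Y \<in> Cs. neighbors As X Y} \<le> 2)"

lemma chain_tip_start:
  assumes "is_cycle C" "r \<in> C"
  shows "chain_tip C {C} {} r"
  using assms seac.start[OF assms(1)] by (auto simp: chain_tip_def neighbors_def)

text \<open>The new cell shares only \<open>r'\<close> with the old graph, so it neighbours only the
  former last cell. As \<open>r\<close> is a new edge, it belongs to the new cell alone.\<close>

lemma chain_tip_attach:
  assumes tip: "chain_tip E Cs As r'" and C: "is_cycle C" "r' \<in> C" and int: "\<Union>E \<inter> \<Union>C = r'"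
    and r: "r \<in> C" "r \<notin> E"
  shows "chain_tip (E \<union> C) (insert C Cs) (insert r' As) r"
proof -
  have S: "seac E Cs As" and r'As: "r' \<notin> As" using tip by (auto simp: chain_tip_def)
  note basic = seac_basic[OF S]
  have EU: "E = \<Union>Cs" and fin: "finite Cs" and AsE: "As \<subseteq> E" using basic by auto
  obtain L where L: "L \<in> Cs" "r' \<in> L" "\<And>X. X \<in> Cs \<Longrightarrow> r' \<in> X \<Longrightarrow> X = L" "card {Y \<in> Cs. neighbors As L Y} \<le> 1"
    using tip unfolding chain_tip_def by blast
  have le2: "card {Y \<in> Cs. neighbors As X Y} \<le> 2" if "X \<in> Cs" for X
    using tip that unfolding chain_tip_def by blast
  have r'E: "r' \<in> E" using L(1,2) EU by blast
  have common: "C \<inter> E \<subseteq> {r'}" using attach_common_edge[OF C int] .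
  have old: "neighbors As X Y" if "X \<in> Cs" "Y \<in> Cs" "neighbors (insert r' As) X Y" for X Y
    using that L(3) unfolding neighbors_def by blast
  have withC: "X = L" if X: "X \<in> Cs" "neighbors (insert r' As) X C \<or> neighbors (insert r' As) C X" for X
  proof -
    obtain e where "e \<in> X" "e \<in> C" using X(2) unfolding neighbors_def by blast
    then have "r' \<in> X" using common X(1) EU by blast
    then show ?thesis using L(3) X(1) by simp
  qed
  have tipC: "card {Y \<in> insert C Cs. neighbors (insert r' As) C Y} \<le> 1"
  proof -
    have "{Y \<in> insert C Cs. neighbors (insert r' As) C Y} \<subseteq> {L}"
      using withC by (auto simp: neighbors_def[of _ C C])
    then show ?thesis using card_mono[of "{L}"] by fastforce
  qed
  have all: "card {Y \<in> insert C Cs. neighbors (insert r' As) X Y} \<le> 2" if X: "X \<in> insert C Cs" for X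
  proof (cases "X = C")
    case True
    then show ?thesis using tipC by simp
  next
    case False
    then have XC: "X \<in> Cs" using X by simp
    show ?thesis
    proof (cases "X = L")
      case True
      have "{Y \<in> insert C Cs. neighbors (insert r' As) X Y} \<subseteq> insert C {Y \<in> Cs. neighbors As L Y}"
        using old[OF XC] True by auto
      then have "card {Y \<in> insert C Cs. neighbors (insert r' As) X Y} \<le> card (insert C {Y \<in> Cs. neighbors As L Y})"
        using fin by (intro card_mono) auto
      also have "\<dots> \<le> Suc (card {Y \<in> Cs. neighbors As L Y})" by (rule card_insert_le_m1[of "Suc _"]) auto
      finally show ?thesis using L(4) by simp
    next
      case F: False
      have "{Y \<in> insert C Cs. neighbors (insert r' As) X Y} \<subseteq> {Y \<in> Cs. neighbors As X Y}"
        using old[OF XC] withC[OF XC] F by auto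
      then have "card {Y \<in> insert C Cs. neighbors (insert r' As) X Y} \<le> card {Y \<in> Cs. neighbors As X Y}"
        using fin by (intro card_mono) auto
      then show ?thesis using le2[OF XC] by simp
    qed
  qed
  have "X = C" if "X \<in> insert C Cs" "r \<in> X" for X using that r(2) EU by auto
  moreover have "r \<notin> insert r' As" using r(2) r'E AsE by auto
  moreover have "seac (E \<union> C) (insert C Cs) (insert r' As)" 
    by (rule seac.attach[OF S C(1) r'E r'As C(2) int])
  ultimately show ?thesis unfolding chain_tip_def using tipC all r(1) by blast
qed

section \<open>Rungs and the cells between them\<close>

locale parallel_paths =
  fixes E :: "'n::finite set set" and p q :: "nat \<Rightarrow> 'n" and k l :: nat
  assumes simple: "simple_graph E" and C2: "C2_graph E" and kl: "0 < k" "0 < l"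
    and pp: "\<And>i j. i < k \<Longrightarrow> j < k \<Longrightarrow> {p i, p j} \<in> E \<longleftrightarrow> j = Suc i \<or> i = Suc j"
    and qq: "\<And>i j. i < l \<Longrightarrow> j < l \<Longrightarrow> {q i, q j} \<in> E \<longleftrightarrow> j = Suc i \<or> i = Suc j"
    and p_inj: "\<And>i j. i < k \<Longrightarrow> j < k \<Longrightarrow> p i = p j \<Longrightarrow> i = j"
    and q_inj: "\<And>i j. i < l \<Longrightarrow> j < l \<Longrightarrow> q i = q j \<Longrightarrow> i = j"
    and pq: "\<And>i j. i < k \<Longrightarrow> j < l \<Longrightarrow> p i \<noteq> q j"
    and cover: "\<And>v. (\<exists>i<k. v = p i) \<or> (\<exists>j<l. v = q j)"
    and nocross: "\<And>i j a b. a < k \<Longrightarrow> j < l \<Longrightarrow> {p i, q j} \<in> E \<Longrightarrow> {p a, q b} \<in> E \<Longrightarrow> i < a \<Longrightarrow> j \<le> b"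
begin

definition rung :: "nat \<Rightarrow> nat \<Rightarrow> bool" where
  "rung i j \<longleftrightarrow> i < k \<and> j < l \<and> {p i, q j} \<in> E"

lemma rung_mono: "rung i j \<Longrightarrow> rung a b \<Longrightarrow> i < a \<Longrightarrow> j \<le> b"
  using nocross by (auto simp: rung_def)

text \<open>Non-crossing excludes incomparable rungs, so the product order is total on
  rungs.\<close>

lemma rung_comparable: "rung i j \<Longrightarrow> rung a b \<Longrightarrow> (i \<le> a \<and> j \<le> b) \<or> (a \<le> i \<and> b \<le> j)"
  using rung_mono[of i j a b] rung_mono[of a b i j] by (cases i a rule: linorder_cases) auto

lemma degree: "2 \<le> vertex_degree E v"
  using C2 by (simp add: C2_graph_def)

text \<open>An end of an induced path has at most one neighbour on it, so the degree condition
  forces an edge to the other path.\<close>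

lemma end_rung_p:
  assumes "i = 0 \<or> i = k - 1"
  shows "\<exists>j. rung i j"
proof (rule ccontr)
  assume no: "\<not> ?thesis"
  have i: "i < k" using assms kl by auto
  obtain a b where ab: "a \<noteq> b" "{p i, a} \<in> E" "{p i, b} \<in> E"
    using degree_two_neighbours[OF simple degree[of "p i"]] by metis
  have "\<exists>j<k. c = p j \<and> (j = Suc i \<or> i = Suc j)" if "{p i, c} \<in> E" for c
    using cover[of c] no pp[OF i] that i by (auto simp: rung_def)
  from this[OF ab(2)] this[OF ab(3)] show False using assms ab(1) by auto
qed

lemma end_rung_q:
  assumes "j = 0 \<or> j = l - 1"
  shows "\<exists>i. rung i j"
proof (rule ccontr)
  assume no: "\<not> ?thesis"
  have j: "j < l" using assms kl by auto
  obtain a b where ab: "a \<noteq> b" "{q j, a} \<in> E" "{q j, b} \<in> E"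
    using degree_two_neighbours[OF simple degree[of "q j"]] by metis
  have "\<exists>i<l. c = q i \<and> (i = Suc j \<or> j = Suc i)" if "{q j, c} \<in> E" for c
    using cover[of c] no qq[OF j] that j by (auto simp: rung_def insert_commute)
  from this[OF ab(2)] this[OF ab(3)] show False using assms ab(1) by auto
qed

text \<open>Both initial vertices have rungs; unless these coincide in \<open>(0, 0)\<close>,
  non-crossing pushes the end of one of them to the initial vertex.\<close>

lemma rung_first: "rung 0 0"
proof -
  obtain i j where "rung 0 j" "rung i 0" using end_rung_p end_rung_q by metis
  then show ?thesis using rung_mono[of 0 j i 0] by (cases i) auto
qed

lemma rung_last: "rung (k - 1) (l - 1)"
proof -
  obtain i j where ij: "rung (k - 1) j" "rung i (l - 1)" using end_rung_p end_rung_q by metis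
  show ?thesis
  proof (cases "i < k - 1")
    case True
    then have "l - 1 \<le> j" using rung_mono[OF ij(2,1)] by simp
    then have "j = l - 1" using ij(1) by (auto simp: rung_def)
    then show ?thesis using ij(1) by simp
  next
    case False
    then have "i = k - 1" using ij(2) by (auto simp: rung_def)
    then show ?thesis using ij(2) by simp
  qed
qed

text \<open>Two single vertices would span at most one edge, against the degree condition. So the
  first and the last rung are distinct and there is at least one cell.\<close>

lemma rungs_differ: "k - 1 \<noteq> 0 \<or> l - 1 \<noteq> 0"
proof (rule ccontr)
  assume "\<not> ?thesis"
  then have kl1: "k = 1" "l = 1" using kl by auto
  obtain a b where ab: "a \<noteq> b" "{p 0, a} \<in> E" "{p 0, b} \<in> E" "a \<noteq> p 0" "b \<noteq> p 0"
    using degree_two_neighbours[OF simple degree[of "p 0"]] by metis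
  then show False using cover[of a] cover[of b] kl1 by auto
qed

definition initial :: "nat \<Rightarrow> nat \<Rightarrow> 'n set" where
  "initial i j = p ` {..i} \<union> q ` {..j}"

definition initial_graph :: "nat \<Rightarrow> nat \<Rightarrow> 'n set set" where
  "initial_graph i j = {e \<in> E. e \<subseteq> initial i j}"

text \<open>The boundary of the region between the rungs \<open>(a, b)\<close> and
  \<open>(i, j)\<close>. One of the two path segments may be empty, in which case the rungs share a
  vertex.\<close>

definition cell :: "nat \<Rightarrow> nat \<Rightarrow> nat \<Rightarrow> nat \<Rightarrow> 'n set set" where
  "cell a b i j = {{p i, q j}, {p a, q b}} \<union> {{p t, p (Suc t)} | t. a \<le> t \<and> t < i} \<union> {{q t, q (Suc t)} | t. b \<le> t \<and> t < j}"

text \<open>Walk up the first path and back down the second. The strict inequality on one side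
  supplies the third vertex.\<close>

lemma is_cycle_cell:
  assumes "a \<le> i" "b \<le> j" "i < k" "j < l" "a < i \<or> b < j"
  shows "is_cycle (cell a b i j)"
proof -
  let ?ps = "map p [a..<Suc i]" and ?qs = "map q [b..<Suc j]"
  let ?xs = "?ps @ rev ?qs"
  have ne: "?ps \<noteq> []" "?qs \<noteq> []" using assms by auto
  have "path_edges ?xs = path_edges ?ps \<union> path_edges ?qs \<union> {{last ?ps, hd (rev ?qs)}}"
    using ne by (simp add: path_edges_append path_edges_rev del: upt_Suc)
  moreover have "last ?ps = p i" "hd (rev ?qs) = q j" "hd ?xs = p a" "last ?xs = q b"
    using assms ne by (simp_all add: hd_append hd_rev last_rev hd_map last_map hd_upt last_upt del: upt_Suc)
  ultimately have "insert {last ?xs, hd ?xs} (path_edges ?xs) = cell a b i j"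
    unfolding cell_def by (auto simp: path_edges_map_upt insert_commute simp del: upt_Suc)
  moreover have "distinct ?xs"
    using assms p_inj q_inj pq by (auto simp: distinct_map inj_on_def simp del: upt_Suc)
  moreover have "3 \<le> length ?xs" using assms by (auto simp del: upt_Suc)
  ultimately show ?thesis using is_cycle_list[of ?xs] by simp
qed

lemma Union_cell: "a \<le> i \<Longrightarrow> b \<le> j \<Longrightarrow> \<Union>(cell a b i j) \<subseteq> p ` {a..i} \<union> q ` {b..j}"
  by (fastforce simp: cell_def)

text \<open>By \<open>pred\<close> no rung other than \<open>(i, j)\<close> is new, and on each path
  exactly the edges beyond \<open>a\<close> or \<open>b\<close> are added; these are the edges of
  the cell.\<close>

lemma initial_graph_extend:
  assumes ab: "rung a b" "a \<le> i" "b \<le> j" and ij: "rung i j"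
    and pred: "\<And>c d. rung c d \<Longrightarrow> c \<le> i \<Longrightarrow> d \<le> j \<Longrightarrow> (c, d) \<noteq> (i, j) \<Longrightarrow> c \<le> a \<and> d \<le> b"
  shows "initial_graph i j = initial_graph a b \<union> cell a b i j"
proof
  have ijk: "i < k" "j < l" using ij by (auto simp: rung_def)
  have "{p t, p (Suc t)} \<in> E" if "t < i" for t using pp[of t "Suc t"] ijk that by auto
  moreover have "{q t, q (Suc t)} \<in> E" if "t < j" for t using qq[of t "Suc t"] ijk that by auto
  ultimately have "cell a b i j \<subseteq> E" using ab ij by (auto simp: cell_def rung_def)
  moreover have "e \<subseteq> initial i j" if "e \<in> cell a b i j" for e
  proof -
    have "e \<subseteq> p ` {a..i} \<union> q ` {b..j}" using Union_cell[OF ab(2,3)] that by blast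
    then show ?thesis by (auto simp: initial_def)
  qed
  moreover have "initial a b \<subseteq> initial i j" using ab by (auto simp: initial_def)
  ultimately show "initial_graph a b \<union> cell a b i j \<subseteq> initial_graph i j"
    by (auto simp: initial_graph_def)
  have mixed: "{p c, q d} \<in> initial_graph a b \<union> cell a b i j" if "{p c, q d} \<in> E" "c \<le> i" "d \<le> j" for c d
  proof (cases "(c, d) = (i, j)")
    case True
    then show ?thesis by (simp add: cell_def)
  next
    case False
    then have "c \<le> a \<and> d \<le> b" using that ijk by (intro pred) (auto simp: rung_def)
    then show ?thesis using that(1) by (auto simp: initial_graph_def initial_def)
  qed
  have pedge: "{p c, p (Suc c)} \<in> initial_graph a b \<union> cell a b i j" if "{p c, p (Suc c)} \<in> E" "Suc c \<le> i" for c
  proof (cases "Suc c \<le> a")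
    case True
    then show ?thesis using that(1) by (auto simp: initial_graph_def initial_def)
  next
    case False
    then have "a \<le> c \<and> c < i" using that(2) by simp
    then show ?thesis unfolding cell_def by blast
  qed
  have qedge: "{q c, q (Suc c)} \<in> initial_graph a b \<union> cell a b i j" if "{q c, q (Suc c)} \<in> E" "Suc c \<le> j" for c
  proof (cases "Suc c \<le> b")
    case True
    then show ?thesis using that(1) by (auto simp: initial_graph_def initial_def)
  next
    case False
    then have "b \<le> c \<and> c < j" using that(2) by simp
    then show ?thesis unfolding cell_def by blast
  qed
  show "initial_graph i j \<subseteq> initial_graph a b \<union> cell a b i j"
  proof
    fix e assume "e \<in> initial_graph i j"
    then have e: "e \<in> E" "e \<subseteq> initial i j" by (auto simp: initial_graph_def)
    then obtain x y where xy: "e = {x, y}" using simple by (metis card_2_iff simple_graph_def)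
    have "x \<in> initial i j" "y \<in> initial i j" using e xy by auto
    then consider c d where "c \<le> i" "d \<le> i" "x = p c" "y = p d" | c d where "c \<le> j" "d \<le> j" "x = q c" "y = q d"
      | c d where "c \<le> i" "d \<le> j" "x = p c" "y = q d" | c d where "c \<le> i" "d \<le> j" "y = p c" "x = q d"
      unfolding initial_def by blast
    then show "e \<in> initial_graph a b \<union> cell a b i j"
    proof cases
      case 1
      then have "d = Suc c \<or> c = Suc d" using e(1) xy ijk pp[of c d] by auto
      then show ?thesis using pedge[of c] pedge[of d] e(1) xy 1 by (auto simp: insert_commute)
    next
      case 2
      then have "d = Suc c \<or> c = Suc d" using e(1) xy ijk qq[of c d] by auto
      then show ?thesis using qedge[of c] qedge[of d] e(1) xy 2 by (auto simp: insert_commute)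
    next
      case 3
      then show ?thesis using mixed[of c d] e(1) xy by simp
    next
      case 4
      then show ?thesis using mixed[of c d] e(1) xy by (simp add: insert_commute)
    qed
  qed
qed

text \<open>Maximize the coordinate sum among the rungs below \<open>(i, j)\<close>. Since rungs are
  comparable, the maximizer dominates all the others coordinatewise.\<close>

lemma predecessor:
  assumes "rung i j" "(i, j) \<noteq> (0, 0)"
  obtains a b where "rung a b" "a \<le> i" "b \<le> j" "a < i \<or> b < j"
    "\<And>c d. rung c d \<Longrightarrow> c \<le> i \<Longrightarrow> d \<le> j \<Longrightarrow> (c, d) \<noteq> (i, j) \<Longrightarrow> c \<le> a \<and> d \<le> b"
proof -
  let ?P = "\<lambda>x. rung (fst x) (snd x) \<and> fst x \<le> i \<and> snd x \<le> j \<and> x \<noteq> (i, j)"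
  have P: "?P (0, 0)" using rung_first assms by auto
  have bound: "\<forall>x. ?P x \<longrightarrow> fst x + snd x < Suc (i + j)" by auto
  obtain x where "?P x \<and> (\<forall>y. ?P y \<longrightarrow> fst y + snd y \<le> fst x + snd x)"
    using ex_has_greatest_nat[of ?P, OF P bound] by (elim exE)
  then obtain a b where ab: "?P (a, b)" and max: "\<And>c d. ?P (c, d) \<Longrightarrow> c + d \<le> a + b" by (cases x) auto
  have "c \<le> a \<and> d \<le> b" if "rung c d" "c \<le> i" "d \<le> j" "(c, d) \<noteq> (i, j)" for c d
    using rung_comparable[of c d a b] max[of c d] ab that by auto
  then show thesis using that[of a b] ab by auto
qed

text \<open>Induction along the rungs: the cell between a rung and its predecessor is glued on at
  the predecessor, which is the free edge of the chain built so far.\<close>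

lemma chain_to_rung:
  assumes "rung i j" "(i, j) \<noteq> (0, 0)"
  shows "\<exists>Cs As. chain_tip (initial_graph i j) Cs As {p i, q j}"
  using assms
proof (induction "i + j" arbitrary: i j rule: less_induct)
  case less
  obtain a b where ab: "rung a b" "a \<le> i" "b \<le> j" "a < i \<or> b < j"
    and pred: "\<And>c d. rung c d \<Longrightarrow> c \<le> i \<Longrightarrow> d \<le> j \<Longrightarrow> (c, d) \<noteq> (i, j) \<Longrightarrow> c \<le> a \<and> d \<le> b"
    using predecessor[OF less.prems] by metis
  have ijk: "i < k" "j < l" using less.prems by (auto simp: rung_def)
  have ext: "initial_graph i j = initial_graph a b \<union> cell a b i j"
    by (rule initial_graph_extend[OF ab(1-3) less.prems(1) pred])
  have cyc: "is_cycle (cell a b i j)" by (rule is_cycle_cell[OF ab(2,3) ijk ab(4)])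
  have in_cell: "{p i, q j} \<in> cell a b i j" "{p a, q b} \<in> cell a b i j" by (auto simp: cell_def)
  show ?case
  proof (cases "(a, b) = (0, 0)")
    case True
    \<comment> \<open>In front of the first cell there is only the rung \<open>(0, 0)\<close>, which
      the cell already contains; the chain starts with this cell.\<close>
    have "initial_graph a b \<subseteq> {{p a, q b}}"
    proof
      fix e assume "e \<in> initial_graph a b"
      then have e: "card e = 2" "e \<subseteq> {p a, q b}"
        using True simple by (auto simp: initial_graph_def initial_def simple_graph_def)
      then have "e = {p a, q b}" by (intro card_seteq) (auto intro: order_trans[OF card_insert_le_m1])
      then show "e \<in> {{p a, q b}}" by simp
    qed
    then have "initial_graph i j = cell a b i j" using ext in_cell by auto
    then show ?thesis using chain_tip_start[OF cyc in_cell(1)] by auto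
  next
    case False
    have "a + b < i + j" using ab by auto
    then obtain Cs As where tip: "chain_tip (initial_graph a b) Cs As {p a, q b}"
      using less.hyps[OF _ ab(1) False] by blast
    have m1: "{p a, q b} \<in> initial_graph a b" using ab(1) by (auto simp: initial_graph_def initial_def rung_def)
    have m2: "\<Union>(initial_graph a b) \<subseteq> initial a b" by (auto simp: initial_graph_def)
    have m3: "initial a b \<inter> (p ` {a..i} \<union> q ` {b..j}) \<subseteq> {p a, q b}"
    proof
      fix x assume x: "x \<in> initial a b \<inter> (p ` {a..i} \<union> q ` {b..j})"
      then have "x \<in> p ` {..a} \<or> x \<in> q ` {..b}" "x \<in> p ` {a..i} \<or> x \<in> q ` {b..j}"
        by (auto simp: initial_def)
      moreover have "p ` {..a} \<subseteq> p ` {..i}" "p ` {a..i} \<subseteq> p ` {..i}" "q ` {..b} \<subseteq> q ` {..j}" "q ` {b..j} \<subseteq> q ` {..j}"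
        using ab by (auto intro!: image_mono)
      ultimately consider "x \<in> p ` {..a}" "x \<in> p ` {a..i}" | "x \<in> q ` {..b}" "x \<in> q ` {b..j}"
        | "x \<in> p ` {..i}" "x \<in> q ` {..j}" by blast
      then show "x \<in> {p a, q b}"
      proof cases
        case 1
        then obtain c d where "c \<le> a" "a \<le> d" "d \<le> i" "x = p c" "x = p d" by auto
        moreover from this have "c = d" using p_inj[of c d] ijk ab by simp
        ultimately show ?thesis by simp
      next
        case 2
        then obtain c d where "c \<le> b" "b \<le> d" "d \<le> j" "x = q c" "x = q d" by auto
        moreover from this have "c = d" using q_inj[of c d] ijk ab by simp
        ultimately show ?thesis by simp
      next
        case 3
        then obtain c d where "c \<le> i" "d \<le> j" "x = p c" "x = q d" by auto
        then show ?thesis using pq[of c d] ijk by simp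
      qed
    qed
    have int: "\<Union>(initial_graph a b) \<inter> \<Union>(cell a b i j) = {p a, q b}"
    proof
      show "\<Union>(initial_graph a b) \<inter> \<Union>(cell a b i j) \<subseteq> {p a, q b}"
        using m2 m3 Union_cell[OF ab(2,3)] by (meson Int_mono order_trans)
      show "{p a, q b} \<subseteq> \<Union>(initial_graph a b) \<inter> \<Union>(cell a b i j)"
        using Union_upper[OF m1] Union_upper[OF in_cell(2)] by (rule Int_greatest)
    qed
    \<comment> \<open>At least one coordinate moves strictly, so an end of the new rung is a new
      vertex and the rung is not an old edge.\<close>
    have "p i \<notin> initial a b \<or> q j \<notin> initial a b"
    proof (cases "a < i")
      case True
      have "p i \<noteq> p c" if "c \<le> a" for c using p_inj[of i c] that True ijk by auto
      moreover have "p i \<noteq> q d" if "d \<le> b" for d using pq[of i d] that ab(3) ijk by simp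
      ultimately have "p i \<notin> initial a b" unfolding initial_def by blast
      then show ?thesis ..
    next
      case False
      then have bj: "b < j" using ab by simp
      have "q j \<noteq> q d" if "d \<le> b" for d using q_inj[of j d] that bj ijk by auto
      moreover have "q j \<noteq> p c" if "c \<le> a" for c using pq[of c j] that ab(2) ijk by auto
      ultimately have "q j \<notin> initial a b" unfolding initial_def by blast
      then show ?thesis ..
    qed
    then have "{p i, q j} \<notin> initial_graph a b" by (auto simp: initial_graph_def)
    from chain_tip_attach[OF tip cyc in_cell(2) int in_cell(1) this]
    show ?thesis unfolding ext by blast
  qed
qed

lemma lseac: "lseac_graph E"
proof -
  have "(k - 1, l - 1) \<noteq> (0, 0)" using rungs_differ by auto
  then obtain Cs As where tip: "chain_tip (initial_graph (k - 1) (l - 1)) Cs As {p (k - 1), q (l - 1)}"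
    using chain_to_rung[OF rung_last] by blast
  have "v \<in> initial (k - 1) (l - 1)" for v
    using cover[of v] by (auto simp: initial_def)
  then have "initial_graph (k - 1) (l - 1) = E" by (auto simp: initial_graph_def)
  then have "seac E Cs As" "\<forall>X\<in>Cs. card {Y \<in> Cs. neighbors As X Y} \<le> 2"
    using tip by (auto simp: chain_tip_def)
  moreover have "\<Union>E = UNIV"
  proof -
    have "v \<in> \<Union>E" for v using degree_two_neighbours[OF simple degree[of v]] by blast
    then show ?thesis by auto
  qed
  ultimately show ?thesis unfolding lseac_graph_def by blast
qed

end

lemma two_parallel_paths_lseac:
  fixes E :: "'n::finite set set"
  assumes E: "simple_graph E" "C2_graph E" and "two_parallel_paths E"
  shows "lseac_graph E"
proof -
  obtain ps qs where ps: "induced_path E ps" and qs: "induced_path E qs"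
    and disj: "set ps \<inter> set qs = {}" and cov: "set ps \<union> set qs = UNIV" and nc: "\<not> crossing E ps qs"
    using assms(3) by (auto simp: two_parallel_paths_def)
  interpret parallel_paths E "(!) ps" "(!) qs" "length ps" "length qs"
  proof
    show "ps ! i \<noteq> qs ! j" if "i < length ps" "j < length qs" for i j
      using disj nth_mem[OF that(1)] nth_mem[OF that(2)] by auto
    show "(\<exists>i<length ps. v = ps ! i) \<or> (\<exists>j<length qs. v = qs ! j)" for v
      using cov by (metis UNIV_I Un_iff in_set_conv_nth)
    show "j \<le> b" if "a < length ps" "j < length qs" "{ps ! i, qs ! j} \<in> E" "{ps ! a, qs ! b} \<in> E" "i < a" for i j a b
      using nc that unfolding crossing_def by (meson not_le)
  qed (use E ps qs in \<open>auto simp: induced_path_def nth_eq_iff_index_eq\<close>)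
  show ?thesis by (rule lseac)
qed

section \<open>The characterization\<close>

lemma finite_multiplicities:
  "finite {eig_multiplicity A c | A c. A \<in> sym_matrices (E :: 'n::finite set set) \<and> is_eigenvalue A c}"
proof (rule finite_subset)
  show "{eig_multiplicity A c | A c. A \<in> sym_matrices E \<and> is_eigenvalue A c} \<subseteq> {..CARD('n)}"
  proof
    fix k assume "k \<in> {eig_multiplicity A c | A c. A \<in> sym_matrices E \<and> is_eigenvalue A c}"
    then obtain A :: "real^'n^'n" and c where "k = dim {x. A *v x = c *\<^sub>R x}"
      by (auto simp: eig_multiplicity_def)
    then show "k \<in> {..CARD('n)}" using dim_subset_UNIV[of "{x. A *v x = c *\<^sub>R x}"] by simp
  qed
qed simp

lemma is_eigenvalue_zeroI:
  fixes A :: "real^'n^'n"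
  assumes "0 < dim {x. A *v x = 0}"
  shows "is_eigenvalue A 0"
proof (rule ccontr)
  assume "\<not> is_eigenvalue A 0"
  then have "{x. A *v x = 0} \<subseteq> {0}" by (auto simp: is_eigenvalue_def)
  then have "dim {x. A *v x = 0} = 0" by (simp only: dim_eq_0)
  with assms show False by (metis less_irrefl)
qed

lemma nullity_attained_max_multiplicity:
  fixes E :: "'n::finite set set"
  assumes "nullity_attained E k" "0 < k"
  shows "k \<le> max_multiplicity E"
proof -
  obtain A where A: "A \<in> sym_matrices E" "k \<le> dim {x. A *v x = 0}"
    using assms(1) by (auto simp: nullity_attained_def)
  then have "is_eigenvalue A 0" using assms(2) by (intro is_eigenvalue_zeroI) auto
  then have "eig_multiplicity A 0 \<le> max_multiplicity E"
    unfolding max_multiplicity_def using A(1) by (intro Max_ge finite_multiplicities) blast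
  then show ?thesis using A(2) by (simp add: eig_multiplicity_def)
qed

text \<open>The lower bound is the two-branch-set construction, the upper bound is zero forcing. The
  matrix of nullity two also shows that the maximum is taken over a nonempty set.\<close>

lemma lseac_max_multiplicity:
  fixes E :: "'n::finite set set"
  assumes "simple_graph E" "C2_graph E" "lseac_graph E"
  shows "max_multiplicity E = 2"
proof (rule antisym)
  show two: "2 \<le> max_multiplicity E"
    using nullity_attained_max_multiplicity[OF C2_nullity_two[OF assms(1,2)]] by simp
  let ?S = "{eig_multiplicity A c | A c. A \<in> sym_matrices E \<and> is_eigenvalue A c}"
  have "?S \<noteq> {}"
  proof -
    obtain A where A: "A \<in> sym_matrices E" "2 \<le> dim {x. A *v x = 0}"
      using C2_nullity_two[OF assms(1,2)] by (auto simp: nullity_attained_def)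
    then have "is_eigenvalue A 0" by (intro is_eigenvalue_zeroI) auto
    then show ?thesis using A(1) by blast
  qed
  then have "max_multiplicity E \<in> ?S"
    unfolding max_multiplicity_def by (rule Max_in[OF finite_multiplicities])
  then show "max_multiplicity E \<le> 2"
    using lseac_eig_multiplicity_le[OF assms(3)] by auto
qed

theorem theorem4p9:
  fixes E :: "'n::finite set set"
  assumes "simple_graph E" and "C2_graph E"
  shows "(max_multiplicity E = 2 \<longleftrightarrow> two_parallel_paths E) \<and>
         (two_parallel_paths E \<longleftrightarrow> lseac_graph E)"
proof -
  have "two_parallel_paths E" if "max_multiplicity E = 2"
  proof (rule low_nullity_two_parallel_paths[OF assms])
    \<comment> \<open>A nullity of three would make zero an eigenvalue of multiplicity at least
      three.\<close>
    show "\<not> nullity_attained E 3"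
      using nullity_attained_max_multiplicity[of E 3] that by auto
  qed
  then show ?thesis
    using two_parallel_paths_lseac[OF assms] lseac_max_multiplicity[OF assms] by blast
qed

end
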